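(* Let $(M,\mathbf{I},\mathbf{J},\mathbf{K},g)$ be a hyper-Kähler manifold with $\dim_{\mathbb{C}}M=r$, let $Q$ be a Kähler manifold with Kähler form $\omega_Q$ and $\dim_{\mathbb{C}}Q=n$ (neither $M$ nor $Q$ need be compact), and let $h:Q\to\mathbb{P}^1$ be a holomorphic map. Let $(X,\underline{\mathbf{I}})$, with $X=M\times Q$, be the higher analog of the twistor space of $M$ determined by $h$, and let $\omega_M$ be the associated form on $X$. Then, for any positive constant $t$, $\omega_M+t\omega_Q$ is a balanced metric (not Kählerian) on $X$.
   Context: A hypercomplex manifold $(M,\mathbf{I},\mathbf{J},\mathbf{K},g)$ is a smooth manifold with integrable complex structures $\mathbf{I},\mathbf{J},\mathbf{K}:TM\to TM$ satisfying $\mathbf{I}^2=\mathbf{J}^2=\mathbf{K}^2=-1$, $\mathbf{I}\mathbf{J}=\mathbf{K}$, $\mathbf{J}\mathbf{K}=\mathbf{I}$, $\mathbf{K}\mathbf{I}=\mathbf{J}$, together with a Riemannian metric $g$ compatible with $\mathbf{I},\mathbf{J},\mathbf{K}$; its complex dimension $r=2k$ is even. Put $\omega_{\mathbf{I}}=g(\mathbf{I}\cdot,\cdot)$, $\omega_{\mathbf{J}}=g(\mathbf{J}\cdot,\cdot)$, $\omega_{\mathbf{K}}=g(\mathbf{K}\cdot,\cdot)$. It is hyper-Kähler if $\omega_{\mathbf{I}},\omega_{\mathbf{J}},\omega_{\mathbf{K}}$ are all closed. The higher analog of the twistor space: let $I$ be the complex structure of $Q$, let $[Z_1,Z_2]$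 be homogeneous coordinates on $\mathbb{P}^1$ and $\zeta=Z_1/Z_2$. For $q\in Q$ with $h(q)=[Z_1,Z_2]$, set on $T_mM$ (for every $m\in M$) $$\mathbf{I}_M=\frac{|Z_2|^2-|Z_1|^2}{|Z_1|^2+|Z_2|^2}\mathbf{I}+\frac{Z_1\overline{Z}_2+\overline{Z}_1Z_2}{|Z_1|^2+|Z_2|^2}\mathbf{J}+\sqrt{-1}\,\frac{\overline{Z}_1Z_2-Z_1\overline{Z}_2}{|Z_1|^2+|Z_2|^2}\mathbf{K},$$ and on $T_{(m,q)}X=T_mM\oplus T_qQ$ put $\underline{\mathbf{I}}=(\mathbf{I}_M,I)$; this is an integrable complex structure on $X=M\times Q$ when $h$ is holomorphic. The form $\omega_M$ on $X$ is $\omega_M=g(\mathbf{I}_M\cdot,\cdot)$ (acting on the $TM$ component), i.e. with $\zeta=\zeta(q)$ the expression of $h$ in the affine coordinate, $$\omega_M=\frac{1-|\zeta|^2}{1+|\zeta|^2}\omega_{\mathbf{I}}+\frac{\zeta+\overline{\zeta}}{1+|\zeta|^2}\omega_{\mathbf{J}}+\sqrt{-1}\,\frac{\overline{\zeta}-\zeta}{1+|\zeta|^2}\omega_{\mathbf{K}}.$$ $\omega_Q$ also denotes its pullback to $X$. A balanced metric on a complex manifold $P$ with $\dim_{\mathbb{C}}P=p$ is a positive definite $(1,1)$-form $\xi$ on $P$ with $\mathrm{d}\xi^{p-1}=0$.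
   Formalization: "Not Kählerian" is proved when h is not locally constant (for connected Q: not constant) and M is nonempty; for constant h the form is a Kähler product form, so the parenthesis fails there. The balanced claim holds for every holomorphic h. *)

theory Defs
  imports "HOL-Analysis.Analysis" "HOL-Combinatorics.Permutations"
begin

section \<open>Smooth functions on open subsets of Euclidean spaces\<close>

text \<open>\<open>C^k\<close> on an open set, by recursion over directional derivatives. In finite dimension this is
  the usual notion.\<close>

primrec Ck_on :: "nat \<Rightarrow> 'a::euclidean_space set \<Rightarrow> ('a \<Rightarrow> 'b::real_normed_vector) \<Rightarrow> bool" where
  "Ck_on 0 S f \<longleftrightarrow> continuous_on S f"
| "Ck_on (Suc k) S f \<longleftrightarrow> (\<forall>x\<in>S. f differentiable (at x)) \<and>
     (\<forall>v. Ck_on k S (\<lambda>x. frechet_derivative f (at x) v))"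

definition smooth_on :: "'a::euclidean_space set \<Rightarrow> ('a \<Rightarrow> 'b::real_normed_vector) \<Rightarrow> bool" where
  "smooth_on S f \<longleftrightarrow> (\<forall>k. Ck_on k S f)"


section \<open>Smooth manifolds\<close>

text \<open>A manifold is a topological space on a set of points of type \<open>'a\<close>, together with an atlas
  indexed by \<open>idx\<close>, with coordinates in the Euclidean space \<open>'m\<close>; the real dimension is
  \<open>DIM('m)\<close>. Neither connectedness nor compactness is required.\<close>

record ('i, 'a, 'm) manifold =
  mtop :: "'a topology"
  idx :: "'i set"
  dom :: "'i \<Rightarrow> 'a set"
  coord :: "'i \<Rightarrow> 'a \<Rightarrow> 'm"

definition inv_coord :: "('i, 'a, 'm) manifold \<Rightarrow> 'i \<Rightarrow> 'm \<Rightarrow> 'a" where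
  "inv_coord A i = inv_into (dom A i) (coord A i)"

definition smooth_manifold :: "('i, 'a, 'm::euclidean_space) manifold \<Rightarrow> bool" where
  "smooth_manifold A \<longleftrightarrow>
     Hausdorff_space (mtop A) \<and> second_countable (mtop A) \<and>
     (\<Union>i\<in>idx A. dom A i) = topspace (mtop A) \<and>
     (\<forall>i\<in>idx A. openin (mtop A) (dom A i) \<and> open (coord A i ` dom A i) \<and>
        homeomorphic_map (subtopology (mtop A) (dom A i)) (top_of_set (coord A i ` dom A i))
          (coord A i)) \<and>
     (\<forall>i\<in>idx A. \<forall>j\<in>idx A.
        smooth_on (coord A i ` (dom A i \<inter> dom A j)) (coord A j \<circ> inv_coord A i))"

text \<open>The coordinate expression at \<open>p\<close> of the differential of a map \<open>f\<close>, with respect to the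
  charts \<open>i\<close> and \<open>j\<close> around \<open>p\<close> and \<open>f p\<close>.\<close>

definition mdiff :: "('i, 'a, 'm::euclidean_space) manifold \<Rightarrow> ('j, 'b, 'n::euclidean_space) manifold \<Rightarrow>
    ('a \<Rightarrow> 'b) \<Rightarrow> 'i \<Rightarrow> 'j \<Rightarrow> 'a \<Rightarrow> 'm \<Rightarrow> 'n" where
  "mdiff A B f i j p =
     frechet_derivative (coord B j \<circ> f \<circ> inv_coord A i) (at (coord A i p))"

definition smooth_map :: "('i, 'a, 'm::euclidean_space) manifold \<Rightarrow>
    ('j, 'b, 'n::euclidean_space) manifold \<Rightarrow> ('a \<Rightarrow> 'b) \<Rightarrow> bool" where
  "smooth_map A B f \<longleftrightarrow> continuous_map (mtop A) (mtop B) f \<and>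
     (\<forall>i\<in>idx A. \<forall>j\<in>idx B.
        smooth_on (coord A i ` {p \<in> dom A i. f p \<in> dom B j}) (coord B j \<circ> f \<circ> inv_coord A i))"

text \<open>The tangent bundle is the bundle glued from the sets \<open>dom i \<times> 'm\<close> by the
  differentials \<open>tchange\<close> of the coordinate changes. Accordingly, tensor fields are given by their
  components \<open>T i p\<close> in the chart \<open>i\<close> at the point \<open>p\<close>, which have to be compatible with
  \<open>tchange\<close>. Only the values with \<open>i \<in> idx\<close> and \<open>p \<in> dom i\<close> matter.\<close>

definition tchange :: "('i, 'a, 'm::euclidean_space) manifold \<Rightarrow> 'i \<Rightarrow> 'i \<Rightarrow> 'a \<Rightarrow> 'm \<Rightarrow> 'm" where
  "tchange A i j p = mdiff A A id i j p"

type_synonym ('i, 'a, 'm) endo_field = "'i \<Rightarrow> 'a \<Rightarrow> 'm \<Rightarrow> 'm"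
type_synonym ('i, 'a, 'm) metric_field = "'i \<Rightarrow> 'a \<Rightarrow> 'm \<Rightarrow> 'm \<Rightarrow> real"
type_synonym ('i, 'a, 'm) form_field = "'i \<Rightarrow> 'a \<Rightarrow> (nat \<Rightarrow> 'm) \<Rightarrow> real"

definition endomorphism_field ::
    "('i, 'a, 'm::euclidean_space) manifold \<Rightarrow> ('i, 'a, 'm) endo_field \<Rightarrow> bool" where
  "endomorphism_field A J \<longleftrightarrow>
     (\<forall>i\<in>idx A. (\<forall>p\<in>dom A i. linear (J i p)) \<and>
        (\<forall>v. smooth_on (coord A i ` dom A i) (\<lambda>x. J i (inv_coord A i x) v))) \<and>
     (\<forall>i\<in>idx A. \<forall>j\<in>idx A. \<forall>p \<in> dom A i \<inter> dom A j. \<forall>v.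
        tchange A i j p (J i p v) = J j p (tchange A i j p v))"

definition riemannian_metric ::
    "('i, 'a, 'm::euclidean_space) manifold \<Rightarrow> ('i, 'a, 'm) metric_field \<Rightarrow> bool" where
  "riemannian_metric A g \<longleftrightarrow>
     (\<forall>i\<in>idx A. (\<forall>p\<in>dom A i. bilinear (g i p) \<and> (\<forall>u v. g i p u v = g i p v u) \<and>
           (\<forall>u. u \<noteq> 0 \<longrightarrow> g i p u u > 0)) \<and>
        (\<forall>u v. smooth_on (coord A i ` dom A i) (\<lambda>x. g i (inv_coord A i x) u v))) \<and>
     (\<forall>i\<in>idx A. \<forall>j\<in>idx A. \<forall>p \<in> dom A i \<inter> dom A j. \<forall>u v.
        g j p (tchange A i j p u) (tchange A i j p v) = g i p u v)"


section \<open>Differential forms\<close>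

text \<open>A \<open>k\<close>-form at a point is a function of a sequence of vectors, of which it only sees the
  entries \<open>0, \<dots>, k - 1\<close>.\<close>

definition alternating_form :: "nat \<Rightarrow> ((nat \<Rightarrow> 'm::real_vector) \<Rightarrow> real) \<Rightarrow> bool" where
  "alternating_form k a \<longleftrightarrow>
     (\<forall>v w. (\<forall>j<k. v j = w j) \<longrightarrow> a v = a w) \<and>
     (\<forall>j<k. \<forall>v. linear (\<lambda>x. a (v(j := x)))) \<and>
     (\<forall>v i j. i < j \<and> j < k \<and> v i = v j \<longrightarrow> a v = 0)"

definition diff_form ::
    "nat \<Rightarrow> ('i, 'a, 'm::euclidean_space) manifold \<Rightarrow> ('i, 'a, 'm) form_field \<Rightarrow> bool" where
  "diff_form k A \<alpha> \<longleftrightarrow>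
     (\<forall>i\<in>idx A. (\<forall>p\<in>dom A i. alternating_form k (\<alpha> i p)) \<and>
        (\<forall>v. smooth_on (coord A i ` dom A i) (\<lambda>x. \<alpha> i (inv_coord A i x) v))) \<and>
     (\<forall>i\<in>idx A. \<forall>j\<in>idx A. \<forall>p \<in> dom A i \<inter> dom A j. \<forall>v.
        \<alpha> j p (\<lambda>l. tchange A i j p (v l)) = \<alpha> i p v)"

text \<open>The wedge product of a \<open>k\<close>-form and an \<open>l\<close>-form, normalised such that
  \<open>dx\<^sub>1 \<and> \<dots> \<and> dx\<^sub>n\<close> is the determinant.\<close>

definition wedge :: "nat \<Rightarrow> nat \<Rightarrow> ('i, 'a, 'm) form_field \<Rightarrow> ('i, 'a, 'm) form_field \<Rightarrow>
    ('i, 'a, 'm) form_field" where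
  "wedge k l \<alpha> \<beta> = (\<lambda>i p v.
     (\<Sum>\<pi> | \<pi> permutes {..<k + l}.
        of_int (sign \<pi>) * \<alpha> i p (\<lambda>j. v (\<pi> j)) * \<beta> i p (\<lambda>j. v (\<pi> (k + j)))) / (fact k * fact l))"

text \<open>\<open>form_power k \<alpha> s\<close> is the \<open>s\<close>-th exterior power \<open>\<alpha>\<^sup>s\<close> of a \<open>k\<close>-form,
  which is a \<open>k * s\<close>-form.\<close>

primrec form_power :: "nat \<Rightarrow> ('i, 'a, 'm) form_field \<Rightarrow> nat \<Rightarrow> ('i, 'a, 'm) form_field" where
  "form_power k \<alpha> 0 = (\<lambda>i p v. 1)"
| "form_power k \<alpha> (Suc s) = wedge (k * s) k (form_power k \<alpha> s) \<alpha>"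

text \<open>The exterior derivative of a \<open>k\<close>-form, in coordinates:
  \<open>d\<alpha>(v\<^sub>0, \<dots>, v\<^sub>k) = \<Sum>\<^sub>s (-1)\<^sup>s D\<alpha>(v\<^sub>s)(v\<^sub>0, \<dots>, v\<^sub>s omitted, \<dots>, v\<^sub>k)\<close>.\<close>

definition ext_deriv :: "nat \<Rightarrow> ('i, 'a, 'm::euclidean_space) manifold \<Rightarrow> ('i, 'a, 'm) form_field \<Rightarrow>
    ('i, 'a, 'm) form_field" where
  "ext_deriv k A \<alpha> = (\<lambda>i p v. \<Sum>s\<le>k. (-1) ^ s *
     frechet_derivative
       (\<lambda>x. \<alpha> i (inv_coord A i x) (\<lambda>j. if j < s then v j else v (Suc j)))
       (at (coord A i p)) (v s))"

definition closed_form ::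
    "nat \<Rightarrow> ('i, 'a, 'm::euclidean_space) manifold \<Rightarrow> ('i, 'a, 'm) form_field \<Rightarrow> bool" where
  "closed_form k A \<alpha> \<longleftrightarrow> (\<forall>i\<in>idx A. \<forall>p\<in>dom A i. \<forall>v. ext_deriv k A \<alpha> i p v = 0)"


section \<open>Complex manifolds\<close>

definition lie_bracket :: "('m::euclidean_space \<Rightarrow> 'm) \<Rightarrow> ('m \<Rightarrow> 'm) \<Rightarrow> 'm \<Rightarrow> 'm" where
  "lie_bracket X Y x =
     frechet_derivative Y (at x) (X x) - frechet_derivative X (at x) (Y x)"

text \<open>Integrability of an almost complex structure is the vanishing of its Nijenhuis tensor
  \<open>[JX, JY] - J[JX, Y] - J[X, JY] - [X, Y]\<close> on all smooth vector fields on coordinate domains.\<close>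

definition integrable_structure ::
    "('i, 'a, 'm::euclidean_space) manifold \<Rightarrow> ('i, 'a, 'm) endo_field \<Rightarrow> bool" where
  "integrable_structure A J \<longleftrightarrow>
     (\<forall>i\<in>idx A. \<forall>X Y. smooth_on (coord A i ` dom A i) X \<longrightarrow> smooth_on (coord A i ` dom A i) Y \<longrightarrow>
        (let J' = (\<lambda>x. J i (inv_coord A i x));
             JX = (\<lambda>x. J' x (X x));
             JY = (\<lambda>x. J' x (Y x))
         in \<forall>x \<in> coord A i ` dom A i.
              lie_bracket JX JY x - J' x (lie_bracket JX Y x) - J' x (lie_bracket X JY x)
                - lie_bracket X Y x = 0))"

text \<open>\<open>complex_manifold n A J\<close>: \<open>A\<close> with the complex structure \<open>J\<close> is a complex manifold of
  complex dimension \<open>n\<close>.\<close>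

definition complex_manifold ::
    "nat \<Rightarrow> ('i, 'a, 'm::euclidean_space) manifold \<Rightarrow> ('i, 'a, 'm) endo_field \<Rightarrow> bool" where
  "complex_manifold n A J \<longleftrightarrow> smooth_manifold A \<and> DIM('m) = 2 * n \<and>
     endomorphism_field A J \<and> (\<forall>i\<in>idx A. \<forall>p\<in>dom A i. \<forall>v. J i p (J i p v) = - v) \<and>
     integrable_structure A J"

definition holomorphic_map ::
    "('i, 'a, 'm::euclidean_space) manifold \<Rightarrow> ('i, 'a, 'm) endo_field \<Rightarrow>
     ('j, 'b, 'n::euclidean_space) manifold \<Rightarrow> ('j, 'b, 'n) endo_field \<Rightarrow> ('a \<Rightarrow> 'b) \<Rightarrow> bool" where
  "holomorphic_map A J B J' f \<longleftrightarrow> smooth_map A B f \<and>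
     (\<forall>i\<in>idx A. \<forall>j\<in>idx B. \<forall>p\<in>dom A i. f p \<in> dom B j \<longrightarrow>
        (\<forall>v. mdiff A B f i j p (J i p v) = J' j (f p) (mdiff A B f i j p v)))"

definition vec2 :: "'m \<Rightarrow> 'm \<Rightarrow> nat \<Rightarrow> 'm" where
  "vec2 u v = (\<lambda>l. if l = 0 then u else v)"

text \<open>A real 2-form is of type \<open>(1,1)\<close> if and only if it is invariant under \<open>J\<close>. The sign in the
  definition of positivity belongs to the convention \<open>\<omega> = g (J \<cdot>) \<cdot>\<close>, i.e. \<open>g u v = \<omega> u (J v)\<close>.\<close>

definition positive_11_form :: "('i, 'a, 'm::euclidean_space) manifold \<Rightarrow>
    ('i, 'a, 'm) endo_field \<Rightarrow> ('i, 'a, 'm) form_field \<Rightarrow> bool" where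
  "positive_11_form A J \<xi> \<longleftrightarrow> diff_form 2 A \<xi> \<and>
     (\<forall>i\<in>idx A. \<forall>p\<in>dom A i.
        (\<forall>u v. \<xi> i p (vec2 (J i p u) (J i p v)) = \<xi> i p (vec2 u v)) \<and>
        (\<forall>u. u \<noteq> 0 \<longrightarrow> \<xi> i p (vec2 u (J i p u)) > 0))"

definition kaehler :: "nat \<Rightarrow> ('i, 'a, 'm::euclidean_space) manifold \<Rightarrow>
    ('i, 'a, 'm) endo_field \<Rightarrow> ('i, 'a, 'm) form_field \<Rightarrow> bool" where
  "kaehler n A J \<omega> \<longleftrightarrow> complex_manifold n A J \<and> positive_11_form A J \<omega> \<and> closed_form 2 A \<omega>"

definition balanced_metric :: "nat \<Rightarrow> ('i, 'a, 'm::euclidean_space) manifold \<Rightarrow>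
    ('i, 'a, 'm) endo_field \<Rightarrow> ('i, 'a, 'm) form_field \<Rightarrow> bool" where
  "balanced_metric n A J \<xi> \<longleftrightarrow> complex_manifold n A J \<and> positive_11_form A J \<xi> \<and>
     closed_form (2 * (n - 1)) A (form_power 2 \<xi> (n - 1))"


section \<open>Hyper-Kaehler manifolds\<close>

definition fundamental_form ::
    "('i, 'a, 'm) metric_field \<Rightarrow> ('i, 'a, 'm) endo_field \<Rightarrow> ('i, 'a, 'm) form_field" where
  "fundamental_form g J = (\<lambda>i p v. g i p (J i p (v 0)) (v 1))"

definition hypercomplex :: "nat \<Rightarrow> ('i, 'a, 'm::euclidean_space) manifold \<Rightarrow>
    ('i, 'a, 'm) endo_field \<Rightarrow> ('i, 'a, 'm) endo_field \<Rightarrow> ('i, 'a, 'm) endo_field \<Rightarrow>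
    ('i, 'a, 'm) metric_field \<Rightarrow> bool" where
  "hypercomplex r M I J K g \<longleftrightarrow>
     complex_manifold r M I \<and> complex_manifold r M J \<and> complex_manifold r M K \<and>
     (\<forall>i\<in>idx M. \<forall>p\<in>dom M i. \<forall>v.
        I i p (J i p v) = K i p v \<and> J i p (K i p v) = I i p v \<and> K i p (I i p v) = J i p v) \<and>
     riemannian_metric M g \<and>
     (\<forall>i\<in>idx M. \<forall>p\<in>dom M i. \<forall>u v.
        g i p (I i p u) (I i p v) = g i p u v \<and> g i p (J i p u) (J i p v) = g i p u v \<and>
        g i p (K i p u) (K i p v) = g i p u v)"

definition hyperkaehler :: "nat \<Rightarrow> ('i, 'a, 'm::euclidean_space) manifold \<Rightarrow>
    ('i, 'a, 'm) endo_field \<Rightarrow> ('i, 'a, 'm) endo_field \<Rightarrow> ('i, 'a, 'm) endo_field \<Rightarrow>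
    ('i, 'a, 'm) metric_field \<Rightarrow> bool" where
  "hyperkaehler r M I J K g \<longleftrightarrow> hypercomplex r M I J K g \<and>
     closed_form 2 M (fundamental_form g I) \<and> closed_form 2 M (fundamental_form g J) \<and>
     closed_form 2 M (fundamental_form g K)"


section \<open>The projective line\<close>

definition cp1_rel :: "complex \<times> complex \<Rightarrow> complex \<times> complex \<Rightarrow> bool" where
  "cp1_rel z w \<longleftrightarrow> z \<noteq> 0 \<and> w \<noteq> 0 \<and> (\<exists>c. c \<noteq> 0 \<and> w = (c * fst z, c * snd z))"

lemma cp1_rel_part_equivp: "part_equivp cp1_rel"
proof (rule part_equivpI)
  have "cp1_rel (1, 1) (1, 1)"
    by (auto simp: cp1_rel_def zero_prod_def intro!: exI[of _ 1])
  then show "\<exists>z. cp1_rel z z" by blast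
  show "symp cp1_rel"
  proof (rule sympI)
    fix z w assume "cp1_rel z w"
    then obtain c where c: "z \<noteq> 0" "w \<noteq> 0" "c \<noteq> 0" "w = (c * fst z, c * snd z)"
      by (auto simp: cp1_rel_def)
    then have "z = (inverse c * fst w, inverse c * snd w)"
      by (simp add: prod_eq_iff)
    with c show "cp1_rel w z"
      unfolding cp1_rel_def by (metis inverse_nonzero_iff_nonzero)
  qed
  show "transp cp1_rel"
  proof (rule transpI)
    fix z w u assume "cp1_rel z w" "cp1_rel w u"
    then obtain c d where c: "z \<noteq> 0" "u \<noteq> 0" "c \<noteq> 0" "w = (c * fst z, c * snd z)"
      "d \<noteq> 0" "u = (d * fst w, d * snd w)"
      by (auto simp: cp1_rel_def)
    then have "d * c \<noteq> 0" "u = (d * c * fst z, d * c * snd z)"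
      by auto
    with c show "cp1_rel z u"
      unfolding cp1_rel_def by blast
  qed
qed

quotient_type cp1 = "complex \<times> complex" / partial: cp1_rel
  by (rule cp1_rel_part_equivp)

text \<open>\<open>abs_cp1 (Z\<^sub>1, Z\<^sub>2)\<close> is the point \<open>[Z\<^sub>1, Z\<^sub>2]\<close>. The two charts are \<open>\<zeta> = Z\<^sub>1 / Z\<^sub>2\<close> on \<open>Z\<^sub>2 \<noteq> 0\<close>
  (index \<^term>\<open>True\<close>) and \<open>Z\<^sub>2 / Z\<^sub>1\<close> on \<open>Z\<^sub>1 \<noteq> 0\<close> (index \<^term>\<open>False\<close>).\<close>

lift_definition cp1_dom :: "bool \<Rightarrow> cp1 \<Rightarrow> bool" is
  "\<lambda>b z. (if b then snd z else fst z) \<noteq> 0"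
  by (auto simp: cp1_rel_def)

lift_definition cp1_coord :: "bool \<Rightarrow> cp1 \<Rightarrow> complex" is
  "\<lambda>b z. if b then fst z / snd z else snd z / fst z"
  by (auto simp: cp1_rel_def)

text \<open>The topology is the quotient topology of the set of nonzero vectors.\<close>

definition cp1_manifold :: "(bool, cp1, complex) manifold" where
  "cp1_manifold = \<lparr>
     mtop = topology (\<lambda>S. open {z. z \<noteq> 0 \<and> abs_cp1 z \<in> S}),
     idx = UNIV,
     dom = (\<lambda>b. {L. cp1_dom b L}),
     coord = cp1_coord\<rparr>"

definition cp1_structure :: "(bool, cp1, complex) endo_field" where
  "cp1_structure = (\<lambda>b L v. \<i> * v)"

lemma istopology_cp1: "istopology (\<lambda>S. open {z. z \<noteq> 0 \<and> abs_cp1 z \<in> S})"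
proof -
  have *: "{z. z \<noteq> 0 \<and> abs_cp1 z \<in> S \<inter> T} =
      {z. z \<noteq> 0 \<and> abs_cp1 z \<in> S} \<inter> {z. z \<noteq> 0 \<and> abs_cp1 z \<in> T}" for S T
    by auto
  have **: "{z. z \<noteq> 0 \<and> abs_cp1 z \<in> \<Union>\<K>} = (\<Union>S\<in>\<K>. {z. z \<noteq> 0 \<and> abs_cp1 z \<in> S})" for \<K>
    by auto
  show ?thesis
    unfolding istopology_def * ** by (auto intro!: open_UN)
qed

text \<open>The coefficients of \<open>I\<close>, \<open>J\<close>, \<open>K\<close> at the point \<open>[Z\<^sub>1, Z\<^sub>2]\<close>. The complex
  expressions in the second and third one have real values, so that \<^const>\<open>Re\<close> only changes the
  type.\<close>

lemma cmod_scale: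
  fixes a b c :: complex
  shows "(cmod (c * a))\<^sup>2 + (cmod (c * b))\<^sup>2 = (cmod c)\<^sup>2 * ((cmod a)\<^sup>2 + (cmod b)\<^sup>2)"
    and "(cmod (c * b))\<^sup>2 - (cmod (c * a))\<^sup>2 = (cmod c)\<^sup>2 * ((cmod b)\<^sup>2 - (cmod a)\<^sup>2)"
  by (simp_all add: norm_mult power_mult_distrib algebra_simps)

lemma cnj_scale:
  fixes a b c :: complex
  shows "(c * a) * cnj (c * b) + cnj (c * a) * (c * b) =
      of_real ((cmod c)\<^sup>2) * (a * cnj b + cnj a * b)"
    and "cnj (c * a) * (c * b) - (c * a) * cnj (c * b) =
      of_real ((cmod c)\<^sup>2) * (cnj a * b - a * cnj b)"
  by (simp_all only: complex_norm_square) (simp_all add: algebra_simps)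

lift_definition twistor_coeff_I :: "cp1 \<Rightarrow> real" is
  "\<lambda>(Z1, Z2). ((cmod Z2)\<^sup>2 - (cmod Z1)\<^sup>2) / ((cmod Z1)\<^sup>2 + (cmod Z2)\<^sup>2)"
  unfolding cp1_rel_def split_beta
  by (elim conjE exE, simp only: fst_conv snd_conv cmod_scale) simp

lift_definition twistor_coeff_J :: "cp1 \<Rightarrow> real" is
  "\<lambda>(Z1, Z2). Re ((Z1 * cnj Z2 + cnj Z1 * Z2) / of_real ((cmod Z1)\<^sup>2 + (cmod Z2)\<^sup>2))"
  unfolding cp1_rel_def split_beta
  by (elim conjE exE, simp only: fst_conv snd_conv cmod_scale cnj_scale of_real_mult) simp

lift_definition twistor_coeff_K :: "cp1 \<Rightarrow> real" is
  "\<lambda>(Z1, Z2). Re (\<i> * ((cnj Z1 * Z2 - Z1 * cnj Z2) / of_real ((cmod Z1)\<^sup>2 + (cmod Z2)\<^sup>2)))"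
  unfolding cp1_rel_def split_beta
  by (elim conjE exE, simp only: fst_conv snd_conv cmod_scale cnj_scale of_real_mult) simp


section \<open>The higher analog of the twistor space\<close>

definition prod_manifold :: "('i, 'a, 'm::euclidean_space) manifold \<Rightarrow>
    ('j, 'b, 'n::euclidean_space) manifold \<Rightarrow> ('i \<times> 'j, 'a \<times> 'b, 'm \<times> 'n) manifold" where
  "prod_manifold A B = \<lparr>
     mtop = prod_topology (mtop A) (mtop B),
     idx = idx A \<times> idx B,
     dom = (\<lambda>(i, j). dom A i \<times> dom B j),
     coord = (\<lambda>(i, j) (p, q). (coord A i p, coord B j q))\<rparr>"

text \<open>The complex structure \<open>I\<^sub>M\<close> on the tangent spaces of \<open>M\<close> determined by a point \<open>L\<close> of the
  projective line.\<close>

definition twistor_I_M :: "('i, 'a, 'm::real_vector) endo_field \<Rightarrow> ('i, 'a, 'm) endo_field \<Rightarrow>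
    ('i, 'a, 'm) endo_field \<Rightarrow> cp1 \<Rightarrow> ('i, 'a, 'm) endo_field" where
  "twistor_I_M I J K L = (\<lambda>i m u.
     twistor_coeff_I L *\<^sub>R I i m u + twistor_coeff_J L *\<^sub>R J i m u + twistor_coeff_K L *\<^sub>R K i m u)"

definition twistor_structure :: "('i, 'a, 'm::real_vector) endo_field \<Rightarrow>
    ('i, 'a, 'm) endo_field \<Rightarrow> ('i, 'a, 'm) endo_field \<Rightarrow> ('j, 'b, 'n) endo_field \<Rightarrow> ('b \<Rightarrow> cp1) \<Rightarrow>
    ('i \<times> 'j, 'a \<times> 'b, 'm \<times> 'n) endo_field" where
  "twistor_structure I J K IQ h = (\<lambda>(i, j) (m, q) (u, v).
     (twistor_I_M I J K (h q) i m u, IQ j q v))"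

definition twistor_form_M :: "('i, 'a, 'm::real_vector) endo_field \<Rightarrow>
    ('i, 'a, 'm) endo_field \<Rightarrow> ('i, 'a, 'm) endo_field \<Rightarrow> ('i, 'a, 'm) metric_field \<Rightarrow> ('b \<Rightarrow> cp1) \<Rightarrow>
    ('i \<times> 'j, 'a \<times> 'b, 'm \<times> 'n) form_field" where
  "twistor_form_M I J K g h = (\<lambda>(i, j) (m, q) w.
     g i m (twistor_I_M I J K (h q) i m (fst (w 0))) (fst (w 1)))"

definition pullback_snd :: "('j, 'b, 'n) form_field \<Rightarrow> ('i \<times> 'j, 'a \<times> 'b, 'm \<times> 'n) form_field" where
  "pullback_snd \<omega> = (\<lambda>(i, j) (m, q) w. \<omega> j q (\<lambda>l. snd (w l)))"

definition twistor_metric :: "('i, 'a, 'm::real_vector) endo_field \<Rightarrow>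
    ('i, 'a, 'm) endo_field \<Rightarrow> ('i, 'a, 'm) endo_field \<Rightarrow> ('i, 'a, 'm) metric_field \<Rightarrow> ('b \<Rightarrow> cp1) \<Rightarrow>
    ('j, 'b, 'n) form_field \<Rightarrow> real \<Rightarrow> ('i \<times> 'j, 'a \<times> 'b, 'm \<times> 'n) form_field" where
  "twistor_metric I J K g h \<omega>Q t =
     (\<lambda>c x w. twistor_form_M I J K g h c x w + t * pullback_snd \<omega>Q c x w)"

definition locally_constant :: "('j, 'b, 'n) manifold \<Rightarrow> ('b \<Rightarrow> 'c) \<Rightarrow> bool" where
  "locally_constant B f \<longleftrightarrow>
     (\<forall>q\<in>topspace (mtop B). \<exists>U. openin (mtop B) U \<and> q \<in> U \<and> f constant_on U)"

end

theory Submission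
  imports Defs
begin

text \<open>
  Why the theorem holds. Write \<open>L = a I + b J + c K\<close> for the complex structure \<open>I\<^sub>M\<close> of the fibre over
  a point of \<open>Q\<close>, where \<open>(a, b, c)\<close> is the point of the unit sphere which corresponds to the value of
  \<open>h\<close> under stereographic projection, and \<open>L'\<^sub>w = a' I + b' J + c' K\<close> for its derivative in a
  direction \<open>w\<close> tangent to \<open>Q\<close>. As \<open>a\<^sup>2 + b\<^sup>2 + c\<^sup>2 = 1\<close>, the vectors \<open>(a, b, c)\<close> and
  \<open>(a', b', c')\<close> are orthogonal, so that \<open>L L'\<^sub>w\<close> is again a combination of \<open>I\<close>, \<open>J\<close>, \<open>K\<close>, with
  the cross product as its coefficients.

  Complex structure. The Nijenhuis tensor has three kinds of components. On vectors tangent to \<open>M\<close> it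
  is the one of a fixed combination \<open>L\<close>, which vanishes by Hitchin's lemma, because the fundamental
  forms of the combinations orthogonal to \<open>L\<close> are closed (\<open>closed_forms_nijenhuis\<close>,
  \<open>nijenhuis_quat_comb\<close>). On vectors tangent to \<open>Q\<close> it vanishes by assumption. The mixed components
  are the differences of \<open>L'\<close> in the direction \<open>I w\<close> and \<open>L L'\<^sub>w\<close>. They vanish since \<open>h\<close> is
  holomorphic and stereographic projection is conformal, with multiplication by the imaginary unit
  corresponding to the cross product with \<open>(a, b, c)\<close> (\<open>sphere_conformal\<close>, \<open>nijenhuis_TT\<close>).

  Balancedness. Let \<open>\<xi> = \<omega>\<^sub>M + t \<omega>\<^sub>Q\<close>. All forms \<open>\<omega>\<^sub>I\<close>, \<open>\<omega>\<^sub>J\<close>, \<open>\<omega>\<^sub>K\<close>, \<open>\<omega>\<^sub>Q\<close> being closed,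
  \<open>d\<xi>(w, u, v)\<close> is the cyclic sum of \<open>g (L'\<^sub>w u) v\<close>, with \<open>w\<close> projected to \<open>Q\<close> and \<open>u\<close>, \<open>v\<close>
  to \<open>M\<close>. Now \<open>d(\<xi>\<^sup>s) = s \<xi>\<^sup>s\<^sup>-\<^sup>1 \<and> d\<xi>\<close> for \<open>s = r + n - 1\<close> is a form of degree \<open>2s + 1\<close> on a space
  of dimension \<open>2s + 2\<close>. It suffices to evaluate it on all but one of the vectors of a unitary basis,
  composed of pairs \<open>e\<close>, \<open>L e\<close> tangent to \<open>M\<close> and \<open>f\<close>, \<open>I f\<close> tangent to \<open>Q\<close>. In a nonzero summand,
  \<open>\<xi>\<^sup>s\<^sup>-\<^sup>1\<close> uses up whole pairs, so that \<open>d\<xi>\<close> is left with one vector \<open>f\<close> tangent to \<open>Q\<close>, whose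
  partner is the missing vector, and with a whole pair tangent to \<open>M\<close>. But \<open>g (L'\<^sub>f e) (L e) = 0\<close>
  because \<open>L L'\<^sub>f\<close> is skew. This is \<open>leibniz_sum_eq_0\<close>, applied in \<open>leibniz_sum_twist\<close>. It rests on the
  expansion of the exterior powers and of their derivative as sums over permutations
  (\<open>form_power_2_expand\<close>, \<open>ext_deriv_form_power_2\<close>).

  Failure of the Kaehler condition. If \<open>d\<xi> = 0\<close>, then \<open>g (L'\<^sub>w u) v = 0\<close> for all \<open>u\<close>, \<open>v\<close>, so
  \<open>(a', b', c') = 0\<close>. Hence the coefficients, and with them \<open>h\<close>, are locally constant
  (\<open>closed_imp_locally_constant\<close>).
\<close>


section \<open>Calculus of smooth functions\<close>

lemma Ck_on_cong:
  assumes "open S" "\<And>x. x \<in> S \<Longrightarrow> f x = g x"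
  shows "Ck_on k S f \<longleftrightarrow> Ck_on k S g"
  using assms
proof (induction k arbitrary: f g)
  case 0
  then show ?case by (auto cong: continuous_on_cong)
next
  case (Suc k)
  have deriv: "(f has_derivative D) (at x) \<longleftrightarrow> (g has_derivative D) (at x)" if "x \<in> S" for x D
    using that Suc.prems has_derivative_transform_within_open[of f D x UNIV S g]
      has_derivative_transform_within_open[of g D x UNIV S f] by auto
  have "Ck_on k S (\<lambda>x. frechet_derivative f (at x) v) \<longleftrightarrow>
      Ck_on k S (\<lambda>x. frechet_derivative g (at x) v)" for v
    by (rule Suc.IH) (use Suc.prems deriv in \<open>auto simp: frechet_derivative_def\<close>)
  then show ?case using deriv by (auto simp: differentiable_def)
qed

lemma Ck_on_SucD: "Ck_on (Suc k) S f \<Longrightarrow> Ck_on k S f"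
proof (induction k arbitrary: f)
  case 0
  then show ?case
    by (auto intro!: continuous_at_imp_continuous_on differentiable_imp_continuous_within)
qed auto

lemma Ck_on_local:
  assumes "\<And>x. x \<in> S \<Longrightarrow> \<exists>T. open T \<and> x \<in> T \<and> Ck_on k T f"
  shows "Ck_on k S f"
  using assms
proof (induction k arbitrary: f)
  case 0
  have "isCont f x" if "x \<in> S" for x
    using 0[OF that] by (auto simp: continuous_on_eq_continuous_at)
  then show ?case by (auto intro: continuous_at_imp_continuous_on)
next
  case (Suc k)
  then show ?case by (simp, meson)
qed

lemma has_derivative_frechet:
  "f differentiable (at x) \<Longrightarrow> (f has_derivative frechet_derivative f (at x)) (at x)"
  by (simp add: frechet_derivative_works)

text \<open>For the inductive steps below: it replaces the derivative, which is chosen by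
  \<^const>\<open>frechet_derivative\<close>, by a given formula.\<close>

lemma Ck_on_SucI:
  assumes "open S" "\<And>x. x \<in> S \<Longrightarrow> (f has_derivative f' x) (at x)"
    "\<And>v. Ck_on k S (\<lambda>x. f' x v)"
  shows "Ck_on (Suc k) S f"
proof -
  have "Ck_on k S (\<lambda>x. frechet_derivative f (at x) v) \<longleftrightarrow> Ck_on k S (\<lambda>x. f' x v)" for v
    using assms(1) frechet_derivative_at[OF assms(2)] by (intro Ck_on_cong) auto
  then show ?thesis using assms by (auto simp: differentiable_def)
qed

lemma Ck_on_const [simp]: "open S \<Longrightarrow> Ck_on k S (\<lambda>x. c)"
  by (induction k arbitrary: c) (auto simp: frechet_derivative_const)

lemma Ck_on_add:
  assumes "open S"
  shows "Ck_on k S f \<Longrightarrow> Ck_on k S g \<Longrightarrow> Ck_on k S (\<lambda>x. f x + g x)"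
proof (induction k arbitrary: f g)
  case 0
  then show ?case by (auto intro: continuous_on_add)
next
  case (Suc k)
  have "((\<lambda>x. f x + g x) has_derivative
      (\<lambda>v. frechet_derivative f (at x) v + frechet_derivative g (at x) v)) (at x)" if "x \<in> S" for x
    by (intro has_derivative_add has_derivative_frechet) (use that Suc.prems in auto)
  moreover have "Ck_on k S (\<lambda>x. frechet_derivative f (at x) v + frechet_derivative g (at x) v)" for v
    by (rule Suc.IH) (use Suc.prems in auto)
  ultimately show ?case by (rule Ck_on_SucI[OF assms])
qed

lemma Ck_on_sum:
  assumes "open S" "\<And>i. i \<in> B \<Longrightarrow> Ck_on k S (f i)"
  shows "Ck_on k S (\<lambda>x. \<Sum>i\<in>B. f i x)"
  using assms(2) by (induction B rule: infinite_finite_induct) (auto simp: assms(1) intro: Ck_on_add)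

lemma Ck_on_bounded_linear:
  assumes "open S" "bounded_linear F"
  shows "Ck_on k S f \<Longrightarrow> Ck_on k S (\<lambda>x. F (f x))"
proof (induction k arbitrary: f)
  case 0
  then show ?case using assms by (simp add: bounded_linear.continuous_on)
next
  case (Suc k)
  have "((\<lambda>x. F (f x)) has_derivative (\<lambda>v. F (frechet_derivative f (at x) v))) (at x)"
    if "x \<in> S" for x
    by (intro bounded_linear.has_derivative[OF assms(2)] has_derivative_frechet)
       (use that Suc.prems in auto)
  moreover have "Ck_on k S (\<lambda>x. F (frechet_derivative f (at x) v))" for v
    by (rule Suc.IH) (use Suc.prems in auto)
  ultimately show ?case by (rule Ck_on_SucI[OF assms(1)])
qed

lemma Ck_on_bounded_bilinear:
  assumes "open S" "bounded_bilinear F"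
  shows "Ck_on k S f \<Longrightarrow> Ck_on k S g \<Longrightarrow> Ck_on k S (\<lambda>x. F (f x) (g x))"
proof (induction k arbitrary: f g)
  case 0
  then show ?case using assms by (simp add: bounded_bilinear.continuous_on)
next
  case (Suc k)
  have "Ck_on k S f" "Ck_on k S g" by (rule Ck_on_SucD, fact)+
  have "((\<lambda>x. F (f x) (g x)) has_derivative (\<lambda>v. F (f x) (frechet_derivative g (at x) v) +
      F (frechet_derivative f (at x) v) (g x))) (at x)" if "x \<in> S" for x
    by (intro bounded_bilinear.FDERIV[OF assms(2)] has_derivative_frechet)
       (use that Suc.prems in auto)
  moreover have "Ck_on k S (\<lambda>x. F (f x) (frechet_derivative g (at x) v))"
      "Ck_on k S (\<lambda>x. F (frechet_derivative f (at x) v) (g x))" for v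
    by (rule Suc.IH; use \<open>Ck_on k S f\<close> \<open>Ck_on k S g\<close> Suc.prems in simp)+
  then have "Ck_on k S (\<lambda>x. F (f x) (frechet_derivative g (at x) v) +
      F (frechet_derivative f (at x) v) (g x))" for v
    by (intro Ck_on_add assms(1))
  ultimately show ?case by (rule Ck_on_SucI[OF assms(1)])
qed

lemma linear_basis_expansion:
  fixes F :: "'m::euclidean_space \<Rightarrow> 'c::real_vector"
  assumes "linear F"
  shows "F w = (\<Sum>b\<in>Basis. (w \<bullet> b) *\<^sub>R F b)"
proof -
  have "F (\<Sum>b\<in>Basis. (w \<bullet> b) *\<^sub>R b) = (\<Sum>b\<in>Basis. (w \<bullet> b) *\<^sub>R F b)"
    by (simp only: linear_sum[OF assms] linear_cmul[OF assms])
  then show ?thesis by (simp only: euclidean_representation)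
qed

text \<open>The derivative of \<open>g \<circ> f\<close> is evaluated at the vector \<open>f' v\<close>, which varies with the
  point. Expanding it in a basis reduces the chain rule to derivatives of \<open>g\<close> in fixed directions.\<close>

lemma Ck_on_compose:
  fixes f :: "'a::euclidean_space \<Rightarrow> 'b::euclidean_space" and g :: "'b \<Rightarrow> 'c::real_normed_vector"
  assumes "open S" "open T" "f ` S \<subseteq> T"
  shows "Ck_on k S f \<Longrightarrow> Ck_on k T g \<Longrightarrow> Ck_on k S (\<lambda>x. g (f x))"
proof (induction k arbitrary: g)
  case 0
  then show ?case using assms by (auto intro: continuous_on_compose2)
next
  case (Suc k)
  let ?f' = "\<lambda>x. frechet_derivative f (at x)" and ?g' = "\<lambda>y. frechet_derivative g (at y)"
  have expand: "?g' (f x) w = (\<Sum>b\<in>Basis. (w \<bullet> b) *\<^sub>R ?g' (f x) b)" if "x \<in> S" for x w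
  proof -
    have "bounded_linear (?g' (f x))"
      by (rule has_derivative_bounded_linear[OF has_derivative_frechet])
         (use Suc.prems that assms(3) in auto)
    then show ?thesis by (intro linear_basis_expansion bounded_linear.linear)
  qed
  have chain: "((\<lambda>x. g (f x)) has_derivative (\<lambda>v. \<Sum>b\<in>Basis. (?f' x v \<bullet> b) *\<^sub>R ?g' (f x) b)) (at x)"
    if "x \<in> S" for x
  proof -
    have "((\<lambda>x. g (f x)) has_derivative (\<lambda>v. ?g' (f x) (?f' x v))) (at x)"
    proof (rule has_derivative_compose[of f "?f' x" x UNIV g "?g' (f x)"])
      show "(f has_derivative ?f' x) (at x)"
        by (rule has_derivative_frechet) (use Suc.prems that in simp)
      show "(g has_derivative ?g' (f x)) (at (f x))"
        by (rule has_derivative_frechet) (use Suc.prems that assms(3) in auto)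
    qed
    then show ?thesis by (rule has_derivative_eq_rhs) (intro ext expand that)
  qed
  have "Ck_on k S f" using Suc.prems(1) by (rule Ck_on_SucD)
  then have "Ck_on k S (\<lambda>x. ?g' (f x) b)" for b
    by (rule Suc.IH[where g = "\<lambda>y. ?g' y b"]) (use Suc.prems(2) in simp)
  moreover have "Ck_on k S (\<lambda>x. ?f' x v \<bullet> b)" for v b
    by (rule Ck_on_bounded_linear[OF assms(1) bounded_linear_inner_left]) (use Suc.prems(1) in simp)
  ultimately have "Ck_on k S (\<lambda>x. \<Sum>b\<in>Basis. (?f' x v \<bullet> b) *\<^sub>R ?g' (f x) b)" for v
    by (intro Ck_on_sum Ck_on_bounded_bilinear[OF assms(1) bounded_bilinear_scaleR] assms(1))
  from Ck_on_SucI[OF assms(1) chain this] show ?case .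
qed

lemma Ck_on_inverse:
  fixes f :: "'a::euclidean_space \<Rightarrow> real"
  assumes "open S" "\<And>x. x \<in> S \<Longrightarrow> f x \<noteq> 0"
  shows "Ck_on k S f \<Longrightarrow> Ck_on k S (\<lambda>x. inverse (f x))"
proof (induction k)
  case 0
  then show ?case using assms(2) by (simp add: continuous_on_inverse)
next
  case (Suc k)
  let ?f' = "\<lambda>x v. frechet_derivative f (at x) v"
  have inv: "Ck_on k S (\<lambda>x. inverse (f x))"
    by (rule Suc.IH, rule Ck_on_SucD, rule Suc.prems)
  have minus: "Ck_on k S (\<lambda>x. - ?f' x v)" for v
    by (rule Ck_on_bounded_linear[OF assms(1) bounded_linear_minus[OF bounded_linear_ident]])
       (use Suc.prems in simp)
  have smooth: "Ck_on k S (\<lambda>x. - ?f' x v * (inverse (f x) * inverse (f x)))" for v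
    by (rule Ck_on_bounded_bilinear[OF assms(1) bounded_bilinear_mult minus
          Ck_on_bounded_bilinear[OF assms(1) bounded_bilinear_mult inv inv]])
  have "((\<lambda>x. inverse (f x)) has_derivative
      (\<lambda>v. - ?f' x v * (inverse (f x) * inverse (f x)))) (at x)" if "x \<in> S" for x
  proof -
    have "(f has_derivative ?f' x) (at x)"
      using that Suc.prems has_derivative_frechet[of f x] by simp
    from Deriv.has_derivative_inverse[OF assms(2)[OF that] this]
    show ?thesis by (simp only: mult_minus_left mult_minus_right mult_ac)
  qed
  then show ?case by (rule Ck_on_SucI[OF assms(1) _ smooth])
qed

lemma smooth_on_cong:
  assumes "open S" "\<And>x. x \<in> S \<Longrightarrow> f x = g x"
  shows "smooth_on S f \<longleftrightarrow> smooth_on S g"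
proof -
  have "Ck_on k S f \<longleftrightarrow> Ck_on k S g" for k
    using assms by (rule Ck_on_cong)
  then show ?thesis unfolding smooth_on_def by blast
qed

lemma smooth_on_local:
  assumes "\<And>x. x \<in> S \<Longrightarrow> \<exists>T. open T \<and> x \<in> T \<and> smooth_on T f"
  shows "smooth_on S f"
  unfolding smooth_on_def
proof (intro allI Ck_on_local)
  fix k x assume "x \<in> S"
  with assms obtain T where "open T" "x \<in> T" "smooth_on T f" by blast
  then show "\<exists>T. open T \<and> x \<in> T \<and> Ck_on k T f"
    unfolding smooth_on_def by (intro exI[of _ T]) simp
qed

lemma smooth_on_const [simp]: "open S \<Longrightarrow> smooth_on S (\<lambda>x. c)"
  by (simp add: smooth_on_def)

lemma smooth_on_add: "open S \<Longrightarrow> smooth_on S f \<Longrightarrow> smooth_on S g \<Longrightarrow> smooth_on S (\<lambda>x. f x + g x)"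
  unfolding smooth_on_def by (intro allI, rule Ck_on_add) auto

lemma smooth_on_sum:
  "open S \<Longrightarrow> (\<And>i. i \<in> B \<Longrightarrow> smooth_on S (f i)) \<Longrightarrow> smooth_on S (\<lambda>x. \<Sum>i\<in>B. f i x)"
  unfolding smooth_on_def by (intro allI, rule Ck_on_sum) auto

lemma smooth_on_bounded_linear:
  "open S \<Longrightarrow> bounded_linear F \<Longrightarrow> smooth_on S f \<Longrightarrow> smooth_on S (\<lambda>x. F (f x))"
  unfolding smooth_on_def by (intro allI, rule Ck_on_bounded_linear[where F = F and f = f]) auto

lemma smooth_on_scaleR:
  "open S \<Longrightarrow> smooth_on S f \<Longrightarrow> smooth_on S g \<Longrightarrow> smooth_on S (\<lambda>x. f x *\<^sub>R g x)"
  unfolding smooth_on_def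
  by (intro allI, rule Ck_on_bounded_bilinear[OF _ bounded_bilinear_scaleR]) auto

lemma smooth_on_mult:
  fixes f g :: "'a::euclidean_space \<Rightarrow> real"
  shows "open S \<Longrightarrow> smooth_on S f \<Longrightarrow> smooth_on S g \<Longrightarrow> smooth_on S (\<lambda>x. f x * g x)"
  using smooth_on_scaleR[of S f g] by simp

lemma smooth_on_inverse:
  fixes f :: "'a::euclidean_space \<Rightarrow> real"
  shows "open S \<Longrightarrow> (\<And>x. x \<in> S \<Longrightarrow> f x \<noteq> 0) \<Longrightarrow> smooth_on S f \<Longrightarrow> smooth_on S (\<lambda>x. inverse (f x))"
  unfolding smooth_on_def by (intro allI, rule Ck_on_inverse) auto

lemma smooth_on_compose:
  fixes f :: "'a::euclidean_space \<Rightarrow> 'b::euclidean_space" and g :: "'b \<Rightarrow> 'c::real_normed_vector"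
  shows "open S \<Longrightarrow> open T \<Longrightarrow> f ` S \<subseteq> T \<Longrightarrow> smooth_on S f \<Longrightarrow> smooth_on T g \<Longrightarrow>
    smooth_on S (\<lambda>x. g (f x))"
  unfolding smooth_on_def by (intro allI, rule Ck_on_compose[where T = T and f = f and g = g]) auto

lemma smooth_on_ident: "open S \<Longrightarrow> smooth_on S (\<lambda>x. x)"
proof -
  have "Ck_on k S (\<lambda>x. x)" if "open S" for k
  proof (cases k)
    case (Suc m)
    then show ?thesis
      using that by (auto intro!: Ck_on_SucI[where f' = "\<lambda>x v. v"])
  qed auto
  then show "open S \<Longrightarrow> smooth_on S (\<lambda>x. x)" by (simp add: smooth_on_def)
qed

lemma smooth_on_linear: "open S \<Longrightarrow> bounded_linear F \<Longrightarrow> smooth_on S F"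
  by (rule smooth_on_bounded_linear[OF _ _ smooth_on_ident])

lemma smooth_on_Pair:
  assumes "open S" "smooth_on S f" "smooth_on S g"
  shows "smooth_on S (\<lambda>x. (f x, g x))"
proof -
  have "smooth_on S (\<lambda>x. (f x, 0) + (0, g x))"
    by (intro assms smooth_on_add
          smooth_on_bounded_linear[where F = "\<lambda>y. (y, 0)" and f = f]
          smooth_on_bounded_linear[where F = "\<lambda>y. (0, y)" and f = g]
          bounded_linear_Pair bounded_linear_ident bounded_linear_zero)
  then show ?thesis by simp
qed

lemma smooth_on_fst:
  fixes f :: "'a::euclidean_space \<Rightarrow> 'c::real_normed_vector" and T :: "'b::euclidean_space set"
  assumes "open S" "open T" "smooth_on S f"
  shows "smooth_on (S \<times> T) (\<lambda>x. f (fst x))"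
  by (rule smooth_on_compose[where T = S and f = fst and g = f])
     (auto intro!: assms open_Times smooth_on_linear bounded_linear_fst)

lemma smooth_on_snd:
  fixes f :: "'b::euclidean_space \<Rightarrow> 'c::real_normed_vector" and S :: "'a::euclidean_space set"
  assumes "open S" "open T" "smooth_on T f"
  shows "smooth_on (S \<times> T) (\<lambda>x. f (snd x))"
  by (rule smooth_on_compose[where T = T and f = snd and g = f])
     (auto intro!: assms open_Times smooth_on_linear bounded_linear_snd)

lemma smooth_on_differentiable: "smooth_on S f \<Longrightarrow> x \<in> S \<Longrightarrow> f differentiable (at x)"
  unfolding smooth_on_def by (drule spec[of _ "Suc 0"]) simp

lemma smooth_on_has_derivative:
  "smooth_on S f \<Longrightarrow> x \<in> S \<Longrightarrow> (f has_derivative frechet_derivative f (at x)) (at x)"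
  by (blast intro: has_derivative_frechet smooth_on_differentiable)

text \<open>The components of tensor fields are known to be smooth on constant vectors only. For a smooth
  vector field as the argument, the field is expanded in a basis.\<close>

lemma smooth_on_linear_apply:
  fixes F :: "'a::euclidean_space \<Rightarrow> 'm::euclidean_space \<Rightarrow> 'c::real_normed_vector"
  assumes "open S" "\<And>x. x \<in> S \<Longrightarrow> linear (F x)" "\<And>v. smooth_on S (\<lambda>x. F x v)" "smooth_on S X"
  shows "smooth_on S (\<lambda>x. F x (X x))"
proof -
  have "smooth_on S (\<lambda>x. \<Sum>b\<in>Basis. (X x \<bullet> b) *\<^sub>R F x b)"
    using assms by (intro smooth_on_sum smooth_on_scaleR smooth_on_bounded_linear[OF _ bounded_linear_inner_left]) auto
  moreover have eq: "F x (X x) = (\<Sum>b\<in>Basis. (X x \<bullet> b) *\<^sub>R F x b)" if "x \<in> S" for x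
    by (rule linear_basis_expansion[OF assms(2)[OF that]])
  ultimately show ?thesis by (simp only: smooth_on_cong[OF assms(1) eq])
qed

lemma has_derivative_linear_apply:
  fixes F :: "'a::euclidean_space \<Rightarrow> 'm::euclidean_space \<Rightarrow> 'c::real_normed_vector"
  assumes "open S" "x \<in> S" "\<And>y. y \<in> S \<Longrightarrow> linear (F y)"
    "\<And>v. ((\<lambda>y. F y v) has_derivative (\<lambda>w. F' w v)) (at x)" "\<And>w. linear (F' w)"
    "(X has_derivative X') (at x)"
  shows "((\<lambda>y. F y (X y)) has_derivative (\<lambda>w. F' w (X x) + F x (X' w))) (at x)"
proof -
  have "((\<lambda>y. \<Sum>b\<in>Basis. (X y \<bullet> b) *\<^sub>R F y b) has_derivative
      (\<lambda>w. \<Sum>b\<in>Basis. (X x \<bullet> b) *\<^sub>R F' w b + (X' w \<bullet> b) *\<^sub>R F x b)) (at x)"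
    by (intro has_derivative_sum has_derivative_scaleR has_derivative_inner_left assms)
  moreover have "(\<Sum>b\<in>Basis. (X x \<bullet> b) *\<^sub>R F' w b + (X' w \<bullet> b) *\<^sub>R F x b) = F' w (X x) + F x (X' w)" for w
    using linear_basis_expansion[OF assms(5), of w "X x"]
      linear_basis_expansion[OF assms(3)[OF assms(2)], of "X' w"]
    by (simp add: sum.distrib)
  ultimately have "((\<lambda>y. \<Sum>b\<in>Basis. (X y \<bullet> b) *\<^sub>R F y b) has_derivative (\<lambda>w. F' w (X x) + F x (X' w))) (at x)"
    by simp
  then show ?thesis
    by (rule has_derivative_transform_within_open[OF _ assms(1,2)])
       (simp add: linear_basis_expansion[OF assms(3), symmetric])
qed

text \<open>Differentiate the identities \<open>F y (u + v) = F y u + F y v\<close> and \<open>F y (c u) = c F y u\<close> in \<open>y\<close>.\<close>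

lemma linear_has_derivative:
  fixes F :: "'a::euclidean_space \<Rightarrow> 'm::euclidean_space \<Rightarrow> 'c::real_normed_vector"
  assumes "open S" "x \<in> S" "\<And>y. y \<in> S \<Longrightarrow> linear (F y)"
    "\<And>v. ((\<lambda>y. F y v) has_derivative (\<lambda>w. F' w v)) (at x)"
  shows "linear (F' w)"
proof (rule linearI)
  fix u v
  have "((\<lambda>y. F y u + F y v) has_derivative (\<lambda>w. F' w u + F' w v)) (at x)"
    by (intro has_derivative_add assms)
  then have "((\<lambda>y. F y (u + v)) has_derivative (\<lambda>w. F' w u + F' w v)) (at x)"
    by (rule has_derivative_transform_within_open[OF _ assms(1,2)]) (auto simp: linear_add assms(3))
  from has_derivative_unique[OF this assms(4)] show "F' w (u + v) = F' w u + F' w v" by metis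
next
  fix c u
  have "((\<lambda>y. c *\<^sub>R F y u) has_derivative (\<lambda>w. c *\<^sub>R F' w u)) (at x)"
    by (intro has_derivative_scaleR_right assms)
  then have "((\<lambda>y. F y (c *\<^sub>R u)) has_derivative (\<lambda>w. c *\<^sub>R F' w u)) (at x)"
    by (rule has_derivative_transform_within_open[OF _ assms(1,2)]) (auto simp: linear_cmul assms(3))
  from has_derivative_unique[OF this assms(4)] show "F' w (c *\<^sub>R u) = c *\<^sub>R F' w u" by metis
qed


section \<open>The Nijenhuis tensor\<close>

text \<open>The value at a point of the Nijenhuis tensor of an endomorphism field with value \<open>A\<close> and
  derivative \<open>A' w u = (D\<^sub>w A) u\<close> there, on constant vector fields.\<close>

definition nijenhuis :: "('m \<Rightarrow> 'm) \<Rightarrow> ('m \<Rightarrow> 'm \<Rightarrow> 'm) \<Rightarrow> 'm \<Rightarrow> 'm \<Rightarrow> 'm::real_vector" where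
  "nijenhuis A A' u v = A' (A u) v - A' (A v) u + A (A' v u) - A (A' u v)"

text \<open>The tensor property: the derivatives of \<open>X\<close> and \<open>Y\<close> cancel, thanks to \<open>A\<^sup>2 = - 1\<close>. Integrability
  may therefore be tested on constant vector fields, as in \<open>integrable_structure_iff\<close>.\<close>

lemma nijenhuis_of_fields:
  fixes A :: "'m::euclidean_space \<Rightarrow> 'm \<Rightarrow> 'm"
  assumes S: "open S" "x \<in> S" and lin: "\<And>y. y \<in> S \<Longrightarrow> linear (A y)"
    and A': "\<And>v. ((\<lambda>y. A y v) has_derivative (\<lambda>w. A' w v)) (at x)"
    and sq: "\<And>v. A x (A x v) = - v"
    and X: "(X has_derivative X') (at x)" and Y: "(Y has_derivative Y') (at x)"
  shows "lie_bracket (\<lambda>y. A y (X y)) (\<lambda>y. A y (Y y)) x - A x (lie_bracket (\<lambda>y. A y (X y)) Y x)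
      - A x (lie_bracket X (\<lambda>y. A y (Y y)) x) - lie_bracket X Y x = nijenhuis (A x) A' (X x) (Y x)"
proof -
  have lin': "linear (A' w)" for w
    by (rule linear_has_derivative[OF S lin A'])
  have AX: "frechet_derivative (\<lambda>y. A y (X y)) (at x) = (\<lambda>w. A' w (X x) + A x (X' w))"
    by (rule frechet_derivative_at[symmetric], rule has_derivative_linear_apply[OF S lin A' lin' X])
  have AY: "frechet_derivative (\<lambda>y. A y (Y y)) (at x) = (\<lambda>w. A' w (Y x) + A x (Y' w))"
    by (rule frechet_derivative_at[symmetric], rule has_derivative_linear_apply[OF S lin A' lin' Y])
  note rules = AX AY frechet_derivative_at[OF X, symmetric] frechet_derivative_at[OF Y, symmetric]
  show ?thesis
    unfolding lie_bracket_def rules nijenhuis_def linear_diff[OF lin[OF S(2)]]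
      linear_add[OF lin[OF S(2)]] sq
    by (simp add: algebra_simps)
qed

lemma integrable_structure_iff:
  fixes N :: "('i, 'a, 'm::euclidean_space) manifold"
  assumes opn: "\<And>i. i \<in> idx N \<Longrightarrow> open (coord N i ` dom N i)"
    and inj: "\<And>i. i \<in> idx N \<Longrightarrow> inj_on (coord N i) (dom N i)"
    and endo: "endomorphism_field N A"
    and sq: "\<And>i p v. i \<in> idx N \<Longrightarrow> p \<in> dom N i \<Longrightarrow> A i p (A i p v) = - v"
  shows "integrable_structure N A \<longleftrightarrow>
    (\<forall>i\<in>idx N. \<forall>x\<in>coord N i ` dom N i. \<forall>u v. nijenhuis (A i (inv_coord N i x))
       (\<lambda>w u. frechet_derivative (\<lambda>y. A i (inv_coord N i y) u) (at x) w) u v = 0)"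
proof -
  have tensor: "lie_bracket (\<lambda>y. A i (inv_coord N i y) (X y)) (\<lambda>y. A i (inv_coord N i y) (Y y)) x
      - A i (inv_coord N i x) (lie_bracket (\<lambda>y. A i (inv_coord N i y) (X y)) Y x)
      - A i (inv_coord N i x) (lie_bracket X (\<lambda>y. A i (inv_coord N i y) (Y y)) x) - lie_bracket X Y x
      = nijenhuis (A i (inv_coord N i x))
         (\<lambda>w u. frechet_derivative (\<lambda>y. A i (inv_coord N i y) u) (at x) w) (X x) (Y x)"
    if i: "i \<in> idx N" and x: "x \<in> coord N i ` dom N i"
      and XY: "smooth_on (coord N i ` dom N i) X" "smooth_on (coord N i ` dom N i) Y" for i X Y x
  proof (rule nijenhuis_of_fields[OF opn[OF i] x])
    have dom: "inv_coord N i y \<in> dom N i" if "y \<in> coord N i ` dom N i" for y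
      using that unfolding inv_coord_def by (rule inv_into_into)
    show "linear (A i (inv_coord N i y))" if "y \<in> coord N i ` dom N i" for y
      using endo i dom[OF that] unfolding endomorphism_field_def by blast
    show "A i (inv_coord N i x) (A i (inv_coord N i x) v) = - v" for v
      by (rule sq[OF i dom[OF x]])
    show "((\<lambda>y. A i (inv_coord N i y) v) has_derivative
        (\<lambda>w. frechet_derivative (\<lambda>y. A i (inv_coord N i y) v) (at x) w)) (at x)" for v
      using endo i by (intro smooth_on_has_derivative[OF _ x]) (simp add: endomorphism_field_def)
  qed (use smooth_on_has_derivative[OF XY(1) x] smooth_on_has_derivative[OF XY(2) x] in simp_all)
  show ?thesis
  proof (intro iffI ballI allI)
    fix i x u v assume *: "integrable_structure N A" "i \<in> idx N" "x \<in> coord N i ` dom N i"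
    have const: "smooth_on (coord N i ` dom N i) (\<lambda>y. u)" for u :: 'm
      by (rule smooth_on_const[OF opn[OF *(2)]])
    from *(1)[unfolded integrable_structure_def Let_def, rule_format, OF *(2) const[of u] const[of v] *(3)]
    show "nijenhuis (A i (inv_coord N i x))
       (\<lambda>w u. frechet_derivative (\<lambda>y. A i (inv_coord N i y) u) (at x) w) u v = 0"
      using tensor[OF *(2,3) const[of u] const[of v]] by simp
  next
    assume *: "\<forall>i\<in>idx N. \<forall>x\<in>coord N i ` dom N i. \<forall>u v. nijenhuis (A i (inv_coord N i x))
       (\<lambda>w u. frechet_derivative (\<lambda>y. A i (inv_coord N i y) u) (at x) w) u v = 0"
    show "integrable_structure N A"
      unfolding integrable_structure_def Let_def
    proof (intro ballI allI impI)
      fix i and X Y :: "'m \<Rightarrow> 'm" and x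
      assume h: "i \<in> idx N" "smooth_on (coord N i ` dom N i) X" "smooth_on (coord N i ` dom N i) Y"
        "x \<in> coord N i ` dom N i"
      show "lie_bracket (\<lambda>y. A i (inv_coord N i y) (X y)) (\<lambda>y. A i (inv_coord N i y) (Y y)) x
      - A i (inv_coord N i x) (lie_bracket (\<lambda>y. A i (inv_coord N i y) (X y)) Y x)
      - A i (inv_coord N i x) (lie_bracket X (\<lambda>y. A i (inv_coord N i y) (Y y)) x) - lie_bracket X Y x = 0"
        unfolding tensor[OF h(1,4,2,3)] using * h by blast
    qed
  qed
qed

text \<open>The real form of Hitchin's lemma. Let \<open>W\<close> be a two-form with \<open>W(A\<cdot>,\<cdot>) = W(\<cdot>,A\<cdot>)\<close>,
  so that \<open>E = W(A\<cdot>,\<cdot>)\<close> is a two-form as well and \<open>E + \<i>W\<close> is of type \<open>(2,0)\<close>. Expanding the definitions gives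
  \<open>W(N(X,Y),Z) = dE(AX,Y,Z) + dE(X,AY,Z) - dW(AX,AY,Z) + dW(X,Y,Z)\<close>
  for the Nijenhuis tensor \<open>N\<close> of \<open>A\<close>, which vanishes if both forms are closed.\<close>

lemma closed_forms_nijenhuis:
  fixes A :: "'m::real_vector \<Rightarrow> 'm" and W :: "'m \<Rightarrow> 'm \<Rightarrow> real"
  assumes W: "bilinear W" and sq: "\<And>u. A (A u) = - u" and anti: "\<And>w u. A (A' w u) = - A' w (A u)"
    and sym: "\<And>u v. W (A u) v = W u (A v)"
    and W'_minus: "\<And>w u v. W' w (- u) v = - W' w u v"
    and W'_skew: "\<And>w u v. W' w u v = - W' w v u"
    and E': "\<And>w u v. E' w u v = W' w (A u) v + W (A' w u) v"
    and E'_skew: "\<And>w u v. E' w u v = - E' w v u"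
    and dW: "\<And>u v z. W' u v z + W' v z u + W' z u v = 0"
    and dE: "\<And>u v z. E' u v z + E' v z u + E' z u v = 0"
  shows "W (nijenhuis A A' x y) z = 0"
proof -
  note W_lin = bilinear_ladd[OF W] bilinear_lsub[OF W] bilinear_lneg[OF W]
  have E'A: "E' w (A u) v = - W' w u v - W (A (A' w u)) v" for w u v
    by (simp add: E' sq anti W'_minus W_lin)
  have WA: "W (A (A' w u)) v = E' w u (A v) - W' w (A u) (A v)" for w u v
    by (simp add: E' sym)
  have swap: "E' w (A u) v + E' w u (A v) - W' w (A u) (A v) = - W' w u v" for w u v
    using E'A WA by simp
  have "W (nijenhuis A A' x y) z
      = E' (A x) y z - W' (A x) (A y) z - (E' (A y) x z - W' (A y) (A x) z)
        + (E' y x (A z) - W' y (A x) (A z)) - (E' x y (A z) - W' x (A y) (A z))"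
    by (simp add: nijenhuis_def W_lin E' sym)
  also have "\<dots> = 0"
    using dE[of "A x" y z] dE[of x "A y" z] dW[of "A x" "A y" z] dW[of x y z]
      swap[of x y z] swap[of y x z] swap[of z x y]
      E'_skew[of "A y" x z] E'_skew[of y z "A x"] E'_skew[of z x "A y"]
      W'_skew[of "A y" "A x" z] W'_skew[of y x z]
    by linarith
  finally show ?thesis .
qed


section \<open>Quaternionic Hermitian vector spaces\<close>

definition quat_comb :: "('m \<Rightarrow> 'm) \<Rightarrow> ('m \<Rightarrow> 'm) \<Rightarrow> ('m \<Rightarrow> 'm) \<Rightarrow> real \<Rightarrow> real \<Rightarrow> real \<Rightarrow> 'm \<Rightarrow> 'm::real_vector"
  where "quat_comb I J K a b c u = a *\<^sub>R I u + b *\<^sub>R J u + c *\<^sub>R K u"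

locale quaternionic_hermitian =
  fixes I J K :: "'m::real_vector \<Rightarrow> 'm" and g :: "'m \<Rightarrow> 'm \<Rightarrow> real"
  assumes lin: "linear I" "linear J" "linear K"
    and sq: "I (I v) = - v" "J (J v) = - v" "K (K v) = - v"
    and mult: "I (J v) = K v" "J (K v) = I v" "K (I v) = J v"
    and g: "bilinear g" and g_sym: "g u v = g v u" and g_pos: "u \<noteq> 0 \<Longrightarrow> g u u > 0"
    and inv: "g (I u) (I v) = g u v" "g (J u) (J v) = g u v" "g (K u) (K v) = g u v"
begin

abbreviation comb :: "real \<Rightarrow> real \<Rightarrow> real \<Rightarrow> 'm \<Rightarrow> 'm" where
  "comb \<equiv> quat_comb I J K"

lemmas comb_def = quat_comb_def[of I J K]

lemma mult': "J (I v) = - K v" "K (J v) = - I v" "I (K v) = - J v"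
  using mult(2)[of "I v"] mult(3)[of "J v"] mult(1)[of "K v"]
    mult(2)[of v] mult(3)[of v] mult(1)[of v] sq linear_neg[OF lin(1)] linear_neg[OF lin(2)] linear_neg[OF lin(3)]
  by (metis mult sq)+

lemmas lin_simps = linear_add[OF lin(1)] linear_add[OF lin(2)] linear_add[OF lin(3)]
  linear_cmul[OF lin(1)] linear_cmul[OF lin(2)] linear_cmul[OF lin(3)]
  linear_neg[OF lin(1)] linear_neg[OF lin(2)] linear_neg[OF lin(3)]

lemmas g_simps = bilinear_ladd[OF g] bilinear_radd[OF g] bilinear_lmul[OF g] bilinear_rmul[OF g]
  bilinear_lneg[OF g] bilinear_rneg[OF g] bilinear_lsub[OF g] bilinear_rsub[OF g]
  bilinear_lzero[OF g] bilinear_rzero[OF g]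

lemma linear_comb: "linear (comb a b c)"
  by (rule linearI) (simp_all add: comb_def lin_simps algebra_simps)

lemma comb_comb: "comb a b c (comb a' b' c' u) = - (a * a' + b * b' + c * c') *\<^sub>R u
    + comb (b * c' - c * b') (c * a' - a * c') (a * b' - b * a') u"
  by (simp add: comb_def lin_simps sq mult mult' algebra_simps)

text \<open>An isometry with square \<open>- 1\<close> is skew.\<close>

lemma skew: "g (I u) v = - g u (I v)" "g (J u) v = - g u (J v)" "g (K u) v = - g u (K v)"
  using inv(1)[of u "I v"] inv(2)[of u "J v"] inv(3)[of u "K v"] by (simp_all add: sq g_simps)

lemma comb_skew: "g (comb a b c u) v = - g u (comb a b c v)"
  by (simp add: comb_def g_simps skew algebra_simps)

lemma comb_self: "g (comb a b c u) u = 0"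
  using comb_skew[of a b c u u] g_sym[of "comb a b c u" u] by simp

lemma comb_comb_self: "comb a b c (comb a b c u) = - (a\<^sup>2 + b\<^sup>2 + c\<^sup>2) *\<^sub>R u"
  by (simp add: comb_comb power2_eq_square) (simp add: comb_def mult.commute)

lemma comb_sq: "a\<^sup>2 + b\<^sup>2 + c\<^sup>2 = 1 \<Longrightarrow> comb a b c (comb a b c u) = - u"
  by (simp only: comb_comb_self) simp

lemma comb_isometry: "a\<^sup>2 + b\<^sup>2 + c\<^sup>2 = 1 \<Longrightarrow> g (comb a b c u) (comb a b c v) = g u v"
  by (simp add: comb_skew comb_sq g_simps)

lemma comb_eq_0D:
  assumes "comb a b c u = 0" "u \<noteq> 0"
  shows "a = 0 \<and> b = 0 \<and> c = 0"
proof -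
  have "g (comb a b c u) (comb a b c u) = (a\<^sup>2 + b\<^sup>2 + c\<^sup>2) * g u u"
    by (simp only: comb_skew comb_comb_self g_simps) (simp add: algebra_simps)
  with assms g_pos[of u] have "a\<^sup>2 + b\<^sup>2 + c\<^sup>2 = 0" by (simp add: g_simps)
  then show ?thesis by (simp add: add_nonneg_eq_0_iff)
qed

text \<open>If \<open>L' = a' I + b' J + c' K\<close> is orthogonal to \<open>L = a I + b J + c K\<close>, then \<open>L L'\<close> is again a
  combination of \<open>I\<close>, \<open>J\<close>, \<open>K\<close> and hence skew: on an \<open>L\<close>-complex line the form of \<open>L'\<close> vanishes.\<close>

lemma comb_orthogonal:
  assumes "a * a' + b * b' + c * c' = 0"
  shows "g (comb a' b' c' u) (comb a b c u) = 0"
proof -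
  have "g (comb a' b' c' u) (comb a b c u) = - g (comb a b c (comb a' b' c' u)) u"
    by (simp add: comb_skew)
  also have "\<dots> = 0" using assms by (simp add: comb_comb comb_self)
  finally show ?thesis .
qed

end

text \<open>Choose \<open>B\<close> among the combinations of \<open>I\<close>, \<open>J\<close>, \<open>K\<close> orthogonal to
  \<open>A = a I + b J + c K\<close>. Then \<open>B A\<close> is a combination as well, so the forms of \<open>B\<close> and of \<open>B A\<close>
  are closed, and Hitchin's lemma applies to \<open>W = g(B\<cdot>,\<cdot>)\<close>.\<close>

lemma nijenhuis_quat_comb:
  fixes I J K :: "'m::euclidean_space \<Rightarrow> 'm \<Rightarrow> 'm" and g :: "'m \<Rightarrow> 'm \<Rightarrow> 'm \<Rightarrow> real"
  assumes S: "open S" "x \<in> S"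
    and Q: "\<And>y. y \<in> S \<Longrightarrow> quaternionic_hermitian (I y) (J y) (K y) (g y)"
    and dI: "\<And>u. ((\<lambda>y. I y u) has_derivative (\<lambda>w. I' w u)) (at x)"
    and dJ: "\<And>u. ((\<lambda>y. J y u) has_derivative (\<lambda>w. J' w u)) (at x)"
    and dK: "\<And>u. ((\<lambda>y. K y u) has_derivative (\<lambda>w. K' w u)) (at x)"
    and dWI: "\<And>u v. ((\<lambda>y. g y (I y u) v) has_derivative (\<lambda>w. WI w u v)) (at x)"
    and dWJ: "\<And>u v. ((\<lambda>y. g y (J y u) v) has_derivative (\<lambda>w. WJ w u v)) (at x)"
    and dWK: "\<And>u v. ((\<lambda>y. g y (K y u) v) has_derivative (\<lambda>w. WK w u v)) (at x)"
    and closed: "\<And>u v z. WI u v z + WI v z u + WI z u v = 0"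
      "\<And>u v z. WJ u v z + WJ v z u + WJ z u v = 0"
      "\<And>u v z. WK u v z + WK v z u + WK z u v = 0"
    and abc: "a\<^sup>2 + b\<^sup>2 + c\<^sup>2 = 1"
  shows "nijenhuis (quat_comb (I x) (J x) (K x) a b c)
    (\<lambda>w u. a *\<^sub>R I' w u + b *\<^sub>R J' w u + c *\<^sub>R K' w u) u v = 0"
proof -
  interpret Qx: quaternionic_hermitian "I x" "J x" "K x" "g x" by (rule Q[OF S(2)])
  define A where "A y = quat_comb (I y) (J y) (K y) a b c" for y
  define A' where "A' w u = a *\<^sub>R I' w u + b *\<^sub>R J' w u + c *\<^sub>R K' w u" for w u
  have dA: "((\<lambda>y. A y u) has_derivative (\<lambda>w. A' w u)) (at x)" for u
    unfolding A_def A'_def quat_comb_def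
    by (intro has_derivative_add has_derivative_scaleR_right dI dJ dK)
  have linA: "linear (A y)" if "y \<in> S" for y
    unfolding A_def by (rule quaternionic_hermitian.linear_comb[OF Q[OF that]])
  have linA': "linear (A' w)" for w
    by (rule linear_has_derivative[OF S linA dA])
  have sqA: "A y (A y u) = - u" if "y \<in> S" for y u
    unfolding A_def by (rule quaternionic_hermitian.comb_sq[OF Q[OF that] abc])
  have antiA: "A x (A' w u) = - A' w (A x u)" for w u
  proof -
    have "((\<lambda>y. A y (A y u)) has_derivative (\<lambda>w. A' w (A x u) + A x (A' w u))) (at x)"
      by (rule has_derivative_linear_apply[OF S linA dA linA' dA])
    moreover have "((\<lambda>y. A y (A y u)) has_derivative (\<lambda>w. 0)) (at x)"
      by (rule has_derivative_transform_within_open[OF has_derivative_const[of "- u"] S])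
         (simp add: sqA)
    ultimately have "(\<lambda>w. A' w (A x u) + A x (A' w u)) = (\<lambda>w. 0)"
      by (rule has_derivative_unique)
    then show ?thesis by (metis add_eq_0_iff)
  qed
  \<comment> \<open>\<open>B = b1 I + b2 J + b3 K\<close>, with an explicit nonzero solution of a linear equation.\<close>
  obtain b1 b2 b3 where orth: "b1 * a + b2 * b + b3 * c = 0" and nz: "\<not> (b1 = 0 \<and> b2 = 0 \<and> b3 = 0)"
  proof (cases "a = 0 \<and> b = 0")
    case True
    then show ?thesis using that[of 1 0 0] by simp
  next
    case False
    then show ?thesis using that[of "- b" a 0] by (auto simp: mult.commute)
  qed
  define W where "W y u v = g y (quat_comb (I y) (J y) (K y) b1 b2 b3 u) v" for y u v
  define W' where "W' w u v = b1 * WI w u v + b2 * WJ w u v + b3 * WK w u v" for w u v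
  \<comment> \<open>The coefficients of \<open>B A\<close>, by the cross product.\<close>
  define e1 where "e1 = b2 * c - b3 * b"
  define e2 where "e2 = b3 * a - b1 * c"
  define e3 where "e3 = b1 * b - b2 * a"
  define E' where "E' w u v = e1 * WI w u v + e2 * WJ w u v + e3 * WK w u v" for w u v
  have d_comb: "((\<lambda>y. g y (quat_comb (I y) (J y) (K y) c1 c2 c3 u) v) has_derivative
      (\<lambda>w. c1 * WI w u v + c2 * WJ w u v + c3 * WK w u v)) (at x)" for c1 c2 c3 u v
  proof -
    have "((\<lambda>y. c1 * g y (I y u) v + c2 * g y (J y u) v + c3 * g y (K y u) v) has_derivative
      (\<lambda>w. c1 * WI w u v + c2 * WJ w u v + c3 * WK w u v)) (at x)"
      by (intro has_derivative_add has_derivative_mult_right dWI dWJ dWK)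
    then show ?thesis
    proof (rule has_derivative_transform_within_open[OF _ S])
      fix y assume "y \<in> S"
      then interpret Qy: quaternionic_hermitian "I y" "J y" "K y" "g y" by (rule Q)
      show "c1 * g y (I y u) v + c2 * g y (J y u) v + c3 * g y (K y u) v
          = g y (quat_comb (I y) (J y) (K y) c1 c2 c3 u) v"
        by (simp add: Qy.comb_def Qy.g_simps)
    qed
  qed
  have dW: "((\<lambda>y. W y u v) has_derivative (\<lambda>w. W' w u v)) (at x)" for u v
    unfolding W_def W'_def by (rule d_comb)
  have bilW: "bilinear (W y)" if "y \<in> S" for y
  proof -
    interpret Qy: quaternionic_hermitian "I y" "J y" "K y" "g y" by (rule Q[OF that])
    show ?thesis
      unfolding bilinear_def W_def
      by (auto intro!: linearI simp: Qy.g_simps linear_add[OF Qy.linear_comb] linear_cmul[OF Qy.linear_comb])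
  qed
  have WA: "W y (A y u) v = g y (quat_comb (I y) (J y) (K y) e1 e2 e3 u) v" if "y \<in> S" for y u v
  proof -
    interpret Qy: quaternionic_hermitian "I y" "J y" "K y" "g y" by (rule Q[OF that])
    show ?thesis using orth by (simp add: W_def A_def Qy.comb_comb e1_def e2_def e3_def)
  qed
  have skew_deriv: "c1 * WI w u v + c2 * WJ w u v + c3 * WK w u v
      = - (c1 * WI w v u + c2 * WJ w v u + c3 * WK w v u)" for c1 c2 c3 w u v
  proof -
    have "((\<lambda>y. g y (quat_comb (I y) (J y) (K y) c1 c2 c3 u) v) has_derivative
      (\<lambda>w. - (c1 * WI w v u + c2 * WJ w v u + c3 * WK w v u))) (at x)"
    proof (rule has_derivative_transform_within_open[OF has_derivative_minus[OF d_comb] S])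
      fix y assume "y \<in> S"
      then interpret Qy: quaternionic_hermitian "I y" "J y" "K y" "g y" by (rule Q)
      show "- g y (quat_comb (I y) (J y) (K y) c1 c2 c3 v) u
          = g y (quat_comb (I y) (J y) (K y) c1 c2 c3 u) v"
        by (simp add: Qy.comb_skew Qy.g_sym[of _ u])
    qed
    from has_derivative_unique[OF d_comb this] show ?thesis by metis
  qed
  have W_N: "W x (nijenhuis (A x) A' u v) z = 0" for z
  proof (rule closed_forms_nijenhuis[where W' = W' and E' = E'])
    show "bilinear (W x)" by (rule bilW[OF S(2)])
    show "A x (A x u) = - u" for u by (rule sqA[OF S(2)])
    show "A x (A' w u) = - A' w (A x u)" for w u by (rule antiA)
    show "W x (A x u) v = W x u (A x v)" for u v
    proof -
      have "W x u (A x v) = - g x (A x v) (quat_comb (I x) (J x) (K x) b1 b2 b3 u) * -1"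
        by (simp add: W_def Qx.g_sym)
      also have "\<dots> = - g x v (A x (quat_comb (I x) (J x) (K x) b1 b2 b3 u))"
        by (simp add: A_def Qx.comb_skew)
      also have "\<dots> = g x (quat_comb (I x) (J x) (K x) e1 e2 e3 u) v"
      proof -
        have "a * b1 + b * b2 + c * b3 = 0" using orth by (simp add: mult.commute)
        then have "A x (quat_comb (I x) (J x) (K x) b1 b2 b3 u) = - quat_comb (I x) (J x) (K x) e1 e2 e3 u"
          by (simp add: A_def Qx.comb_comb)
             (simp add: quat_comb_def e1_def e2_def e3_def algebra_simps)
        then show ?thesis by (simp add: Qx.g_simps Qx.g_sym[of v])
      qed
      finally show ?thesis by (simp add: WA[OF S(2)])
    qed
    have linW': "linear (\<lambda>u. W' w u v)" for w v
      by (rule linear_has_derivative[OF S _ dW])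
         (use bilW in \<open>simp add: bilinear_def\<close>)
    show "W' w (- u) v = - W' w u v" for w u v
      using linear_neg[OF linW'] by simp
    show "W' w u v = - W' w v u" for w u v
      unfolding W'_def by (rule skew_deriv)
    show "E' w u v = - E' w v u" for w u v
      unfolding E'_def by (rule skew_deriv)
    show "E' w u v = W' w (A x u) v + W x (A' w u) v" for w u v
    proof -
      have "((\<lambda>y. W y (A y u) v) has_derivative (\<lambda>w. W' w (A x u) v + W x (A' w u) v)) (at x)"
        by (rule has_derivative_linear_apply[OF S _ dW linW' dA])
           (use bilW in \<open>simp add: bilinear_def\<close>)
      moreover have "((\<lambda>y. W y (A y u) v) has_derivative (\<lambda>w. E' w u v)) (at x)"
        unfolding E'_def
        by (rule has_derivative_transform_within_open[OF d_comb S]) (simp add: WA)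
      ultimately show ?thesis using has_derivative_unique by metis
    qed
    show "W' u v z + W' v z u + W' z u v = 0" "E' u v z + E' v z u + E' z u v = 0" for u v z
    proof -
      have "c1 * WI u v z + c2 * WJ u v z + c3 * WK u v z + (c1 * WI v z u + c2 * WJ v z u + c3 * WK v z u)
          + (c1 * WI z u v + c2 * WJ z u v + c3 * WK z u v)
        = c1 * (WI u v z + WI v z u + WI z u v) + c2 * (WJ u v z + WJ v z u + WJ z u v)
          + c3 * (WK u v z + WK v z u + WK z u v)" for c1 c2 c3
        by (simp add: algebra_simps)
      then show "W' u v z + W' v z u + W' z u v = 0" "E' u v z + E' v z u + E' z u v = 0"
        by (simp_all add: W'_def E'_def closed)
    qed
  qed
  \<comment> \<open>\<open>W\<close> is nondegenerate since \<open>B\<close> is injective.\<close>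
  let ?n = "nijenhuis (A x) A' u v"
  have "g x (quat_comb (I x) (J x) (K x) b1 b2 b3 ?n) (quat_comb (I x) (J x) (K x) b1 b2 b3 ?n) = 0"
    using W_N by (simp add: W_def)
  then have "quat_comb (I x) (J x) (K x) b1 b2 b3 ?n = 0"
    using Qx.g_pos by (metis less_irrefl)
  with nz Qx.comb_eq_0D have "?n = 0" by blast
  then show ?thesis by (simp add: A_def A'_def[abs_def])
qed


section \<open>Powers of a two-form as sums over permutations\<close>

lemma permutes_sign_compose:
  fixes p q :: "'a \<Rightarrow> 'a"
  assumes "finite S" "p permutes S" "q permutes S"
  shows "sign (p \<circ> q) = sign p * sign q"
  using assms by (intro sign_compose permutes_imp_permutation)

lemma sum_permutations_const: "(\<Sum>\<pi> | \<pi> permutes {..<n::nat}. c) = fact n * (c::real)"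
  by (simp add: card_permutations)

text \<open>In the wedge product of the \<open>s\<close>-th power with \<open>\<xi>\<close>, a permutation \<open>\<sigma>\<close> of the first \<open>2s\<close>
  entries, coming from the power, composes with the permutation \<open>\<pi>\<close> of all entries. Every
  composite arises \<open>(2s)!\<close> times, which cancels the normalisation.\<close>

lemma form_power_2_expand:
  assumes dep: "\<And>v. \<xi> i p v = \<xi> i p (vec2 (v 0) (v 1))"
  shows "form_power 2 \<xi> s i p v = (\<Sum>\<pi> | \<pi> permutes {..<2 * s}.
      of_int (sign \<pi>) * (\<Prod>l<s. \<xi> i p (vec2 (v (\<pi> (2 * l))) (v (\<pi> (2 * l + 1)))))) / 2 ^ s"
proof (induction s arbitrary: v)
  case 0
  then show ?case by simp
next
  case (Suc s)
  define F where "F \<rho> = of_int (sign \<rho>) *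
    (\<Prod>l<Suc s. \<xi> i p (vec2 (v (\<rho> (2 * l))) (v (\<rho> (2 * l + 1)))))" for \<rho>
  let ?P = "\<lambda>n. {\<pi>. \<pi> permutes {..<n::nat}}"
  have inner: "of_int (sign \<pi>) * form_power 2 \<xi> s i p (\<lambda>j. v (\<pi> j)) * \<xi> i p (\<lambda>j. v (\<pi> (2 * s + j)))
      = (\<Sum>\<sigma>\<in>?P (2 * s). F (\<pi> \<circ> \<sigma>)) / 2 ^ s" if "\<pi> \<in> ?P (2 * s + 2)" for \<pi>
  proof -
    have "of_int (sign \<pi>) * (of_int (sign \<sigma>) *
        (\<Prod>l<s. \<xi> i p (vec2 (v (\<pi> (\<sigma> (2 * l)))) (v (\<pi> (\<sigma> (2 * l + 1)))))))
        * \<xi> i p (\<lambda>j. v (\<pi> (2 * s + j))) = F (\<pi> \<circ> \<sigma>)" if "\<sigma> \<in> ?P (2 * s)" for \<sigma>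
    proof -
      have \<sigma>: "\<sigma> permutes {..<2 * s}" "\<sigma> permutes {..<2 * s + 2}"
        using that by (auto intro: permutes_subset)
      then have "sign (\<pi> \<circ> \<sigma>) = sign \<pi> * sign \<sigma>"
        using \<open>\<pi> \<in> _\<close> by (intro permutes_sign_compose[of "{..<2 * s + 2}"]) auto
      moreover have "\<sigma> (2 * s) = 2 * s" "\<sigma> (2 * s + 1) = 2 * s + 1"
        by (rule permutes_not_in[OF \<sigma>(1)]; simp)+
      moreover have "\<xi> i p (\<lambda>j. v (\<pi> (2 * s + j))) = \<xi> i p (vec2 (v (\<pi> (2 * s))) (v (\<pi> (2 * s + 1))))"
        by (subst dep) simp
      ultimately show ?thesis by (simp add: F_def)
    qed
    then show ?thesis
      unfolding Suc.IH
      by (simp only: times_divide_eq_right times_divide_eq_left sum_distrib_left sum_distrib_right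
          cong: sum.cong)
  qed
  have "form_power 2 \<xi> (Suc s) i p v
      = (\<Sum>\<pi>\<in>?P (2 * s + 2). (\<Sum>\<sigma>\<in>?P (2 * s). F (\<pi> \<circ> \<sigma>)) / 2 ^ s) / (fact (2 * s) * fact 2)"
    unfolding form_power.simps wedge_def by (simp only: inner cong: sum.cong)
  also have "(\<Sum>\<pi>\<in>?P (2 * s + 2). (\<Sum>\<sigma>\<in>?P (2 * s). F (\<pi> \<circ> \<sigma>)) / 2 ^ s)
      = (\<Sum>\<sigma>\<in>?P (2 * s). \<Sum>\<pi>\<in>?P (2 * s + 2). F (\<pi> \<circ> \<sigma>)) / 2 ^ s"
    by (simp only: sum_divide_distrib[symmetric] sum.swap[of _ "?P (2 * s)"])
  also have "(\<Sum>\<sigma>\<in>?P (2 * s). \<Sum>\<pi>\<in>?P (2 * s + 2). F (\<pi> \<circ> \<sigma>)) = (\<Sum>\<sigma>\<in>?P (2 * s). sum F (?P (2 * s + 2)))"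
  proof (rule sum.cong[OF refl])
    fix \<sigma> assume "\<sigma> \<in> ?P (2 * s)"
    then have "\<sigma> permutes {..<2 * s + 2}" by (auto intro: permutes_subset)
    from sum_permutations_compose_right[OF this, of F]
    show "(\<Sum>\<pi>\<in>?P (2 * s + 2). F (\<pi> \<circ> \<sigma>)) = sum F (?P (2 * s + 2))" by simp
  qed
  finally have "form_power 2 \<xi> (Suc s) i p v = sum F (?P (2 * s + 2)) / 2 ^ Suc s"
    by (simp only: sum_permutations_const) (simp add: fact_2)
  then show ?case by (simp add: F_def)
qed

text \<open>A permutation \<open>\<rho>\<close> of \<open>{0, \<dots>, n}\<close> is determined by \<open>k = \<rho> 0\<close> and by a permutation
  \<open>\<pi>\<close> of \<open>n\<close> letters, acting on the sequence \<open>0, \<dots>, n\<close> with \<open>k\<close> omitted. The signs are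
  those in the exterior derivative, which thereby becomes a sum over permutations.\<close>

definition skip :: "nat \<Rightarrow> nat \<Rightarrow> nat" where
  "skip k j = (if j < k then j else Suc j)"

definition front :: "nat \<Rightarrow> (nat \<Rightarrow> nat) \<Rightarrow> nat \<Rightarrow> nat" where
  "front k \<pi> = case_nat k (\<lambda>j. skip k (\<pi> j))"

lemma front_id_permutes_sign:
  "front k id permutes {..k} \<and> sign (front k id) = (-1) ^ k"
proof (induction k)
  case 0
  have "front 0 id = id" by (auto simp: front_def skip_def fun_eq_iff split: nat.split)
  then show ?case by (simp only: permutes_id sign_id power_0 simp_thms)
next
  case (Suc k)
  have step: "front (Suc k) id = Transposition.transpose k (Suc k) \<circ> front k id"
    by (auto simp: front_def skip_def fun_eq_iff Transposition.transpose_def split: nat.split)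
  have p: "front k id permutes {..Suc k}" by (rule permutes_subset[OF conjunct1[OF Suc]]) simp
  have t: "Transposition.transpose k (Suc k) permutes {..Suc k}" by (rule permutes_swap_id) auto
  show ?case
    unfolding step permutes_sign_compose[OF finite_atMost t p] conjunct2[OF Suc]
    by (rule conjI[OF permutes_compose[OF p t]]) (simp add: sign_swap_id)
qed

lemma front_permutes:
  assumes "k \<le> n" "\<pi> permutes {..<n}"
  shows "front k \<pi> permutes {..<Suc n}" "sign (front k \<pi>) = (-1) ^ k * sign \<pi>"
proof -
  have bij: "bij_betw Suc {..<n} {1..<Suc n}"
    by (auto simp: bij_betw_def image_Suc_lessThan)
  have lift: "front 0 \<pi> = map_permutation {..<n} Suc \<pi>"
  proof
    fix j
    have img: "Suc ` {..<n} = {1..n}" by (auto simp: image_Suc_lessThan)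
    have "map_permutation {..<n} Suc \<pi> (Suc j) = Suc (\<pi> j)" for j
    proof (cases "j < n")
      case True
      then show ?thesis using map_permutation_apply[of Suc "{..<n}" j \<pi>] by simp
    next
      case False
      then show ?thesis
        using permutes_not_in[OF assms(2), of j] by (simp add: map_permutation_def restrict_id_def img)
    qed
    moreover have "map_permutation {..<n} Suc \<pi> 0 = 0"
      by (simp add: map_permutation_def restrict_id_def img)
    ultimately show "front 0 \<pi> j = map_permutation {..<n} Suc \<pi> j"
      by (cases j) (auto simp: front_def skip_def)
  qed
  have l: "front 0 \<pi> permutes {..<Suc n}"
    unfolding lift by (rule permutes_subset[OF map_permutation_permutes[OF bij assms(2)]]) auto
  have f: "front k id permutes {..<Suc n}"
    by (rule permutes_subset[OF conjunct1[OF front_id_permutes_sign]]) (use assms(1) in auto)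
  have comp: "front k \<pi> = front k id \<circ> front 0 \<pi>"
    by (auto simp: front_def skip_def fun_eq_iff split: nat.split)
  show "front k \<pi> permutes {..<Suc n}" unfolding comp by (rule permutes_compose[OF l f])
  have "sign (front 0 \<pi>) = sign \<pi>"
    unfolding lift by (rule sign_map_permutation) (use assms in auto)
  then show "sign (front k \<pi>) = (-1) ^ k * sign \<pi>"
    unfolding comp permutes_sign_compose[OF finite_lessThan f l] conjunct2[OF front_id_permutes_sign]
    by simp
qed

lemma sum_front:
  fixes F :: "(nat \<Rightarrow> nat) \<Rightarrow> real"
  shows "(\<Sum>k\<le>n. \<Sum>\<pi> | \<pi> permutes {..<n}. (-1) ^ k * of_int (sign \<pi>) * F (front k \<pi>))
    = (\<Sum>\<rho> | \<rho> permutes {..<Suc n}. of_int (sign \<rho>) * F \<rho>)"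
proof -
  let ?D = "{..n} \<times> {\<pi>. \<pi> permutes {..<n}}" and ?f = "\<lambda>(k, \<pi>). front k \<pi>"
  let ?R = "{\<rho>. \<rho> permutes {..<Suc n}}"
  have inj: "inj_on ?f ?D"
  proof (rule inj_onI, clarify)
    fix k \<pi> k' \<pi>' assume eq: "front k \<pi> = front k' \<pi>'"
    then have "k = k'" by (metis front_def nat.case(1))
    moreover have "\<pi> j = \<pi>' j" for j
    proof -
      have "skip k (\<pi> j) = skip k (\<pi>' j)" using eq \<open>k = k'\<close> by (metis front_def nat.case(2))
      then show ?thesis by (auto simp: skip_def split: if_splits)
    qed
    ultimately show "k = k' \<and> \<pi> = \<pi>'" by auto
  qed
  have "card (?f ` ?D) = card ?R"
    by (simp add: card_image[OF inj] card_cartesian_product card_permutations)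
  moreover have sub: "?f ` ?D \<subseteq> ?R" using front_permutes(1) by auto
  ultimately have "?f ` ?D = ?R"
    by (intro card_subset_eq) (auto intro: finite_permutations)
  with inj have bij: "bij_betw ?f ?D ?R" by (simp add: bij_betw_def)
  have "(\<Sum>k\<le>n. \<Sum>\<pi> | \<pi> permutes {..<n}. (-1) ^ k * of_int (sign \<pi>) * F (front k \<pi>))
      = (\<Sum>(k, \<pi>)\<in>?D. of_int (sign (front k \<pi>)) * F (front k \<pi>))"
    unfolding sum.cartesian_product by (intro sum.cong) (auto simp: front_permutes(2))
  also have "\<dots> = (\<Sum>x\<in>?D. of_int (sign (?f x)) * F (?f x))"
    by (intro sum.cong) auto
  also have "\<dots> = (\<Sum>\<rho>\<in>?R. of_int (sign \<rho>) * F \<rho>)"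
    by (rule sum.reindex_bij_betw[OF bij])
  finally show ?thesis .
qed

text \<open>With \<open>T w u v\<close> the derivative of \<open>\<xi>(u, v)\<close> in the direction \<open>w\<close>, the \<open>m\<close>-th summand of the
  Leibniz rule for \<open>d(\<xi>\<^sup>s)\<close>, up to a factor.\<close>

definition leibniz_term :: "('x \<Rightarrow> 'x \<Rightarrow> 'x \<Rightarrow> real) \<Rightarrow> ('x \<Rightarrow> 'x \<Rightarrow> real) \<Rightarrow> nat \<Rightarrow> nat \<Rightarrow>
    (nat \<Rightarrow> 'x) \<Rightarrow> real" where
  "leibniz_term T X s m u = T (u 0) (u (2 * m + 1)) (u (2 * m + 2)) *
     (\<Prod>l\<in>{..<s} - {m}. X (u (2 * l + 1)) (u (2 * l + 2)))"

definition leibniz_sum :: "('x \<Rightarrow> 'x \<Rightarrow> 'x \<Rightarrow> real) \<Rightarrow> ('x \<Rightarrow> 'x \<Rightarrow> real) \<Rightarrow> nat \<Rightarrow> nat \<Rightarrow>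
    (nat \<Rightarrow> 'x) \<Rightarrow> real" where
  "leibniz_sum T X s m v = (\<Sum>\<rho> | \<rho> permutes {..<2 * s + 1}.
     of_int (sign \<rho>) * leibniz_term T X s m (\<lambda>c. v (\<rho> c)))"

lemma ext_deriv_form_power_2:
  fixes A :: "('i, 'a, 'x::euclidean_space) manifold"
  assumes S: "open S" "coord A i p \<in> S" and p: "inv_coord A i (coord A i p) = p"
    and dep: "\<And>y v. y \<in> S \<Longrightarrow> \<xi> i (inv_coord A i y) v = \<xi> i (inv_coord A i y) (vec2 (v 0) (v 1))"
    and deriv: "\<And>u v. ((\<lambda>y. \<xi> i (inv_coord A i y) (vec2 u v)) has_derivative (\<lambda>w. D w u v))
      (at (coord A i p))"
  shows "ext_deriv (2 * s) A (form_power 2 \<xi> s) i p v =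
    (\<Sum>m<s. leibniz_sum D (\<lambda>u v. \<xi> i p (vec2 u v)) s m v) / 2 ^ s"
proof -
  let ?X = "\<lambda>u v. \<xi> i p (vec2 u v)" and ?x = "coord A i p"
  have term_deriv: "frechet_derivative (\<lambda>y. form_power 2 \<xi> s i (inv_coord A i y) u) (at ?x) =
    (\<lambda>w. (\<Sum>\<pi> | \<pi> permutes {..<2 * s}. of_int (sign \<pi>) *
        (\<Sum>m<s. leibniz_term D ?X s m (case_nat w (\<lambda>j. u (\<pi> j))))) / 2 ^ s)" for u
  proof (rule frechet_derivative_at[symmetric])
    let ?h = "\<lambda>y. (\<Sum>\<pi> | \<pi> permutes {..<2 * s}. of_int (sign \<pi>) *
        (\<Prod>l<s. \<xi> i (inv_coord A i y) (vec2 (u (\<pi> (2 * l))) (u (\<pi> (2 * l + 1)))))) * inverse (2 ^ s)"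
    have "(?h has_derivative (\<lambda>w. (\<Sum>\<pi> | \<pi> permutes {..<2 * s}. of_int (sign \<pi>) *
        (\<Sum>m<s. D w (u (\<pi> (2 * m))) (u (\<pi> (2 * m + 1))) *
          (\<Prod>l\<in>{..<s} - {m}. \<xi> i (inv_coord A i ?x) (vec2 (u (\<pi> (2 * l))) (u (\<pi> (2 * l + 1)))))))
        * inverse (2 ^ s))) (at ?x)"
      by (intro has_derivative_mult_left has_derivative_sum has_derivative_mult_right
            has_derivative_prod deriv)
    then have "(?h has_derivative (\<lambda>w. (\<Sum>\<pi> | \<pi> permutes {..<2 * s}. of_int (sign \<pi>) *
        (\<Sum>m<s. leibniz_term D ?X s m (case_nat w (\<lambda>j. u (\<pi> j))))) / 2 ^ s)) (at ?x)"
      by (simp add: leibniz_term_def p divide_inverse)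
    then show "((\<lambda>y. form_power 2 \<xi> s i (inv_coord A i y) u) has_derivative
        (\<lambda>w. (\<Sum>\<pi> | \<pi> permutes {..<2 * s}. of_int (sign \<pi>) *
        (\<Sum>m<s. leibniz_term D ?X s m (case_nat w (\<lambda>j. u (\<pi> j))))) / 2 ^ s)) (at ?x)"
    proof (rule has_derivative_transform_within_open[OF _ S])
      fix y assume "y \<in> S"
      from form_power_2_expand[of \<xi> i "inv_coord A i y", OF dep[OF this], of s u]
      show "?h y = form_power 2 \<xi> s i (inv_coord A i y) u" by (simp add: divide_inverse)
    qed
  qed
  have "ext_deriv (2 * s) A (form_power 2 \<xi> s) i p v =
      (\<Sum>k\<le>2 * s. (-1) ^ k * ((\<Sum>\<pi> | \<pi> permutes {..<2 * s}. of_int (sign \<pi>) *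
        (\<Sum>m<s. leibniz_term D ?X s m (case_nat (v k) (\<lambda>j. v (skip k (\<pi> j)))))) / 2 ^ s))"
    unfolding ext_deriv_def term_deriv by (simp add: skip_def if_distrib)
  also have "\<dots> = (\<Sum>k\<le>2 * s. \<Sum>\<pi> | \<pi> permutes {..<2 * s}. (-1) ^ k * of_int (sign \<pi>) *
      (\<Sum>m<s. leibniz_term D ?X s m (\<lambda>c. v (front k \<pi> c)))) / 2 ^ s"
  proof -
    have "case_nat (v k) (\<lambda>j. v (skip k (\<pi> j))) = (\<lambda>c. v (front k \<pi> c))" for k \<pi>
      by (auto simp: front_def fun_eq_iff split: nat.split)
    then show ?thesis by (simp add: sum_divide_distrib sum_distrib_left mult.assoc)
  qed
  also have "\<dots> = (\<Sum>\<rho> | \<rho> permutes {..<Suc (2 * s)}. of_int (sign \<rho>) *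
      (\<Sum>m<s. leibniz_term D ?X s m (\<lambda>c. v (\<rho> c)))) / 2 ^ s"
    by (subst sum_front[of "\<lambda>\<rho>. \<Sum>m<s. leibniz_term D ?X s m (\<lambda>c. v (\<rho> c))"]) (rule refl)
  also have "\<dots> = (\<Sum>m<s. leibniz_sum D ?X s m v) / 2 ^ s"
    unfolding leibniz_sum_def sum_distrib_left by (subst sum.swap) simp
  finally show ?thesis .
qed

text \<open>The rotation \<open>\<kappa>\<close> of the three positions of the arguments of \<open>T\<close> is an even permutation, which
  leaves the other positions alone. Thus three times the sum is the sum with \<open>T\<close> replaced by its
  cyclic sum.\<close>

lemma leibniz_sum_cyclic:
  assumes "m < s" "\<And>w u v. T w u v + T u v w + T v w u = 0"
  shows "leibniz_sum T X s m v = 0"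
proof -
  define a b where "a = 2 * m + 1" and "b = 2 * m + 2"
  define \<kappa> where "\<kappa> = Transposition.transpose 0 a \<circ> Transposition.transpose a b"
  have \<kappa>_simps: "\<kappa> 0 = a" "\<kappa> a = b" "\<kappa> b = 0" "\<And>c. c \<noteq> 0 \<Longrightarrow> c \<noteq> a \<Longrightarrow> c \<noteq> b \<Longrightarrow> \<kappa> c = c"
    by (auto simp: \<kappa>_def Transposition.transpose_def a_def b_def)
  have t: "Transposition.transpose 0 a permutes {..<2 * s + 1}" "Transposition.transpose a b permutes {..<2 * s + 1}"
    using assms(1) by (auto intro!: permutes_swap_id simp: a_def b_def)
  have \<kappa>: "\<kappa> permutes {..<2 * s + 1}" unfolding \<kappa>_def by (rule permutes_compose[OF t(2,1)])
  have sign_\<kappa>: "sign \<kappa> = 1"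
    unfolding \<kappa>_def permutes_sign_compose[OF finite_lessThan t] by (simp add: sign_swap_id a_def b_def)
  define F where "F \<rho> = of_int (sign \<rho>) * leibniz_term T X s m (\<lambda>c. v (\<rho> c))" for \<rho>
  define P where "P \<rho> = of_int (sign \<rho>) *
    (\<Prod>l\<in>{..<s} - {m}. X (v (\<rho> (2 * l + 1))) (v (\<rho> (2 * l + 2))))" for \<rho>
  have P_\<kappa>: "P (\<rho> \<circ> \<kappa>) = P \<rho>" if "\<rho> permutes {..<2 * s + 1}" for \<rho>
  proof -
    have "\<kappa> (2 * l + 1) = 2 * l + 1" "\<kappa> (2 * l + 2) = 2 * l + 2" if "l \<noteq> m" for l
    proof -
      have "2 * l + 1 \<noteq> a" "2 * l + 1 \<noteq> b" "2 * l + 2 \<noteq> a" "2 * l + 2 \<noteq> b"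
        using that unfolding a_def b_def by presburger+
      then show "\<kappa> (2 * l + 1) = 2 * l + 1" "\<kappa> (2 * l + 2) = 2 * l + 2"
        by (auto intro: \<kappa>_simps(4))
    qed
    then show ?thesis
      unfolding P_def permutes_sign_compose[OF finite_lessThan that \<kappa>] sign_\<kappa>
      by (intro arg_cong2[where f = "(*)"] prod.cong) auto
  qed
  have F: "F \<rho> = P \<rho> * T (v (\<rho> 0)) (v (\<rho> a)) (v (\<rho> b))" for \<rho>
    by (simp add: F_def P_def leibniz_term_def a_def b_def)
  let ?R = "{\<rho>. \<rho> permutes {..<2 * s + 1}}"
  have rot: "sum F ?R = (\<Sum>\<rho>\<in>?R. F (\<rho> \<circ> \<kappa>))" "sum F ?R = (\<Sum>\<rho>\<in>?R. F (\<rho> \<circ> (\<kappa> \<circ> \<kappa>)))"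
    using sum_permutations_compose_right[OF \<kappa>, of F]
      sum_permutations_compose_right[OF permutes_compose[OF \<kappa> \<kappa>], of F] by simp_all
  have "3 * sum F ?R = (\<Sum>\<rho>\<in>?R. F \<rho> + F (\<rho> \<circ> \<kappa>) + F (\<rho> \<circ> (\<kappa> \<circ> \<kappa>)))"
    using rot by (simp add: sum.distrib)
  also have "\<dots> = 0"
  proof (rule sum.neutral, rule ballI)
    fix \<rho> assume "\<rho> \<in> ?R"
    then have \<rho>: "\<rho> permutes {..<2 * s + 1}" by simp
    have "P (\<rho> \<circ> \<kappa>) = P \<rho>" "P (\<rho> \<circ> (\<kappa> \<circ> \<kappa>)) = P \<rho>"
      using P_\<kappa>[OF \<rho>] P_\<kappa>[OF permutes_compose[OF \<kappa> \<rho>]] by (simp_all add: o_assoc)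
    then have "F \<rho> + F (\<rho> \<circ> \<kappa>) + F (\<rho> \<circ> (\<kappa> \<circ> \<kappa>)) = P \<rho> * (T (v (\<rho> 0)) (v (\<rho> a)) (v (\<rho> b))
        + T (v (\<rho> a)) (v (\<rho> b)) (v (\<rho> 0)) + T (v (\<rho> b)) (v (\<rho> 0)) (v (\<rho> a)))"
      by (simp add: F \<kappa>_simps algebra_simps)
    then show "F \<rho> + F (\<rho> \<circ> \<kappa>) + F (\<rho> \<circ> (\<kappa> \<circ> \<kappa>)) = 0" by (simp add: assms(2))
  qed
  finally show ?thesis by (simp add: leibniz_sum_def F_def)
qed

lemma leibniz_sum_diff:
  "leibniz_sum (\<lambda>w u v. T w u v - T' w u v) X s m v = leibniz_sum T X s m v - leibniz_sum T' X s m v"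
  by (simp add: leibniz_sum_def leibniz_term_def sum_subtractf[symmetric] algebra_simps)

text \<open>The transposition of the positions of two equal vectors changes the signs of the terms only.\<close>

lemma leibniz_sum_repeated:
  assumes "v a = v b" "a \<noteq> b" "a < 2 * s + 1" "b < 2 * s + 1"
  shows "leibniz_sum T X s m v = 0"
proof -
  define F where "F \<rho> = of_int (sign \<rho>) * leibniz_term T X s m (\<lambda>c. v (\<rho> c))" for \<rho>
  let ?R = "{\<rho>. \<rho> permutes {..<2 * s + 1}}"
  have t: "Transposition.transpose a b permutes {..<2 * s + 1}" using assms by (intro permutes_swap_id) auto
  have v: "v (Transposition.transpose a b c) = v c" for c using assms(1) by (auto simp: Transposition.transpose_def)
  have "F (Transposition.transpose a b \<circ> \<rho>) = - F \<rho>" if "\<rho> \<in> ?R" for \<rho>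
    using that permutes_sign_compose[OF finite_lessThan t, of \<rho>] assms(2)
    by (simp add: F_def v sign_swap_id)
  then have "(\<Sum>\<rho>\<in>?R. F (Transposition.transpose a b \<circ> \<rho>)) = - sum F ?R"
    by (simp add: sum_negf)
  with setum_permutations_compose_left[OF t, of F] have "sum F ?R = 0" by simp
  then show ?thesis by (simp add: leibniz_sum_def F_def)
qed

text \<open>Arbitrary vectors are admitted in one more slot at each step of the induction on \<open>k\<close>.\<close>

lemma multilinear_eq_0_on_spanning_set:
  fixes \<Phi> :: "(nat \<Rightarrow> 'x::real_vector) \<Rightarrow> real"
  assumes lin: "\<And>j v. j < n \<Longrightarrow> linear (\<lambda>x. \<Phi> (v(j := x)))" and span: "span B = UNIV"
    and zero: "\<And>v. (\<And>j. j < n \<Longrightarrow> v j \<in> B) \<Longrightarrow> \<Phi> v = 0"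
  shows "\<Phi> v = 0"
proof -
  have "\<Phi> v = 0" if "k \<le> n" "\<And>j. k \<le> j \<Longrightarrow> j < n \<Longrightarrow> v j \<in> B" for k v
    using that
  proof (induction k arbitrary: v)
    case 0
    then show ?case by (intro zero) simp
  next
    case (Suc k)
    have "\<Phi> (v(k := b)) = 0" if "b \<in> B" for b
    proof (rule Suc.IH)
      show "(v(k := b)) j \<in> B" if "k \<le> j" "j < n" for j
        using Suc.prems(2)[of j] \<open>b \<in> B\<close> that by simp
    qed (use Suc.prems in simp)
    with linear_eq_0_on_span[OF lin[of k v], of B "v k"] span Suc.prems(1)
    have "\<Phi> (v(k := v k)) = 0" by simp
    then show ?case by simp
  qed
  from this[of n v] show ?thesis by simp
qed

lemma leibniz_term_linear:
  fixes T :: "'x::real_vector \<Rightarrow> 'x \<Rightarrow> 'x \<Rightarrow> real"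
  assumes T: "\<And>u v. linear (\<lambda>w. T w u v)" "\<And>w v. linear (\<lambda>u. T w u v)" "\<And>w u. linear (\<lambda>v. T w u v)"
    and X: "bilinear X" and c: "c < 2 * s + 1" "m < s"
  shows "linear (\<lambda>x. leibniz_term T X s m (u(c := x)))"
proof -
  have X': "linear (\<lambda>x. X x w)" "linear (\<lambda>x. X w x)" for w
    using X by (simp_all add: bilinear_def)
  have scale: "linear (\<lambda>x. r * f x)" "linear (\<lambda>x. f x * r)" if "linear f" for f :: "'x \<Rightarrow> real" and r
    by (rule linearI; simp add: linear_add[OF that] linear_cmul[OF that] algebra_simps)+
  show ?thesis
  proof (cases "c = 0 \<or> c = 2 * m + 1 \<or> c = 2 * m + 2")
    case True
    have "(\<Prod>l\<in>{..<s} - {m}. X ((u(c := x)) (2 * l + 1)) ((u(c := x)) (2 * l + 2)))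
        = (\<Prod>l\<in>{..<s} - {m}. X (u (2 * l + 1)) (u (2 * l + 2)))" for x
    proof (rule prod.cong[OF refl])
      fix l assume "l \<in> {..<s} - {m}"
      then have "l \<noteq> m" by simp
      then have "2 * l + 1 \<noteq> c" "2 * l + 2 \<noteq> c" using True by presburger+
      then show "X ((u(c := x)) (2 * l + 1)) ((u(c := x)) (2 * l + 2)) = X (u (2 * l + 1)) (u (2 * l + 2))"
        by simp
    qed
    moreover have "linear (\<lambda>x. T ((u(c := x)) 0) ((u(c := x)) (2 * m + 1)) ((u(c := x)) (2 * m + 2)))"
      using True by (elim disjE) (simp_all add: T)
    ultimately show ?thesis
      unfolding leibniz_term_def by (simp only: scale)
  next
    case False
    define l0 where "l0 = (c - 1) div 2"
    have l0: "l0 < s" "l0 \<noteq> m" "c = 2 * l0 + 1 \<or> c = 2 * l0 + 2"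
      using False c unfolding l0_def by presburger+
    let ?r = "T (u 0) (u (2 * m + 1)) (u (2 * m + 2)) *
      (\<Prod>l\<in>{..<s} - {m} - {l0}. X (u (2 * l + 1)) (u (2 * l + 2)))"
    have "(\<Prod>l\<in>{..<s} - {m}. X ((u(c := x)) (2 * l + 1)) ((u(c := x)) (2 * l + 2)))
        = X ((u(c := x)) (2 * l0 + 1)) ((u(c := x)) (2 * l0 + 2)) *
          (\<Prod>l\<in>{..<s} - {m} - {l0}. X (u (2 * l + 1)) (u (2 * l + 2)))" for x
    proof (subst prod.remove[of _ l0])
      have "X ((u(c := x)) (2 * l + 1)) ((u(c := x)) (2 * l + 2)) = X (u (2 * l + 1)) (u (2 * l + 2))"
        if "l \<noteq> l0" for l
      proof -
        have "2 * l + 1 \<noteq> c" "2 * l + 2 \<noteq> c" using l0(3) that by presburger+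
        then show ?thesis by simp
      qed
      then show "X ((u(c := x)) (2 * l0 + 1)) ((u(c := x)) (2 * l0 + 2)) *
          (\<Prod>l\<in>{..<s} - {m} - {l0}. X ((u(c := x)) (2 * l + 1)) ((u(c := x)) (2 * l + 2))) =
        X ((u(c := x)) (2 * l0 + 1)) ((u(c := x)) (2 * l0 + 2)) *
          (\<Prod>l\<in>{..<s} - {m} - {l0}. X (u (2 * l + 1)) (u (2 * l + 2)))"
        by (intro arg_cong2[where f = "(*)"] prod.cong) auto
    qed (use l0 in auto)
    then have "leibniz_term T X s m (u(c := x)) =
        ?r * X ((u(c := x)) (2 * l0 + 1)) ((u(c := x)) (2 * l0 + 2))" for x
      using False by (simp add: leibniz_term_def)
    moreover have "linear (\<lambda>x. X ((u(c := x)) (2 * l0 + 1)) ((u(c := x)) (2 * l0 + 2)))"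
      using l0(3) by (elim disjE) (simp_all add: X')
    ultimately show ?thesis by (simp only: scale)
  qed
qed

lemma leibniz_sum_linear:
  fixes T :: "'x::real_vector \<Rightarrow> 'x \<Rightarrow> 'x \<Rightarrow> real"
  assumes T: "\<And>u v. linear (\<lambda>w. T w u v)" "\<And>w v. linear (\<lambda>u. T w u v)" "\<And>w u. linear (\<lambda>v. T w u v)"
    and X: "bilinear X" and j: "j < 2 * s + 1" "m < s"
  shows "linear (\<lambda>x. leibniz_sum T X s m (v(j := x)))"
  unfolding leibniz_sum_def
proof (rule linear_compose_sum, rule ballI)
  fix \<rho> assume "\<rho> \<in> {\<rho>. \<rho> permutes {..<2 * s + 1}}"
  then have \<rho>: "\<rho> permutes {..<2 * s + 1}" by simp
  have "(\<lambda>c. (v(j := x)) (\<rho> c)) = (\<lambda>c. v (\<rho> c))(inv \<rho> j := x)" for x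
    using permutes_inverses[OF \<rho>] by (auto simp: fun_eq_iff)
  moreover have "inv \<rho> j < 2 * s + 1"
    using permutes_in_image[OF permutes_inv[OF \<rho>], of j] j by simp
  ultimately have lin: "linear (\<lambda>x. leibniz_term T X s m (\<lambda>c. (v(j := x)) (\<rho> c)))"
    using leibniz_term_linear[OF T X _ j(2)] by simp
  show "linear (\<lambda>x. real_of_int (sign \<rho>) * leibniz_term T X s m (\<lambda>c. (v(j := x)) (\<rho> c)))"
    by (rule linearI) (simp_all only: linear_add[OF lin] linear_cmul[OF lin] distrib_left
      real_scaleR_def mult.left_commute)
qed

text \<open>The combinatorial heart of the balancedness. On distinct basis vectors, let \<open>b\<^sub>0\<close>, \<open>b\<^sub>1\<close>, \<open>b\<^sub>2\<close>
  be the arguments of \<open>T\<close> in a nonzero term. All other arguments are matched in pairs by \<open>\<tau>\<close>, the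
  vector \<open>b\<^sub>0\<close> differs in kind from \<open>b\<^sub>1\<close> and \<open>b\<^sub>2\<close>, and the latter are not partners. So the
  partners of \<open>b\<^sub>0\<close> and \<open>b\<^sub>1\<close> do not occur in the term. This is impossible, since \<open>2s + 1\<close> of the
  \<open>2s + 2\<close> basis vectors do.\<close>

lemma leibniz_sum_eq_0:
  fixes T :: "'x::real_vector \<Rightarrow> 'x \<Rightarrow> 'x \<Rightarrow> real"
  assumes T: "\<And>u v. linear (\<lambda>w. T w u v)" "\<And>w v. linear (\<lambda>u. T w u v)" "\<And>w u. linear (\<lambda>v. T w u v)"
    and X: "bilinear X" and m: "m < s"
    and B: "finite B" "card B = 2 * s + 2" "span B = UNIV"
    and \<tau>: "\<And>b. b \<in> B \<Longrightarrow> \<tau> b \<in> B \<and> \<tau> b \<noteq> b \<and> \<tau> (\<tau> b) = b \<and> P (\<tau> b) = P b"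
    and X_B: "\<And>b c. b \<in> B \<Longrightarrow> c \<in> B \<Longrightarrow> X b c \<noteq> 0 \<Longrightarrow> c = \<tau> b"
    and T_B: "\<And>a b c. a \<in> B \<Longrightarrow> b \<in> B \<Longrightarrow> c \<in> B \<Longrightarrow> T a b c \<noteq> 0 \<Longrightarrow> \<not> P a \<and> P b \<and> P c \<and> c \<noteq> \<tau> b"
  shows "leibniz_sum T X s m v = 0"
proof (rule multilinear_eq_0_on_spanning_set[where n = "2 * s + 1" and B = B])
  fix v :: "nat \<Rightarrow> 'x" assume vB: "\<And>j. j < 2 * s + 1 \<Longrightarrow> v j \<in> B"
  show "leibniz_sum T X s m v = 0"
  proof (cases "inj_on v {..<2 * s + 1}")
    case False
    then obtain a b where "v a = v b" "a \<noteq> b" "a < 2 * s + 1" "b < 2 * s + 1"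
      by (auto simp: inj_on_def)
    then show ?thesis by (rule leibniz_sum_repeated)
  next
    case inj: True
    have "leibniz_term T X s m (\<lambda>c. v (\<rho> c)) = 0" if \<rho>: "\<rho> permutes {..<2 * s + 1}" for \<rho>
    proof (rule ccontr)
      assume nz: "leibniz_term T X s m (\<lambda>c. v (\<rho> c)) \<noteq> 0"
      define u where "u c = v (\<rho> c)" for c
      define a b where "a = 2 * m + 1" and "b = 2 * m + 2"
      have ab: "a < 2 * s + 1" "b < 2 * s + 1" "a \<noteq> 0" "b \<noteq> 0" "a \<noteq> b" using m by (auto simp: a_def b_def)
      have uB: "u c \<in> B" if "c < 2 * s + 1" for c
        unfolding u_def using permutes_in_image[OF \<rho>, of c] that vB by simp
      have "inj_on u {..<2 * s + 1}"
        unfolding u_def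
        by (rule comp_inj_on[unfolded comp_def])
           (use inj permutes_inj_on[OF \<rho>] permutes_image[OF \<rho>] in auto)
      then have u_inj: "c = c'" if "u c = u c'" "c < 2 * s + 1" "c' < 2 * s + 1" for c c'
        using that by (auto simp: inj_on_def)
      have "T (u 0) (u a) (u b) \<noteq> 0"
        and pairs: "\<And>l. l < s \<Longrightarrow> l \<noteq> m \<Longrightarrow> X (u (2 * l + 1)) (u (2 * l + 2)) \<noteq> 0"
        using nz unfolding leibniz_term_def u_def a_def b_def by auto
      then have kinds: "\<not> P (u 0)" "P (u a)" "P (u b)" "u b \<noteq> \<tau> (u a)"
        using T_B[of "u 0" "u a" "u b"] uB ab by auto
      \<comment> \<open>Matched vectors have a partner in a different position.\<close>
      have partner: "\<exists>c'. c' < 2 * s + 1 \<and> c' \<noteq> 0 \<and> c' \<noteq> a \<and> c' \<noteq> b \<and> \<tau> (u c) = u c'"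
        if c: "c < 2 * s + 1" "c \<noteq> 0" "c \<noteq> a" "c \<noteq> b" for c
      proof -
        define l where "l = (c - 1) div 2"
        have l: "l < s" "l \<noteq> m" "c = 2 * l + 1 \<or> c = 2 * l + 2"
          using c unfolding l_def a_def b_def by presburger+
        have \<tau>_l: "\<tau> (u (2 * l + 1)) = u (2 * l + 2)"
          using X_B[OF uB uB pairs[OF l(1,2)]] l(1) by simp
        then have \<tau>_l': "\<tau> (u (2 * l + 2)) = u (2 * l + 1)"
          using \<tau>[OF uB[of "2 * l + 1"]] l(1) by simp
        have other: "2 * l + 1 \<noteq> a" "2 * l + 1 \<noteq> b" "2 * l + 2 \<noteq> a" "2 * l + 2 \<noteq> b"
          using l(2) unfolding a_def b_def by presburger+
        from l(3) show ?thesis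
        proof
          assume "c = 2 * l + 1"
          then show ?thesis using \<tau>_l l(1) other by (intro exI[of _ "2 * l + 2"]) simp
        next
          assume "c = 2 * l + 2"
          then show ?thesis using \<tau>_l' l(1) other by (intro exI[of _ "2 * l + 1"]) simp
        qed
      qed
      have free: "\<tau> (u d) \<notin> u ` {..<2 * s + 1}" if d: "d = 0 \<or> d = a" for d
      proof
        assume "\<tau> (u d) \<in> u ` {..<2 * s + 1}"
        then obtain c where c: "c < 2 * s + 1" "\<tau> (u d) = u c" by auto
        have d': "d < 2 * s + 1" using d ab by auto
        note \<tau>_d = \<tau>[OF uB[OF d']]
        show False
        proof (cases "c = 0 \<or> c = a \<or> c = b")
          case True
          then show False using c(2) \<tau>_d d kinds by auto
        next
          case False
          then obtain c' where "c' < 2 * s + 1" "c' \<noteq> 0" "c' \<noteq> a" "\<tau> (u c) = u c'"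
            using partner[OF c(1)] by blast
          moreover have "\<tau> (u c) = u d" using c(2) \<tau>_d by metis
          ultimately show False using u_inj[of c' d] d d' by auto
        qed
      qed
      have \<tau>_0a: "\<tau> (u 0) \<in> B" "\<tau> (u a) \<in> B" "P (\<tau> (u 0)) = P (u 0)" "P (\<tau> (u a)) = P (u a)"
        using \<tau>[OF uB[OF ab(1)]] \<tau>[OF uB[of 0]] by simp_all
      have "\<tau> (u 0) \<noteq> \<tau> (u a)"
        using \<tau>_0a(3,4) kinds by metis
      then have "card {\<tau> (u 0), \<tau> (u a)} = 2" by simp
      moreover have "card (u ` {..<2 * s + 1}) = 2 * s + 1"
        using \<open>inj_on u _\<close> by (simp add: card_image)
      moreover have "{\<tau> (u 0), \<tau> (u a)} \<inter> u ` {..<2 * s + 1} = {}" using free by blast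
      ultimately have "card ({\<tau> (u 0), \<tau> (u a)} \<union> u ` {..<2 * s + 1}) = 2 * s + 3"
        by (subst card_Un_disjoint) auto
      moreover have "card ({\<tau> (u 0), \<tau> (u a)} \<union> u ` {..<2 * s + 1}) \<le> card B"
        by (rule card_mono[OF B(1)]) (use \<tau>_0a(1,2) uB in auto)
      ultimately show False using B(2) by linarith
    qed
    then show ?thesis by (simp add: leibniz_sum_def)
  qed
next
  show "linear (\<lambda>x. leibniz_sum T X s m (v(j := x)))" if "j < 2 * s + 1" for j v
    by (rule leibniz_sum_linear[OF T X that m])
qed (rule B(3))


section \<open>Unitary bases\<close>

text \<open>A basis of pairs \<open>e\<close>, \<open>J e\<close> which is orthogonal for a Hermitian metric \<open>g\<close>. The involution
  \<open>\<tau>\<close> exchanges the vectors of each pair, so that \<open>g (J b) c\<close> vanishes on the basis unless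
  \<open>c = \<tau> b\<close>. A largest orthogonal set of nonzero vectors which is closed under \<open>J\<close> up to sign spans
  the space: otherwise a nonzero vector \<open>u\<close> orthogonal to it could be added together with \<open>J u\<close>.\<close>

lemma unitary_basis:
  fixes J :: "'m::euclidean_space \<Rightarrow> 'm" and g :: "'m \<Rightarrow> 'm \<Rightarrow> real"
  assumes lin: "linear J" and sq: "\<And>v. J (J v) = - v"
    and g: "bilinear g" and sym: "\<And>u v. g u v = g v u" and pos: "\<And>u. u \<noteq> 0 \<Longrightarrow> g u u > 0"
    and inv: "\<And>u v. g (J u) (J v) = g u v"
  obtains E \<tau> where "finite E" "card E = DIM('m)" "span E = UNIV"
    "\<And>b. b \<in> E \<Longrightarrow> \<tau> b \<in> E \<and> \<tau> b \<noteq> b \<and> \<tau> (\<tau> b) = b"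
    "\<And>b. b \<in> E \<Longrightarrow> \<tau> b = J b \<or> \<tau> b = - J b"
    "\<And>b c. b \<in> E \<Longrightarrow> c \<in> E \<Longrightarrow> g (J b) c \<noteq> 0 \<Longrightarrow> c = \<tau> b"
proof -
  note g_simps = bilinear_ladd[OF g] bilinear_radd[OF g] bilinear_lmul[OF g] bilinear_rmul[OF g]
    bilinear_lneg[OF g] bilinear_rneg[OF g] bilinear_lsub[OF g] bilinear_rsub[OF g]
    bilinear_lzero[OF g] bilinear_rzero[OF g]
  have g_sum: "g (sum f A) v = (\<Sum>a\<in>A. g (f a) v)" for f :: "'m \<Rightarrow> 'm" and A v
  proof -
    have "linear (\<lambda>u. g u v)" using g by (simp add: bilinear_def)
    from linear_sum[OF this] show ?thesis .
  qed
  have g_J: "g (J u) v = - g u (J v)" for u v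
    using inv[of u "J v"] by (simp add: sq g_simps)
  have g_J_self: "g (J u) u = 0" for u using g_J[of u u] sym[of "J u" u] by simp
  define good where "good E \<longleftrightarrow> finite E \<and> 0 \<notin> E \<and> (\<forall>b\<in>E. \<forall>c\<in>E. b \<noteq> c \<longrightarrow> g b c = 0) \<and>
    (\<forall>b\<in>E. J b \<in> E \<or> - J b \<in> E)" for E
  have indep: "independent E" if "good E" for E
  proof (rule independent_if_scalars_zero)
    show "finite E" using that by (simp add: good_def)
    fix f b assume 0: "(\<Sum>x\<in>E. f x *\<^sub>R x) = 0" and b: "b \<in> E"
    have "g (\<Sum>x\<in>E. f x *\<^sub>R x) b = (\<Sum>x\<in>E. if x = b then f b * g b b else 0)"
      unfolding g_sum using that b by (intro sum.cong) (auto simp: g_simps good_def)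
    then have "f b * g b b = 0" using 0 b that by (simp add: g_simps good_def)
    moreover have "b \<noteq> 0" using that b by (auto simp: good_def)
    ultimately show "f b = 0" using pos[of b] by auto
  qed
  have extend: "\<exists>E'. good E' \<and> card E < card E'" if E: "good E" and not_all: "span E \<noteq> UNIV" for E
  proof -
    from not_all obtain w where w: "w \<notin> span E" by blast
    define u where "u = w - (\<Sum>b\<in>E. (g w b / g b b) *\<^sub>R b)"
    have "u \<noteq> 0"
    proof
      assume "u = 0"
      then have "w = (\<Sum>b\<in>E. (g w b / g b b) *\<^sub>R b)" by (simp add: u_def)
      moreover have "(\<Sum>b\<in>E. (g w b / g b b) *\<^sub>R b) \<in> span E"
        by (intro span_sum span_scale span_base)
      ultimately show False using w by simp
    qed
    have orth: "g u c = 0" if c: "c \<in> E" for c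
    proof -
      have "g (\<Sum>b\<in>E. (g w b / g b b) *\<^sub>R b) c = (\<Sum>b\<in>E. if b = c then g w c else 0)"
        unfolding g_sum
      proof (intro sum.cong refl)
        fix b assume "b \<in> E"
        then have "b \<noteq> 0" using E by (auto simp: good_def)
        then show "g ((g w b / g b b) *\<^sub>R b) c = (if b = c then g w c else 0)"
          using E c \<open>b \<in> E\<close> pos[of b] by (auto simp: g_simps good_def)
      qed
      then show ?thesis using c E by (simp add: u_def g_simps good_def)
    qed
    have orth_J: "g (J u) c = 0" if c: "c \<in> E" for c
    proof -
      have "J c \<in> E \<or> - J c \<in> E" using E c by (simp add: good_def)
      then show ?thesis using orth[of "J c"] orth[of "- J c"] by (auto simp: g_J g_simps)
    qed
    have J0: "J u \<noteq> 0" using sq[of u] \<open>u \<noteq> 0\<close> linear_0[OF lin] by auto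
    have new: "u \<notin> E" "J u \<notin> E" "J u \<noteq> u"
      using orth[of u] orth_J[of "J u"] g_J_self[of u] pos[OF \<open>u \<noteq> 0\<close>] pos[OF J0] by auto
    have "good (insert u (insert (J u) E))"
      unfolding good_def
      using E \<open>u \<noteq> 0\<close> J0 orth orth_J g_J_self[of u] sym sq[of u]
      by (auto simp: good_def)
    moreover have "card E < card (insert u (insert (J u) E))"
      using new E by (simp add: good_def)
    ultimately show ?thesis by blast
  qed
  have bound: "card E \<le> DIM('m)" if "good E" for E
    using independent_bound[OF indep[OF that]] by simp
  have ex: "good {}" by (simp add: good_def)
  obtain E where E: "good E" and max: "\<And>E'. good E' \<Longrightarrow> card E' \<le> card E"
    using ex_has_greatest_nat[of good "{}" card "Suc DIM('m)"] ex bound by (metis less_Suc_eq_le)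
  have span: "span E = UNIV" using extend[OF E] max by (metis not_less)
  have card: "card E = DIM('m)"
    using indep[OF E] span dim_eq_card[of E UNIV] by simp
  define \<tau> where "\<tau> b = (if J b \<in> E then J b else - J b)" for b
  have \<tau>_E: "\<tau> b \<in> E" if "b \<in> E" for b using E that by (auto simp: \<tau>_def good_def)
  have \<tau>_unique: "c = \<tau> b" if "b \<in> E" "c \<in> E" "g (J b) c \<noteq> 0" for b c
  proof (rule ccontr)
    assume "c \<noteq> \<tau> b"
    then have "g (\<tau> b) c = 0" using E that \<tau>_E[OF that(1)] by (auto simp: good_def)
    with that(3) show False by (auto simp: \<tau>_def g_simps split: if_splits)
  qed
  have J_nz: "g (J b) (J b) \<noteq> 0" if "b \<in> E" for b
  proof -
    have "b \<noteq> 0" using E that by (auto simp: good_def)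
    then show ?thesis using pos[of b] by (simp add: inv)
  qed
  show ?thesis
  proof (rule that[of E \<tau>])
    show "\<tau> b \<in> E \<and> \<tau> b \<noteq> b \<and> \<tau> (\<tau> b) = b" if b: "b \<in> E" for b
    proof (intro conjI)
      show "\<tau> b \<in> E" by (rule \<tau>_E[OF b])
      show "\<tau> b \<noteq> b"
      proof
        assume "\<tau> b = b"
        then have "J b = b \<or> J b = - b" by (metis \<tau>_def minus_minus)
        then have "g (J b) b = g b b \<or> g (J b) b = - g b b" by (auto simp: g_simps)
        then show False using J_nz[OF b] by (simp add: g_J_self inv)
      qed
      have "g (J (\<tau> b)) b \<noteq> 0"
        using J_nz[OF b] by (auto simp: \<tau>_def sq g_simps inv linear_neg[OF lin])
      from \<tau>_unique[OF \<tau>_E[OF b] b this] show "\<tau> (\<tau> b) = b" by simp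
    qed
  qed (use E card span \<tau>_unique in \<open>auto simp: good_def \<tau>_def\<close>)
qed


section \<open>The sphere of complex structures\<close>

text \<open>Stereographic projection. The coefficients of \<open>I\<close>, \<open>J\<close>, \<open>K\<close> are the functions
  \<open>sphere_I\<close>, \<open>sphere_J\<close>, \<open>sphere_K\<close> of the affine coordinate \<open>\<zeta>\<close>; in the coordinate \<open>1 / \<zeta>\<close>
  the first and the third one change their sign.\<close>

definition sphere_weight :: "complex \<Rightarrow> real" where
  "sphere_weight z = inverse (1 + (Re z)\<^sup>2 + (Im z)\<^sup>2)"

definition sphere_I :: "complex \<Rightarrow> real" where
  "sphere_I z = 2 * sphere_weight z - 1"

definition sphere_J :: "complex \<Rightarrow> real" where
  "sphere_J z = 2 * Re z * sphere_weight z"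

definition sphere_K :: "complex \<Rightarrow> real" where
  "sphere_K z = 2 * Im z * sphere_weight z"

definition chart_sign :: "bool \<Rightarrow> real" where
  "chart_sign b = (if b then 1 else - 1)"

lemma chart_sign_sq: "chart_sign b * chart_sign b = 1"
  by (simp add: chart_sign_def)

lemma weight_denominator_pos: "1 + (Re z)\<^sup>2 + (Im z)\<^sup>2 > 0"
  by (intro add_pos_nonneg) auto

lemma sphere_weight: "sphere_weight z * (1 + (Re z)\<^sup>2 + (Im z)\<^sup>2) = 1"
  using weight_denominator_pos[of z] by (simp add: sphere_weight_def)

lemma sphere_divide:
  assumes "w \<noteq> 0"
  shows "sphere_I (z / w) = ((cmod w)\<^sup>2 - (cmod z)\<^sup>2) / ((cmod z)\<^sup>2 + (cmod w)\<^sup>2)"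
    "sphere_J (z / w) = 2 * (Re z * Re w + Im z * Im w) / ((cmod z)\<^sup>2 + (cmod w)\<^sup>2)"
    "sphere_K (z / w) = 2 * (Im z * Re w - Re z * Im w) / ((cmod z)\<^sup>2 + (cmod w)\<^sup>2)"
proof -
  define A B where "A = (cmod z)\<^sup>2" and "B = (cmod w)\<^sup>2"
  have B: "B > 0" and A: "A \<ge> 0" using assms by (simp_all add: A_def B_def)
  have "1 + (Re (z / w))\<^sup>2 + (Im (z / w))\<^sup>2 = 1 + A / B"
    by (simp add: cmod_power2[symmetric] norm_divide power_divide A_def B_def)
  also have "\<dots> = (A + B) / B" using B by (simp add: field_simps)
  finally have weight: "sphere_weight (z / w) = B / (A + B)"
    by (simp add: sphere_weight_def)
  show "sphere_I (z / w) = (B - A) / (A + B)"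
    using A B by (simp add: sphere_I_def weight field_simps)
  have "Re (z / w) = (Re z * Re w + Im z * Im w) / B" "Im (z / w) = (Im z * Re w - Re z * Im w) / B"
    by (simp_all add: Re_divide Im_divide B_def cmod_power2)
  then show "sphere_J (z / w) = 2 * (Re z * Re w + Im z * Im w) / (A + B)"
    "sphere_K (z / w) = 2 * (Im z * Re w - Re z * Im w) / (A + B)"
    using B by (simp_all add: sphere_J_def sphere_K_def weight)
qed

lemma twistor_coeff_chart:
  assumes "cp1_dom b L"
  shows "twistor_coeff_I L = chart_sign b * sphere_I (cp1_coord b L)"
    "twistor_coeff_J L = sphere_J (cp1_coord b L)"
    "twistor_coeff_K L = chart_sign b * sphere_K (cp1_coord b L)"
proof -
  have "cp1_dom b L \<longrightarrow> twistor_coeff_I L = chart_sign b * sphere_I (cp1_coord b L) \<and>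
    twistor_coeff_J L = sphere_J (cp1_coord b L) \<and>
    twistor_coeff_K L = chart_sign b * sphere_K (cp1_coord b L)"
  proof (transfer fixing: b, clarify)
    fix z1 z2 :: complex
    assume nz: "(if b then snd (z1, z2) else fst (z1, z2)) \<noteq> 0"
    let ?S = "(cmod z1)\<^sup>2 + (cmod z2)\<^sup>2"
    have J: "Re ((z1 * cnj z2 + cnj z1 * z2) / complex_of_real ?S)
        = 2 * (Re z1 * Re z2 + Im z1 * Im z2) / ?S"
      unfolding Re_divide_of_real by simp
    have K: "Re (\<i> * ((cnj z1 * z2 - z1 * cnj z2) / complex_of_real ?S))
        = 2 * (Im z1 * Re z2 - Re z1 * Im z2) / ?S"
      unfolding Re_i_times Im_divide_of_real by (simp add: minus_divide_left)
    show "((cmod z2)\<^sup>2 - (cmod z1)\<^sup>2) / ?S =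
        chart_sign b * sphere_I (if b then fst (z1, z2) / snd (z1, z2) else snd (z1, z2) / fst (z1, z2)) \<and>
      Re ((z1 * cnj z2 + cnj z1 * z2) / complex_of_real ?S) =
        sphere_J (if b then fst (z1, z2) / snd (z1, z2) else snd (z1, z2) / fst (z1, z2)) \<and>
      Re (\<i> * ((cnj z1 * z2 - z1 * cnj z2) / complex_of_real ?S)) =
        chart_sign b * sphere_K (if b then fst (z1, z2) / snd (z1, z2) else snd (z1, z2) / fst (z1, z2))"
      unfolding J K
      using nz sphere_divide[of z2 z1] sphere_divide[of z1 z2]
      by (cases b) (simp_all add: chart_sign_def add.commute mult.commute minus_divide_left)
  qed
  with assms show "twistor_coeff_I L = chart_sign b * sphere_I (cp1_coord b L)"
    "twistor_coeff_J L = sphere_J (cp1_coord b L)"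
    "twistor_coeff_K L = chart_sign b * sphere_K (cp1_coord b L)" by blast+
qed

lemma cp1_coord_inj:
  assumes "cp1_dom b L" "cp1_dom b L'" "cp1_coord b L = cp1_coord b L'"
  shows "L = L'"
proof -
  have "cp1_dom b L \<longrightarrow> cp1_dom b L' \<longrightarrow> cp1_coord b L = cp1_coord b L' \<longrightarrow> L = L'"
  proof (transfer fixing: b, intro impI)
    fix z w :: "complex \<times> complex"
    assume rel: "cp1_rel z z" "cp1_rel w w"
      and nz: "(if b then snd z else fst z) \<noteq> 0" "(if b then snd w else fst w) \<noteq> 0"
      and eq: "(if b then fst z / snd z else snd z / fst z) = (if b then fst w / snd w else snd w / fst w)"
    define c where "c = (if b then snd w / snd z else fst w / fst z)"
    have "c \<noteq> 0" "w = (c * fst z, c * snd z)"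
      using nz eq by (auto simp: c_def prod_eq_iff field_simps split: if_splits)
    then show "cp1_rel z w" using rel unfolding cp1_rel_def by blast
  qed
  with assms show ?thesis by blast
qed

lemma cp1_dom_cover: "\<exists>b. cp1_dom b L"
proof (transfer)
  fix z :: "complex \<times> complex" assume "cp1_rel z z"
  then have "fst z \<noteq> 0 \<or> snd z \<noteq> 0" by (auto simp: cp1_rel_def prod_eq_iff)
  then show "\<exists>b. (if b then snd z else fst z) \<noteq> 0" by (metis (full_types))
qed

lemma sphere_norm: "(sphere_I z)\<^sup>2 + (sphere_J z)\<^sup>2 + (sphere_K z)\<^sup>2 = 1"
proof -
  have "(sphere_I z)\<^sup>2 + (sphere_J z)\<^sup>2 + (sphere_K z)\<^sup>2
    = 1 + 4 * sphere_weight z * (sphere_weight z * (1 + (Re z)\<^sup>2 + (Im z)\<^sup>2) - 1)"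
    by (simp add: sphere_I_def sphere_J_def sphere_K_def power2_eq_square algebra_simps)
  then show ?thesis by (simp add: sphere_weight)
qed

lemma twistor_coeff_norm: "(twistor_coeff_I L)\<^sup>2 + (twistor_coeff_J L)\<^sup>2 + (twistor_coeff_K L)\<^sup>2 = 1"
proof -
  obtain b where "cp1_dom b L" using cp1_dom_cover by blast
  moreover have "(chart_sign b)\<^sup>2 = 1" by (simp add: chart_sign_def)
  ultimately show ?thesis
    using sphere_norm[of "cp1_coord b L"] by (simp add: twistor_coeff_chart power_mult_distrib)
qed

lemma twistor_coeff_inj:
  assumes "cp1_dom b L" "cp1_dom b L'" "twistor_coeff_I L = twistor_coeff_I L'"
    "twistor_coeff_J L = twistor_coeff_J L'" "twistor_coeff_K L = twistor_coeff_K L'"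
  shows "L = L'"
proof (rule cp1_coord_inj[OF assms(1,2)])
  let ?z = "cp1_coord b L" and ?z' = "cp1_coord b L'"
  have "chart_sign b \<noteq> 0" by (simp add: chart_sign_def)
  then have "sphere_I ?z = sphere_I ?z'" "sphere_J ?z = sphere_J ?z'" "sphere_K ?z = sphere_K ?z'"
    using assms by (simp_all add: twistor_coeff_chart)
  then have w: "sphere_weight ?z = sphere_weight ?z'"
    and eq: "Re ?z * sphere_weight ?z = Re ?z' * sphere_weight ?z'" "Im ?z * sphere_weight ?z = Im ?z' * sphere_weight ?z'"
    by (simp_all add: sphere_I_def sphere_J_def sphere_K_def)
  have "sphere_weight ?z' \<noteq> 0" using sphere_weight[of ?z'] by auto
  with w eq show "?z = ?z'" by (simp add: complex_eq_iff)
qed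

definition d_weight :: "complex \<Rightarrow> complex \<Rightarrow> real" where
  "d_weight z v = - 2 * (Re z * Re v + Im z * Im v) * (sphere_weight z * sphere_weight z)"

lemma sphere_weight_has_derivative: "(sphere_weight has_derivative d_weight z) (at z)"
proof -
  have "((\<lambda>z. 1 + (Re z)\<^sup>2 + (Im z)\<^sup>2) has_derivative (\<lambda>v. 2 * (Re z * Re v + Im z * Im v))) (at z)"
    by (auto intro!: derivative_eq_intros simp: algebra_simps)
  from Deriv.has_derivative_inverse[OF _ this] weight_denominator_pos[of z]
  have "((\<lambda>z. inverse (1 + (Re z)\<^sup>2 + (Im z)\<^sup>2)) has_derivative
      (\<lambda>v. - (sphere_weight z * (2 * (Re z * Re v + Im z * Im v)) * sphere_weight z))) (at z)"
    by (simp add: sphere_weight_def)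
  then show ?thesis
    unfolding sphere_weight_def[abs_def, symmetric]
    by (rule has_derivative_eq_rhs) (simp add: d_weight_def fun_eq_iff algebra_simps)
qed

definition d_sphere_I :: "complex \<Rightarrow> complex \<Rightarrow> real" where
  "d_sphere_I z v = 2 * d_weight z v"

definition d_sphere_J :: "complex \<Rightarrow> complex \<Rightarrow> real" where
  "d_sphere_J z v = 2 * (Re v * sphere_weight z + Re z * d_weight z v)"

definition d_sphere_K :: "complex \<Rightarrow> complex \<Rightarrow> real" where
  "d_sphere_K z v = 2 * (Im v * sphere_weight z + Im z * d_weight z v)"

lemma sphere_has_derivative:
  "(sphere_I has_derivative d_sphere_I z) (at z)"
  "(sphere_J has_derivative d_sphere_J z) (at z)"
  "(sphere_K has_derivative d_sphere_K z) (at z)"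
  unfolding sphere_I_def[abs_def] sphere_J_def[abs_def] sphere_K_def[abs_def]
    d_sphere_I_def[abs_def] d_sphere_J_def[abs_def] d_sphere_K_def[abs_def]
  by (auto intro!: derivative_eq_intros sphere_weight_has_derivative simp: algebra_simps)

text \<open>Stereographic projection is conformal: multiplication by the imaginary unit corresponds to the
  rotation by a right angle in the tangent planes of the sphere, which is the cross product with the
  position vector.\<close>

lemma sphere_conformal:
  "d_sphere_I z (\<i> * v) = sphere_J z * d_sphere_K z v - sphere_K z * d_sphere_J z v"
  "d_sphere_J z (\<i> * v) = sphere_K z * d_sphere_I z v - sphere_I z * d_sphere_K z v"
  "d_sphere_K z (\<i> * v) = sphere_I z * d_sphere_J z v - sphere_J z * d_sphere_I z v"
proof -
  define W x y p q where "W = sphere_weight z" and "x = Re z" and "y = Im z" and "p = Re v" and "q = Im v"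
  have W: "W * (1 + x * x + y * y) = 1"
    using sphere_weight[of z] by (simp add: W_def x_def y_def power2_eq_square)
  note defs = d_sphere_I_def d_sphere_J_def d_sphere_K_def sphere_I_def sphere_J_def sphere_K_def d_weight_def
  show "d_sphere_I z (\<i> * v) = sphere_J z * d_sphere_K z v - sphere_K z * d_sphere_J z v"
    unfolding defs by (simp add: algebra_simps)
  have "2 * (- q * W + x * (- 2 * (x * - q + y * p) * (W * W)))
      = 2 * y * W * (2 * (- 2 * (x * p + y * q) * (W * W)))
        - (2 * W - 1) * (2 * (q * W + y * (- 2 * (x * p + y * q) * (W * W))))"
    using W by algebra
  then show "d_sphere_J z (\<i> * v) = sphere_K z * d_sphere_I z v - sphere_I z * d_sphere_K z v"
    unfolding defs by (simp add: W_def x_def y_def p_def q_def)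
  have "2 * (p * W + y * (- 2 * (x * - q + y * p) * (W * W)))
      = (2 * W - 1) * (2 * (p * W + x * (- 2 * (x * p + y * q) * (W * W))))
        - 2 * x * W * (2 * (- 2 * (x * p + y * q) * (W * W)))"
    using W by algebra
  then show "d_sphere_K z (\<i> * v) = sphere_I z * d_sphere_J z v - sphere_J z * d_sphere_I z v"
    unfolding defs by (simp add: W_def x_def y_def p_def q_def)
qed

lemma sphere_smooth: "smooth_on UNIV sphere_I" "smooth_on UNIV sphere_J" "smooth_on UNIV sphere_K"
proof -
  have re: "smooth_on UNIV Re" and im: "smooth_on UNIV Im"
    by (auto intro!: smooth_on_linear bounded_linear_Re bounded_linear_Im)
  have "smooth_on UNIV (\<lambda>z. 1 + Re z * Re z + Im z * Im z)"
    by (intro smooth_on_add smooth_on_mult smooth_on_const re im) auto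
  then have "smooth_on UNIV (\<lambda>z. inverse (1 + Re z * Re z + Im z * Im z))"
    using weight_denominator_pos by (intro smooth_on_inverse) (auto simp: power2_eq_square less_le)
  then have w: "smooth_on UNIV sphere_weight"
    by (simp add: sphere_weight_def[abs_def] power2_eq_square)
  have "smooth_on UNIV (\<lambda>z. 2 * sphere_weight z + - 1)"
    by (intro smooth_on_add smooth_on_mult smooth_on_const w) auto
  then show "smooth_on UNIV sphere_I" by (simp add: sphere_I_def[abs_def])
  have "smooth_on UNIV (\<lambda>z. 2 * Re z * sphere_weight z)" "smooth_on UNIV (\<lambda>z. 2 * Im z * sphere_weight z)"
    by (intro smooth_on_mult smooth_on_const w re im; simp)+
  then show "smooth_on UNIV sphere_J" "smooth_on UNIV sphere_K"
    by (simp_all add: sphere_J_def[abs_def] sphere_K_def[abs_def])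
qed


section \<open>Products of manifolds\<close>

lemma second_countable_prod_topology:
  assumes "second_countable X" "second_countable Y"
  shows "second_countable (prod_topology X Y)"
proof -
  obtain B where B: "countable B" "\<forall>V\<in>B. openin X V"
      "\<forall>U x. openin X U \<and> x \<in> U \<longrightarrow> (\<exists>V\<in>B. x \<in> V \<and> V \<subseteq> U)"
    using assms(1) unfolding second_countable_def by (elim exE conjE)
  obtain C where C: "countable C" "\<forall>V\<in>C. openin Y V"
      "\<forall>U x. openin Y U \<and> x \<in> U \<longrightarrow> (\<exists>V\<in>C. x \<in> V \<and> V \<subseteq> U)"
    using assms(2) unfolding second_countable_def by (elim exE conjE)
  show ?thesis
    unfolding second_countable_def
  proof (intro exI[of _ "(\<lambda>(U, V). U \<times> V) ` (B \<times> C)"] conjI ballI allI impI)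
    show "countable ((\<lambda>(U, V). U \<times> V) ` (B \<times> C))" using B(1) C(1) by auto
    show "openin (prod_topology X Y) V" if "V \<in> (\<lambda>(U, V). U \<times> V) ` (B \<times> C)" for V
      using that B(2) C(2) by (auto simp: openin_prod_Times_iff)
    fix W p assume W: "openin (prod_topology X Y) W \<and> p \<in> W"
    obtain x y where p: "p = (x, y)" by (cases p)
    from W obtain U V where "openin X U" "openin Y V" "x \<in> U" "y \<in> V" "U \<times> V \<subseteq> W"
      unfolding p openin_prod_topology_alt by metis
    moreover from this B(3) C(3) obtain U' V'
      where "U' \<in> B" "x \<in> U'" "U' \<subseteq> U" "V' \<in> C" "y \<in> V'" "V' \<subseteq> V"
      by metis
    ultimately show "\<exists>V\<in>(\<lambda>(U, V). U \<times> V) ` (B \<times> C). p \<in> V \<and> V \<subseteq> W"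
      using p by (intro bexI[of _ "U' \<times> V'"]) auto
  qed
qed

context
  fixes A :: "('i, 'a, 'm::euclidean_space) manifold" and i :: 'i
  assumes A: "smooth_manifold A" and i: "i \<in> idx A"
begin

lemma chart_homeomorphic:
  "homeomorphic_map (subtopology (mtop A) (dom A i)) (top_of_set (coord A i ` dom A i)) (coord A i)"
  using A i by (simp add: smooth_manifold_def)

lemma chart_open: "open (coord A i ` dom A i)" and chart_openin: "openin (mtop A) (dom A i)"
  using A i by (simp_all add: smooth_manifold_def)

lemma chart_topspace: "topspace (subtopology (mtop A) (dom A i)) = dom A i"
  using openin_subset[OF chart_openin] by (auto simp: topspace_subtopology)

lemma chart_inj: "inj_on (coord A i) (dom A i)"
  using homeomorphic_imp_injective_map[OF chart_homeomorphic] by (simp only: chart_topspace)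

lemma inv_coord_coord: "p \<in> dom A i \<Longrightarrow> inv_coord A i (coord A i p) = p"
  unfolding inv_coord_def by (rule inv_into_f_f[OF chart_inj])

lemma inv_coord_in: "x \<in> coord A i ` dom A i \<Longrightarrow> inv_coord A i x \<in> dom A i"
  unfolding inv_coord_def by (rule inv_into_into)

lemma coord_inv_coord: "x \<in> coord A i ` dom A i \<Longrightarrow> coord A i (inv_coord A i x) = x"
  unfolding inv_coord_def by (rule f_inv_into_f)

lemma chart_image_open:
  assumes "openin (mtop A) U" "U \<subseteq> dom A i"
  shows "open (coord A i ` U)"
proof -
  have "openin (subtopology (mtop A) (dom A i)) U"
    using assms chart_openin by (simp add: openin_open_subtopology)
  then have "openin (top_of_set (coord A i ` dom A i)) (coord A i ` U)"
    using homeomorphic_imp_open_map[OF chart_homeomorphic] by (simp add: open_map_def)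
  then show ?thesis using chart_open openin_open_eq by blast
qed

lemma chart_preimage_openin:
  assumes "open V"
  shows "openin (mtop A) {p \<in> dom A i. coord A i p \<in> V}"
proof -
  have "openin (top_of_set (coord A i ` dom A i)) (coord A i ` dom A i \<inter> V)"
    by (rule openin_open_Int[OF assms])
  from openin_continuous_map_preimage[OF homeomorphic_imp_continuous_map[OF chart_homeomorphic] this]
  have "openin (subtopology (mtop A) (dom A i)) {p \<in> dom A i. coord A i p \<in> coord A i ` dom A i \<inter> V}"
    unfolding chart_topspace .
  from openin_trans_full[OF this chart_openin]
  have "openin (mtop A) {p \<in> dom A i. coord A i p \<in> coord A i ` dom A i \<inter> V}" .
  also have "{p \<in> dom A i. coord A i p \<in> coord A i ` dom A i \<inter> V} = {p \<in> dom A i. coord A i p \<in> V}"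
    by auto
  finally show ?thesis .
qed

lemma tchange_has_derivative:
  assumes j: "j \<in> idx A" and p: "p \<in> dom A i \<inter> dom A j"
  shows "((coord A j \<circ> inv_coord A i) has_derivative tchange A i j p) (at (coord A i p))"
proof -
  have "smooth_on (coord A i ` (dom A i \<inter> dom A j)) (coord A j \<circ> inv_coord A i)"
    using A i j unfolding smooth_manifold_def by blast
  from smooth_on_has_derivative[OF this, of "coord A i p"] p show ?thesis
    by (simp add: tchange_def mdiff_def)
qed

lemma tchange_linear:
  assumes "j \<in> idx A" "p \<in> dom A i \<inter> dom A j"
  shows "linear (tchange A i j p)"
  by (rule bounded_linear.linear[OF has_derivative_bounded_linear[OF tchange_has_derivative[OF assms]]])

end

lemma prod_manifold_simps:
  "mtop (prod_manifold A B) = prod_topology (mtop A) (mtop B)"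
  "idx (prod_manifold A B) = idx A \<times> idx B"
  "dom (prod_manifold A B) (i, j) = dom A i \<times> dom B j"
  "coord (prod_manifold A B) (i, j) (p, q) = (coord A i p, coord B j q)"
  "coord (prod_manifold A B) (i, j) = map_prod (coord A i) (coord B j)"
  by (auto simp: prod_manifold_def fun_eq_iff)

lemma prod_manifold_image:
  "coord (prod_manifold A B) (i, j) ` (U \<times> V) = coord A i ` U \<times> coord B j ` V"
  unfolding prod_manifold_simps by (simp add: map_prod_surj_on)

context
  fixes A :: "('i, 'a, 'm::euclidean_space) manifold" and B :: "('j, 'b, 'n::euclidean_space) manifold"
    and i :: 'i and j :: 'j
  assumes A: "smooth_manifold A" and B: "smooth_manifold B" and i: "i \<in> idx A" and j: "j \<in> idx B"
begin

lemma prod_inv_coord: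
  assumes "x \<in> coord A i ` dom A i" "y \<in> coord B j ` dom B j"
  shows "inv_coord (prod_manifold A B) (i, j) (x, y) = (inv_coord A i x, inv_coord B j y)"
proof -
  have inj: "inj_on (coord (prod_manifold A B) (i, j)) (dom A i \<times> dom B j)"
    unfolding prod_manifold_simps by (rule map_prod_inj_on[OF chart_inj[OF A i] chart_inj[OF B j]])
  have "inv_into (dom A i \<times> dom B j) (coord (prod_manifold A B) (i, j))
      (coord (prod_manifold A B) (i, j) (inv_coord A i x, inv_coord B j y)) = (inv_coord A i x, inv_coord B j y)"
    by (rule inv_into_f_f[OF inj]) (simp add: inv_coord_in[OF A i assms(1)] inv_coord_in[OF B j assms(2)])
  then show ?thesis
    unfolding prod_manifold_simps(4) coord_inv_coord[OF A i assms(1)] coord_inv_coord[OF B j assms(2)]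
    unfolding inv_coord_def prod_manifold_simps(3) .
qed

lemma prod_tchange:
  assumes i': "i' \<in> idx A" and j': "j' \<in> idx B" and m: "m \<in> dom A i \<inter> dom A i'" and q: "q \<in> dom B j \<inter> dom B j'"
  shows "tchange (prod_manifold A B) (i, j) (i', j') (m, q) w = (tchange A i i' m (fst w), tchange B j j' q (snd w))"
proof -
  let ?x = "(coord A i m, coord B j q)"
  have A': "((coord A i' \<circ> inv_coord A i) has_derivative tchange A i i' m) (at (fst ?x))"
    using tchange_has_derivative[OF A i i' m] by simp
  have B': "((coord B j' \<circ> inv_coord B j) has_derivative tchange B j j' q) (at (snd ?x))"
    using tchange_has_derivative[OF B j j' q] by simp
  have fst': "(fst has_derivative fst) (at ?x)" and snd': "(snd has_derivative snd) (at ?x)"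
    by (rule bounded_linear_imp_has_derivative, rule bounded_linear_fst bounded_linear_snd)+
  have "((\<lambda>z. ((coord A i' \<circ> inv_coord A i) (fst z), (coord B j' \<circ> inv_coord B j) (snd z)))
      has_derivative (\<lambda>w. (tchange A i i' m (fst w), tchange B j j' q (snd w)))) (at ?x)"
    by (intro has_derivative_Pair has_derivative_compose[OF fst' A'] has_derivative_compose[OF snd' B'])
  then have "((coord (prod_manifold A B) (i', j') \<circ> id \<circ> inv_coord (prod_manifold A B) (i, j))
      has_derivative (\<lambda>w. (tchange A i i' m (fst w), tchange B j j' q (snd w)))) (at ?x)"
  proof (rule has_derivative_transform_within_open)
    show "open (coord A i ` dom A i \<times> coord B j ` dom B j)"
      by (intro open_Times chart_open[OF A i] chart_open[OF B j])
    show "?x \<in> coord A i ` dom A i \<times> coord B j ` dom B j" using m q by auto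
    fix z assume "z \<in> coord A i ` dom A i \<times> coord B j ` dom B j"
    then show "((coord A i' \<circ> inv_coord A i) (fst z), (coord B j' \<circ> inv_coord B j) (snd z))
        = (coord (prod_manifold A B) (i', j') \<circ> id \<circ> inv_coord (prod_manifold A B) (i, j)) z"
      by (cases z) (simp add: prod_inv_coord prod_manifold_simps(4))
  qed
  from frechet_derivative_at[OF this] show ?thesis
    by (simp add: tchange_def[of "prod_manifold A B"] mdiff_def prod_manifold_simps(4) fun_eq_iff)
qed

end

lemma smooth_manifold_prod:
  fixes A :: "('i, 'a, 'm::euclidean_space) manifold" and B :: "('j, 'b, 'n::euclidean_space) manifold"
  assumes A: "smooth_manifold A" and B: "smooth_manifold B"
  shows "smooth_manifold (prod_manifold A B)"
  unfolding smooth_manifold_def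
proof (intro conjI ballI)
  let ?P = "prod_manifold A B"
  show "Hausdorff_space (mtop ?P)"
    using A B by (simp add: prod_manifold_simps Hausdorff_space_prod_topology smooth_manifold_def)
  show "second_countable (mtop ?P)"
    using A B by (simp add: prod_manifold_simps second_countable_prod_topology smooth_manifold_def)
  have "(\<Union>k\<in>idx ?P. dom ?P k) = (\<Union>i\<in>idx A. dom A i) \<times> (\<Union>j\<in>idx B. dom B j)"
    by (auto simp: prod_manifold_simps(2,3))
  then show "(\<Union>k\<in>idx ?P. dom ?P k) = topspace (mtop ?P)"
    using A B by (simp add: prod_manifold_simps smooth_manifold_def)
  fix k assume "k \<in> idx ?P"
  then obtain i j where k: "k = (i, j)" "i \<in> idx A" "j \<in> idx B" by (auto simp: prod_manifold_simps)
  show "openin (mtop ?P) (dom ?P k)"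
    using chart_openin[OF A k(2)] chart_openin[OF B k(3)]
    by (simp add: k prod_manifold_simps openin_prod_Times_iff)
  show "open (coord ?P k ` dom ?P k)"
    unfolding k(1) prod_manifold_simps(3) prod_manifold_image
    by (intro open_Times chart_open A B k)
  obtain f g where
    f: "homeomorphic_maps (subtopology (mtop A) (dom A i)) (top_of_set (coord A i ` dom A i)) (coord A i) f" and
    g: "homeomorphic_maps (subtopology (mtop B) (dom B j)) (top_of_set (coord B j ` dom B j)) (coord B j) g"
    using chart_homeomorphic[OF A k(2)] chart_homeomorphic[OF B k(3)] unfolding homeomorphic_map_maps by blast
  have "coord ?P (i, j) = (\<lambda>(x, y). (coord A i x, coord B j y))"
    by (simp add: prod_manifold_def)
  moreover have "homeomorphic_maps (subtopology (mtop ?P) (dom ?P (i, j)))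
      (top_of_set (coord ?P (i, j) ` dom ?P (i, j))) (\<lambda>(x, y). (coord A i x, coord B j y)) (\<lambda>(x, y). (f x, g y))"
    unfolding prod_manifold_simps(1,3) prod_manifold_image subtopology_Times
      prod_topology_subtopology_eu[symmetric] homeomorphic_maps_prod
    using f g by blast
  ultimately show "homeomorphic_map (subtopology (mtop ?P) (dom ?P k)) (top_of_set (coord ?P k ` dom ?P k)) (coord ?P k)"
    unfolding k(1) homeomorphic_map_maps by metis
  fix k' assume "k' \<in> idx ?P"
  then obtain i' j' where k': "k' = (i', j')" "i' \<in> idx A" "j' \<in> idx B" by (auto simp: prod_manifold_simps)
  let ?SA = "coord A i ` (dom A i \<inter> dom A i')" and ?SB = "coord B j ` (dom B j \<inter> dom B j')"
  have openA: "open ?SA"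
    by (intro chart_image_open[OF A k(2)] openin_Int chart_openin A k k') auto
  have openB: "open ?SB"
    by (intro chart_image_open[OF B k(3)] openin_Int chart_openin B k k') auto
  have "smooth_on ?SA (coord A i' \<circ> inv_coord A i)" "smooth_on ?SB (coord B j' \<circ> inv_coord B j)"
    using A B k k' unfolding smooth_manifold_def by blast+
  then have smooth: "smooth_on (?SA \<times> ?SB) (\<lambda>z. ((coord A i' \<circ> inv_coord A i) (fst z), (coord B j' \<circ> inv_coord B j) (snd z)))"
    by (intro smooth_on_Pair open_Times openA openB smooth_on_fst smooth_on_snd)
  have image: "coord ?P k ` (dom ?P k \<inter> dom ?P k') = ?SA \<times> ?SB"
    unfolding k k' prod_manifold_simps(3) Times_Int_Times prod_manifold_image ..
  have eq: "((coord A i' \<circ> inv_coord A i) (fst z), (coord B j' \<circ> inv_coord B j) (snd z))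
      = (coord ?P k' \<circ> inv_coord ?P k) z" if "z \<in> ?SA \<times> ?SB" for z
  proof -
    obtain x y where z: "z = (x, y)" by (cases z)
    have "x \<in> coord A i ` dom A i" "y \<in> coord B j ` dom B j" using that z by auto
    then show ?thesis
      unfolding z k k' by (simp add: prod_inv_coord[OF A B k(2,3)] prod_manifold_simps(4))
  qed
  show "smooth_on (coord ?P k ` (dom ?P k \<inter> dom ?P k')) (coord ?P k' \<circ> inv_coord ?P k)"
    unfolding image by (rule iffD1[OF smooth_on_cong[OF open_Times[OF openA openB] eq] smooth])
qed


section \<open>Two-forms\<close>

lemma alternating_form_2_bilinear:
  assumes "bilinear \<beta>" "\<And>u. \<beta> u u = 0"
  shows "alternating_form 2 (\<lambda>v. \<beta> (v 0) (v 1))"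
  unfolding alternating_form_def
proof (intro conjI allI impI)
  fix v w :: "nat \<Rightarrow> 'a" assume "\<forall>j<2. v j = w j"
  then show "\<beta> (v 0) (v 1) = \<beta> (w 0) (w 1)" by simp
next
  fix j :: nat and v :: "nat \<Rightarrow> 'a" assume "j < 2"
  then have "j = 0 \<or> j = 1" by auto
  then show "linear (\<lambda>x. \<beta> ((v(j := x)) 0) ((v(j := x)) 1))"
    using assms(1) by (elim disjE) (simp_all add: bilinear_def)
next
  fix v :: "nat \<Rightarrow> 'a" and i j :: nat assume "i < j \<and> j < 2 \<and> v i = v j"
  then have "i = 0" "j = 1" "v i = v j" by auto
  then show "\<beta> (v 0) (v 1) = 0" using assms(2) by simp
qed

context
  fixes a :: "(nat \<Rightarrow> 'x::real_vector) \<Rightarrow> real"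
  assumes a: "alternating_form 2 a"
begin

lemma alternating_form_2_vec2: "a v = a (vec2 (v 0) (v 1))"
proof -
  have "\<forall>j<2. v j = vec2 (v 0) (v 1) j" by (auto simp: vec2_def less_2_cases_iff)
  then show ?thesis using a unfolding alternating_form_def by blast
qed

lemma alternating_form_2_self: "a (vec2 u u) = 0"
proof -
  have "(0::nat) < 1 \<and> (1::nat) < 2 \<and> vec2 u u 0 = vec2 u u 1" by (simp add: vec2_def)
  then show ?thesis using a unfolding alternating_form_def by blast
qed

lemma alternating_form_2_imp_bilinear: "bilinear (\<lambda>u v. a (vec2 u v))"
proof -
  have slot: "linear (\<lambda>x. a (v(j := x)))" if "j < 2" for j v
    using a that unfolding alternating_form_def by blast
  have "a ((vec2 u v)(0 := x)) = a (vec2 x v)" "a ((vec2 u v)(1 := x)) = a (vec2 u x)" for u v x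
    by (subst alternating_form_2_vec2, simp add: vec2_def)+
  then have "linear (\<lambda>x. a (vec2 x v))" "linear (\<lambda>x. a (vec2 u x))" for u v
    using slot[of 0 "vec2 0 v"] slot[of 1 "vec2 u 0"] by simp_all
  then show ?thesis by (simp add: bilinear_def)
qed

lemma alternating_form_2_skew: "a (vec2 u v) = - a (vec2 v u)"
proof -
  note bil = alternating_form_2_imp_bilinear
  have "a (vec2 (u + v) (u + v)) = a (vec2 u u) + a (vec2 u v) + a (vec2 v u) + a (vec2 v v)"
    using bilinear_ladd[OF bil] bilinear_radd[OF bil] by simp
  then show ?thesis by (simp add: alternating_form_2_self)
qed

end

text \<open>For a two-form, skew symmetry turns the alternating sum of the exterior derivative into a cyclic
  sum.\<close>

lemma closed_form_2_cyclic:
  fixes A :: "('i, 'a, 'm::euclidean_space) manifold"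
  assumes A: "smooth_manifold A" and i: "i \<in> idx A" and p: "p \<in> dom A i"
    and alt: "\<And>p. p \<in> dom A i \<Longrightarrow> alternating_form 2 (\<alpha> i p)"
    and deriv: "\<And>u v. ((\<lambda>y. \<alpha> i (inv_coord A i y) (vec2 u v)) has_derivative (\<lambda>w. W w u v))
      (at (coord A i p))"
    and closed: "closed_form 2 A \<alpha>"
  shows "W u v z + W v z u + W z u v = 0"
proof -
  let ?x = "coord A i p" and ?U = "coord A i ` dom A i"
  define c where "c = (\<lambda>k::nat. if k = 0 then u else if k = 1 then v else z)"
  have S: "open ?U" "?x \<in> ?U" using chart_open[OF A i] p by auto
  have fd: "frechet_derivative (\<lambda>y. \<alpha> i (inv_coord A i y) d) (at ?x) = (\<lambda>w. W w (d 0) (d 1))" for d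
  proof (rule frechet_derivative_at[symmetric],
      rule has_derivative_transform_within_open[OF deriv[of "d 0" "d 1"] S])
    fix y assume "y \<in> ?U"
    from alternating_form_2_vec2[OF alt[OF inv_coord_in[OF A i this]], of d]
    show "\<alpha> i (inv_coord A i y) (vec2 (d 0) (d 1)) = \<alpha> i (inv_coord A i y) d" by simp
  qed
  have skew: "W w u v = - W w v u" for w u v
  proof -
    have "((\<lambda>y. - \<alpha> i (inv_coord A i y) (vec2 v u)) has_derivative (\<lambda>w. - W w v u)) (at ?x)"
      by (intro has_derivative_minus deriv)
    then have "((\<lambda>y. \<alpha> i (inv_coord A i y) (vec2 u v)) has_derivative (\<lambda>w. - W w v u)) (at ?x)"
    proof (rule has_derivative_transform_within_open[OF _ S])
      fix y assume "y \<in> ?U"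
      from alternating_form_2_skew[OF alt[OF inv_coord_in[OF A i this]], of u v]
      show "- \<alpha> i (inv_coord A i y) (vec2 v u) = \<alpha> i (inv_coord A i y) (vec2 u v)" by simp
    qed
    from has_derivative_unique[OF deriv this] show ?thesis by metis
  qed
  have "ext_deriv 2 A \<alpha> i p c = 0"
    using closed i p unfolding closed_form_def by blast
  then have "W u v z - W v u z + W z u v = 0"
    unfolding ext_deriv_def fd by (simp add: c_def numeral_2_eq_2)
  then show ?thesis using skew[of v u z] by simp
qed


section \<open>The twistor structure in product charts\<close>

lemma openin_cp1_dom: "openin (mtop cp1_manifold) {L. cp1_dom b L}"
proof -
  have dom: "cp1_dom b (abs_cp1 z) = ((if b then snd z else fst z) \<noteq> 0)" if "z \<noteq> 0" for z
  proof (rule cp1_dom.abs_eq)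
    show "cp1_rel z z" using that unfolding cp1_rel_def by (auto intro: exI[of _ 1])
  qed
  have "{z. z \<noteq> 0 \<and> abs_cp1 z \<in> {L. cp1_dom b L}} = {z. (if b then snd z else fst z) \<noteq> 0}"
  proof (rule set_eqI)
    fix z :: "complex \<times> complex"
    show "z \<in> {z. z \<noteq> 0 \<and> abs_cp1 z \<in> {L. cp1_dom b L}} \<longleftrightarrow> z \<in> {z. (if b then snd z else fst z) \<noteq> 0}"
      by (cases "z = 0") (simp_all add: dom)
  qed
  moreover have "open {z :: complex \<times> complex. (if b then snd z else fst z) \<noteq> 0}"
    by (cases b) (auto intro!: open_Collect_neq continuous_intros)
  ultimately have "open {z. z \<noteq> 0 \<and> abs_cp1 z \<in> {L. cp1_dom b L}}" by simp
  then show ?thesis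
    unfolding cp1_manifold_def by (simp add: topology_inverse'[OF istopology_cp1])
qed

lemma endomorphism_field_linear:
  "endomorphism_field A E \<Longrightarrow> i \<in> idx A \<Longrightarrow> p \<in> dom A i \<Longrightarrow> linear (E i p)"
  by (simp add: endomorphism_field_def)

lemma complex_manifold_sq:
  "complex_manifold n A E \<Longrightarrow> i \<in> idx A \<Longrightarrow> p \<in> dom A i \<Longrightarrow> E i p (E i p v) = - v"
  by (simp add: complex_manifold_def)

locale twistor_data =
  fixes M :: "('i, 'a, 'm::euclidean_space) manifold"
    and I J K :: "('i, 'a, 'm) endo_field"
    and g :: "('i, 'a, 'm) metric_field"
    and Q :: "('j, 'b, 'q::euclidean_space) manifold"
    and IQ :: "('j, 'b, 'q) endo_field"
    and \<omega>Q :: "('j, 'b, 'q) form_field"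
    and h :: "'b \<Rightarrow> cp1"
    and r n :: nat
    and t :: real
  assumes hk: "hyperkaehler r M I J K g"
    and kae: "kaehler n Q IQ \<omega>Q"
    and hol: "holomorphic_map Q IQ cp1_manifold cp1_structure h"
    and t: "t > 0"
begin

abbreviation "cI q \<equiv> twistor_coeff_I (h q)"
abbreviation "cJ q \<equiv> twistor_coeff_J (h q)"
abbreviation "cK q \<equiv> twistor_coeff_K (h q)"
abbreviation "XX \<equiv> prod_manifold M Q"
abbreviation "TT \<equiv> twistor_structure I J K IQ h"
abbreviation "\<xi> \<equiv> twistor_metric I J K g h \<omega>Q t"

lemma M: "smooth_manifold M" and Q: "smooth_manifold Q"
  and dim: "DIM('m) = 2 * r" "DIM('q) = 2 * n"
  using hk kae
  by (simp_all add: hyperkaehler_def hypercomplex_def complex_manifold_def kaehler_def)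

lemma endo: "endomorphism_field M I" "endomorphism_field M J" "endomorphism_field M K" "endomorphism_field Q IQ"
  using hk kae
  by (simp_all add: hyperkaehler_def hypercomplex_def complex_manifold_def kaehler_def)

lemma metric: "riemannian_metric M g"
  using hk by (simp add: hyperkaehler_def hypercomplex_def)

lemma quaternionic:
  assumes "i \<in> idx M" "m \<in> dom M i"
  shows "quaternionic_hermitian (I i m) (J i m) (K i m) (g i m)"
proof -
  note hc = hk[unfolded hyperkaehler_def hypercomplex_def, THEN conjunct1]
  have lin: "linear (I i m)" "linear (J i m)" "linear (K i m)"
    by (rule endomorphism_field_linear[OF _ assms], rule endo)+
  have sq: "I i m (I i m v) = - v" "J i m (J i m v) = - v" "K i m (K i m v) = - v" for v
    by (rule complex_manifold_sq[OF _ assms], use hc in blast)+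
  have mult: "I i m (J i m v) = K i m v" "J i m (K i m v) = I i m v" "K i m (I i m v) = J i m v" for v
    using hc assms by blast+
  have inv: "g i m (I i m u) (I i m v) = g i m u v" "g i m (J i m u) (J i m v) = g i m u v"
    "g i m (K i m u) (K i m v) = g i m u v" for u v
    using hc assms by blast+
  have g: "bilinear (g i m)" "g i m u v = g i m v u" "u \<noteq> 0 \<Longrightarrow> g i m u u > 0" for u v
    using metric assms unfolding riemannian_metric_def by blast+
  show ?thesis
    by (rule quaternionic_hermitian.intro; fact)
qed

lemma IQ_sq: "j \<in> idx Q \<Longrightarrow> q \<in> dom Q j \<Longrightarrow> IQ j q (IQ j q v) = - v"
  using kae by (simp add: kaehler_def complex_manifold_def)

lemma IQ_linear: "j \<in> idx Q \<Longrightarrow> q \<in> dom Q j \<Longrightarrow> linear (IQ j q)"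
  using endo(4) by (simp add: endomorphism_field_def)

lemma IQ_smooth: "j \<in> idx Q \<Longrightarrow> smooth_on (coord Q j ` dom Q j) (\<lambda>y. IQ j (inv_coord Q j y) v)"
  using endo(4) by (simp add: endomorphism_field_def)

lemma IJK_smooth:
  assumes "i \<in> idx M"
  shows "smooth_on (coord M i ` dom M i) (\<lambda>x. I i (inv_coord M i x) v)"
    "smooth_on (coord M i ` dom M i) (\<lambda>x. J i (inv_coord M i x) v)"
    "smooth_on (coord M i ` dom M i) (\<lambda>x. K i (inv_coord M i x) v)"
  using endo assms by (simp_all add: endomorphism_field_def)

lemma g_linear: "i \<in> idx M \<Longrightarrow> m \<in> dom M i \<Longrightarrow> linear (\<lambda>u. g i m u v)"
  using metric by (simp add: riemannian_metric_def bilinear_def)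

lemma g_smooth: "i \<in> idx M \<Longrightarrow> smooth_on (coord M i ` dom M i) (\<lambda>x. g i (inv_coord M i x) u v)"
  using metric by (simp add: riemannian_metric_def)

lemma fundamental_smooth:
  assumes i: "i \<in> idx M"
  shows "smooth_on (coord M i ` dom M i) (\<lambda>x. g i (inv_coord M i x) (I i (inv_coord M i x) u) v)"
    "smooth_on (coord M i ` dom M i) (\<lambda>x. g i (inv_coord M i x) (J i (inv_coord M i x) u) v)"
    "smooth_on (coord M i ` dom M i) (\<lambda>x. g i (inv_coord M i x) (K i (inv_coord M i x) u) v)"
  by (rule smooth_on_linear_apply[OF chart_open[OF M i] g_linear[OF i inv_coord_in[OF M i]]
        g_smooth[OF i] IJK_smooth(1)[OF i]],
      assumption,
      rule smooth_on_linear_apply[OF chart_open[OF M i] g_linear[OF i inv_coord_in[OF M i]]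
        g_smooth[OF i] IJK_smooth(2)[OF i]],
      assumption,
      rule smooth_on_linear_apply[OF chart_open[OF M i] g_linear[OF i inv_coord_in[OF M i]]
        g_smooth[OF i] IJK_smooth(3)[OF i]])

lemma \<omega>Q_alternating: "j \<in> idx Q \<Longrightarrow> q \<in> dom Q j \<Longrightarrow> alternating_form 2 (\<omega>Q j q)"
  using kae by (simp add: kaehler_def positive_11_form_def diff_form_def)

lemma \<omega>Q_smooth: "j \<in> idx Q \<Longrightarrow> smooth_on (coord Q j ` dom Q j) (\<lambda>y. \<omega>Q j (inv_coord Q j y) v)"
  using kae by (simp add: kaehler_def positive_11_form_def diff_form_def)

lemma coeff_norm: "(cI q)\<^sup>2 + (cJ q)\<^sup>2 + (cK q)\<^sup>2 = 1"
  by (rule twistor_coeff_norm)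

text \<open>Near a point of \<open>Q\<close> the coefficients are the functions \<open>sphere_I\<close>, \<open>sphere_J\<close>, \<open>sphere_K\<close>, up
  to sign, of the holomorphic coordinate expression \<open>\<zeta>\<close> of \<open>h\<close>.\<close>

lemma coeff_local:
  assumes j: "j \<in> idx Q" and q: "q \<in> dom Q j"
  obtains b S \<zeta> where "open S" "coord Q j q \<in> S" "S \<subseteq> coord Q j ` dom Q j" "smooth_on S \<zeta>"
    "\<And>y. y \<in> S \<Longrightarrow> cI (inv_coord Q j y) = chart_sign b * sphere_I (\<zeta> y)"
    "\<And>y. y \<in> S \<Longrightarrow> cJ (inv_coord Q j y) = sphere_J (\<zeta> y)"
    "\<And>y. y \<in> S \<Longrightarrow> cK (inv_coord Q j y) = chart_sign b * sphere_K (\<zeta> y)"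
    "\<And>y. y \<in> S \<Longrightarrow> cp1_dom b (h (inv_coord Q j y))"
    "\<And>w. frechet_derivative \<zeta> (at (coord Q j q)) (IQ j q w) = \<i> * frechet_derivative \<zeta> (at (coord Q j q)) w"
proof -
  obtain b where b: "cp1_dom b (h q)" using cp1_dom_cover by blast
  define V where "V = {p \<in> dom Q j. h p \<in> {L. cp1_dom b L}}"
  define \<zeta> where "\<zeta> = cp1_coord b \<circ> h \<circ> inv_coord Q j"
  have cp1: "idx cp1_manifold = UNIV" "dom cp1_manifold b = {L. cp1_dom b L}" "coord cp1_manifold b = cp1_coord b"
    by (simp_all add: cp1_manifold_def)
  have cont: "continuous_map (mtop Q) (mtop cp1_manifold) h"
    and smooth: "smooth_on (coord Q j ` V) \<zeta>"
    using hol j unfolding holomorphic_map_def smooth_map_def V_def \<zeta>_def cp1(2)[symmetric] cp1(3)[symmetric]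
    by (simp_all add: cp1(1))
  have "openin (mtop Q) {p \<in> topspace (mtop Q). h p \<in> {L. cp1_dom b L}}"
    by (rule openin_continuous_map_preimage[OF cont openin_cp1_dom])
  moreover have "V = dom Q j \<inter> {p \<in> topspace (mtop Q). h p \<in> {L. cp1_dom b L}}"
    using openin_subset[OF chart_openin[OF Q j]] by (auto simp: V_def)
  ultimately have "openin (mtop Q) V"
    using chart_openin[OF Q j] by (simp only: openin_Int)
  then have "open (coord Q j ` V)" by (rule chart_image_open[OF Q j]) (auto simp: V_def)
  moreover have V: "inv_coord Q j y \<in> V" if "y \<in> coord Q j ` V" for y
    using that inv_coord_coord[OF Q j] by (auto simp: V_def)
  then have dom: "cp1_dom b (h (inv_coord Q j y))" if "y \<in> coord Q j ` V" for y
    using that by (auto simp: V_def)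
  moreover have "frechet_derivative \<zeta> (at (coord Q j q)) (IQ j q w) = \<i> * frechet_derivative \<zeta> (at (coord Q j q)) w" for w
  proof -
    have "h q \<in> dom cp1_manifold b" using b by (simp add: cp1)
    then have "mdiff Q cp1_manifold h j b q (IQ j q w) = cp1_structure b (h q) (mdiff Q cp1_manifold h j b q w)"
      using hol j q unfolding holomorphic_map_def by (simp add: cp1(1))
    then show ?thesis by (simp add: mdiff_def cp1 \<zeta>_def cp1_structure_def)
  qed
  ultimately show ?thesis
    using smooth b q
    by (intro that[of "coord Q j ` V" \<zeta> b]) (auto simp: V_def \<zeta>_def twistor_coeff_chart)
qed

lemma coeff_smooth:
  assumes j: "j \<in> idx Q"
  shows "smooth_on (coord Q j ` dom Q j) (\<lambda>y. cI (inv_coord Q j y))"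
    "smooth_on (coord Q j ` dom Q j) (\<lambda>y. cJ (inv_coord Q j y))"
    "smooth_on (coord Q j ` dom Q j) (\<lambda>y. cK (inv_coord Q j y))"
proof -
  have "\<exists>S. open S \<and> y \<in> S \<and> smooth_on S (\<lambda>y. cI (inv_coord Q j y)) \<and>
    smooth_on S (\<lambda>y. cJ (inv_coord Q j y)) \<and> smooth_on S (\<lambda>y. cK (inv_coord Q j y))"
    if "y \<in> coord Q j ` dom Q j" for y
  proof -
    from that obtain q where q: "q \<in> dom Q j" "y = coord Q j q" by blast
    obtain b S \<zeta> where S: "open S" "coord Q j q \<in> S" "smooth_on S \<zeta>"
      and c: "\<And>y. y \<in> S \<Longrightarrow> cI (inv_coord Q j y) = chart_sign b * sphere_I (\<zeta> y)"
        "\<And>y. y \<in> S \<Longrightarrow> cJ (inv_coord Q j y) = sphere_J (\<zeta> y)"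
        "\<And>y. y \<in> S \<Longrightarrow> cK (inv_coord Q j y) = chart_sign b * sphere_K (\<zeta> y)"
      by (rule coeff_local[OF j q(1)]) blast
    have s: "smooth_on S (\<lambda>y. f (\<zeta> y))" if "smooth_on UNIV f" for f :: "complex \<Rightarrow> real"
      by (rule smooth_on_compose[OF S(1) open_UNIV _ S(3) that]) simp
    note const = smooth_on_const[OF S(1)]
    have "smooth_on S (\<lambda>y. cI (inv_coord Q j y))"
      by (rule iffD2[OF smooth_on_cong[OF S(1) c(1)] smooth_on_mult[OF S(1) const s[OF sphere_smooth(1)]]])
    moreover have "smooth_on S (\<lambda>y. cJ (inv_coord Q j y))"
      by (rule iffD2[OF smooth_on_cong[OF S(1) c(2)] s[OF sphere_smooth(2)]])
    moreover have "smooth_on S (\<lambda>y. cK (inv_coord Q j y))"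
      by (rule iffD2[OF smooth_on_cong[OF S(1) c(3)] smooth_on_mult[OF S(1) const s[OF sphere_smooth(3)]]])
    ultimately show ?thesis using S q by metis
  qed
  note loc = this
  show "smooth_on (coord Q j ` dom Q j) (\<lambda>y. cI (inv_coord Q j y))"
    by (rule smooth_on_local, drule loc, elim exE conjE, intro exI conjI)
  show "smooth_on (coord Q j ` dom Q j) (\<lambda>y. cJ (inv_coord Q j y))"
    by (rule smooth_on_local, drule loc, elim exE conjE, intro exI conjI)
  show "smooth_on (coord Q j ` dom Q j) (\<lambda>y. cK (inv_coord Q j y))"
    by (rule smooth_on_local, drule loc, elim exE conjE, intro exI conjI)
qed

end


context twistor_data
begin

lemma twistor_structure_apply:
  "TT (i, j) (m, q) u =
    (quat_comb (I i m) (J i m) (K i m) (cI q) (cJ q) (cK q) (fst u), IQ j q (snd u))"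
  by (cases u) (simp add: twistor_structure_def twistor_I_M_def quat_comb_def)

lemma twistor_metric_apply:
  "\<xi> (i, j) (m, q) d =
    g i m (quat_comb (I i m) (J i m) (K i m) (cI q) (cJ q) (cK q) (fst (d 0))) (fst (d 1))
    + t * \<omega>Q j q (\<lambda>l. snd (d l))"
  by (simp add: twistor_metric_def twistor_form_M_def pullback_snd_def twistor_I_M_def quat_comb_def)

lemma twistor_metric_vec2:
  "\<xi> (i, j) (m, q) (vec2 u v) =
    g i m (quat_comb (I i m) (J i m) (K i m) (cI q) (cJ q) (cK q) (fst u)) (fst v)
    + t * \<omega>Q j q (vec2 (snd u) (snd v))"
proof -
  have "(\<lambda>l. snd (vec2 u v l)) = vec2 (snd u) (snd v)" by (auto simp: vec2_def)
  then show ?thesis by (simp add: twistor_metric_apply) (simp add: vec2_def)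
qed

end

locale twistor_point = twistor_data M I J K g Q IQ \<omega>Q h r n t
  for M :: "('i, 'a, 'm::euclidean_space) manifold"
    and I J K :: "('i, 'a, 'm) endo_field"
    and g :: "('i, 'a, 'm) metric_field"
    and Q :: "('j, 'b, 'q::euclidean_space) manifold"
    and IQ :: "('j, 'b, 'q) endo_field"
    and \<omega>Q :: "('j, 'b, 'q) form_field"
    and h :: "'b \<Rightarrow> cp1"
    and r n :: nat
    and t :: real +
  fixes i :: 'i and j :: 'j and m :: 'a and q :: 'b
  assumes i: "i \<in> idx M" and j: "j \<in> idx Q" and m: "m \<in> dom M i" and q: "q \<in> dom Q j"
begin

sublocale quaternionic_hermitian "I i m" "J i m" "K i m" "g i m"
  by (rule quaternionic[OF i m])

abbreviation "UM \<equiv> coord M i ` dom M i"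
abbreviation "UQ \<equiv> coord Q j ` dom Q j"
abbreviation "xM \<equiv> coord M i m"
abbreviation "xQ \<equiv> coord Q j q"

abbreviation "I' w u \<equiv> frechet_derivative (\<lambda>x. I i (inv_coord M i x) u) (at xM) w"
abbreviation "J' w u \<equiv> frechet_derivative (\<lambda>x. J i (inv_coord M i x) u) (at xM) w"
abbreviation "K' w u \<equiv> frechet_derivative (\<lambda>x. K i (inv_coord M i x) u) (at xM) w"
abbreviation "WI w u v \<equiv>
  frechet_derivative (\<lambda>x. g i (inv_coord M i x) (I i (inv_coord M i x) u) v) (at xM) w"
abbreviation "WJ w u v \<equiv>
  frechet_derivative (\<lambda>x. g i (inv_coord M i x) (J i (inv_coord M i x) u) v) (at xM) w"
abbreviation "WK w u v \<equiv>
  frechet_derivative (\<lambda>x. g i (inv_coord M i x) (K i (inv_coord M i x) u) v) (at xM) w"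
abbreviation "dI \<equiv> frechet_derivative (\<lambda>y. cI (inv_coord Q j y)) (at xQ)"
abbreviation "dJ \<equiv> frechet_derivative (\<lambda>y. cJ (inv_coord Q j y)) (at xQ)"
abbreviation "dK \<equiv> frechet_derivative (\<lambda>y. cK (inv_coord Q j y)) (at xQ)"
abbreviation "IQ' w u \<equiv> frechet_derivative (\<lambda>y. IQ j (inv_coord Q j y) u) (at xQ) w"
abbreviation "WQ w u v \<equiv> frechet_derivative (\<lambda>y. \<omega>Q j (inv_coord Q j y) (vec2 u v)) (at xQ) w"

lemma UM: "open UM" "xM \<in> UM" "inv_coord M i xM = m"
  using chart_open[OF M i] m inv_coord_coord[OF M i] by auto

lemma UQ: "open UQ" "xQ \<in> UQ" "inv_coord Q j xQ = q"
  using chart_open[OF Q j] q inv_coord_coord[OF Q j] by auto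

lemmas IJK_deriv = smooth_on_has_derivative[OF IJK_smooth(1)[OF i] UM(2)]
  smooth_on_has_derivative[OF IJK_smooth(2)[OF i] UM(2)]
  smooth_on_has_derivative[OF IJK_smooth(3)[OF i] UM(2)]
lemmas W_deriv = smooth_on_has_derivative[OF fundamental_smooth(1)[OF i] UM(2)]
  smooth_on_has_derivative[OF fundamental_smooth(2)[OF i] UM(2)]
  smooth_on_has_derivative[OF fundamental_smooth(3)[OF i] UM(2)]
lemmas coeff_deriv = smooth_on_has_derivative[OF coeff_smooth(1)[OF j] UQ(2)]
  smooth_on_has_derivative[OF coeff_smooth(2)[OF j] UQ(2)]
  smooth_on_has_derivative[OF coeff_smooth(3)[OF j] UQ(2)]
lemmas IQ_deriv = smooth_on_has_derivative[OF IQ_smooth[OF j] UQ(2)]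
lemmas WQ_deriv = smooth_on_has_derivative[OF \<omega>Q_smooth[OF j] UQ(2)]

lemma coeff_deriv_linear: "linear dI" "linear dJ" "linear dK"
  using coeff_deriv by (blast intro: bounded_linear.linear has_derivative_bounded_linear)+

lemma coeff_deriv_orthogonal: "cI q * dI w + cJ q * dJ w + cK q * dK w = 0"
proof -
  have "((\<lambda>y. (cI (inv_coord Q j y))\<^sup>2 + (cJ (inv_coord Q j y))\<^sup>2 + (cK (inv_coord Q j y))\<^sup>2)
      has_derivative (\<lambda>w. 2 * (cI q * dI w + cJ q * dJ w + cK q * dK w))) (at xQ)"
    unfolding power2_eq_square
    by (rule has_derivative_eq_rhs[OF has_derivative_add[OF has_derivative_add[OF
          has_derivative_mult[OF coeff_deriv(1) coeff_deriv(1)]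
          has_derivative_mult[OF coeff_deriv(2) coeff_deriv(2)]]
          has_derivative_mult[OF coeff_deriv(3) coeff_deriv(3)]]])
       (simp add: UQ(3) fun_eq_iff algebra_simps)
  then have "((\<lambda>y. 1) has_derivative (\<lambda>w. 2 * (cI q * dI w + cJ q * dJ w + cK q * dK w))) (at xQ)"
    by (simp only: coeff_norm)
  from fun_cong[OF has_derivative_unique[OF this has_derivative_const], of w]
  show ?thesis by (metis mult_eq_0_iff zero_neq_numeral)
qed

text \<open>Since \<open>\<zeta>\<close> is holomorphic, this is the conformality of stereographic projection. The change of
  signs in the second chart is a rotation of the sphere by a half turn, hence compatible with cross
  products.\<close>

lemma coeff_deriv_conformal:
  "dI (IQ j q w) = cJ q * dK w - cK q * dJ w"
  "dJ (IQ j q w) = cK q * dI w - cI q * dK w"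
  "dK (IQ j q w) = cI q * dJ w - cJ q * dI w"
proof -
  obtain b S \<zeta> where S: "open S" "xQ \<in> S" "smooth_on S \<zeta>"
    and c: "\<And>y. y \<in> S \<Longrightarrow> cI (inv_coord Q j y) = chart_sign b * sphere_I (\<zeta> y)"
      "\<And>y. y \<in> S \<Longrightarrow> cJ (inv_coord Q j y) = sphere_J (\<zeta> y)"
      "\<And>y. y \<in> S \<Longrightarrow> cK (inv_coord Q j y) = chart_sign b * sphere_K (\<zeta> y)"
    and hol: "\<And>w. frechet_derivative \<zeta> (at xQ) (IQ j q w) = \<i> * frechet_derivative \<zeta> (at xQ) w"
    by (rule coeff_local[OF j q]) blast
  let ?d = "frechet_derivative \<zeta> (at xQ)"
  let ?z = "\<zeta> xQ"
  have \<zeta>: "(\<zeta> has_derivative ?d) (at xQ)" by (rule smooth_on_has_derivative[OF S(3,2)])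
  note chain = sphere_has_derivative[of ?z, THEN has_derivative_compose[OF \<zeta>]]
  have dI: "dI = (\<lambda>w. chart_sign b * d_sphere_I ?z (?d w))"
    by (rule frechet_derivative_at[symmetric],
        rule has_derivative_transform_within_open[OF has_derivative_mult_right[OF chain(1)] S(1,2)])
       (simp add: c)
  have dJ: "dJ = (\<lambda>w. d_sphere_J ?z (?d w))"
    by (rule frechet_derivative_at[symmetric],
        rule has_derivative_transform_within_open[OF chain(2) S(1,2)])
       (simp add: c)
  have dK: "dK = (\<lambda>w. chart_sign b * d_sphere_K ?z (?d w))"
    by (rule frechet_derivative_at[symmetric],
        rule has_derivative_transform_within_open[OF has_derivative_mult_right[OF chain(3)] S(1,2)])
       (simp add: c)
  note conf = sphere_conformal[of ?z "?d w"]
  have coeff: "cI q = chart_sign b * sphere_I ?z" "cJ q = sphere_J ?z" "cK q = chart_sign b * sphere_K ?z"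
    using c[OF S(2)] by (simp_all add: UQ(3))
  have sgn: "chart_sign b * x * (chart_sign b * y) = x * y" for x y
    using chart_sign_sq[of b] by (metis mult.assoc mult.commute mult.left_commute mult_1)
  show "dI (IQ j q w) = cJ q * dK w - cK q * dJ w"
    unfolding dI dJ dK hol coeff conf by (simp only: right_diff_distrib mult.left_commute mult.assoc)
  show "dJ (IQ j q w) = cK q * dI w - cI q * dK w"
    unfolding dI dJ dK hol coeff conf sgn ..
  show "dK (IQ j q w) = cI q * dJ w - cJ q * dI w"
    unfolding dI dJ dK hol coeff conf by (simp only: right_diff_distrib mult.left_commute mult.assoc)
qed

lemma fundamental_form_alternating:
  assumes "m' \<in> dom M i"
  shows "alternating_form 2 (fundamental_form g I i m')"
    "alternating_form 2 (fundamental_form g J i m')"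
    "alternating_form 2 (fundamental_form g K i m')"
proof -
  interpret q': quaternionic_hermitian "I i m'" "J i m'" "K i m'" "g i m'" by (rule quaternionic[OF i assms])
  have alt: "alternating_form 2 (\<lambda>v. g i m' (quat_comb (I i m') (J i m') (K i m') a b c (v 0)) (v 1))" for a b c
  proof (rule alternating_form_2_bilinear[where \<beta> = "\<lambda>u v. g i m' (quat_comb (I i m') (J i m') (K i m') a b c u) v"])
    show "bilinear (\<lambda>u v. g i m' (quat_comb (I i m') (J i m') (K i m') a b c u) v)"
      unfolding bilinear_def
      by (auto intro!: linearI simp: q'.g_simps linear_add[OF q'.linear_comb] linear_cmul[OF q'.linear_comb])
  qed (rule q'.comb_self)
  from alt[of 1 0 0] alt[of 0 1 0] alt[of 0 0 1]
  show "alternating_form 2 (fundamental_form g I i m')"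
    "alternating_form 2 (fundamental_form g J i m')"
    "alternating_form 2 (fundamental_form g K i m')"
    by (simp_all add: quat_comb_def fundamental_form_def)
qed

lemma W_cyclic:
  "WI u v z + WI v z u + WI z u v = 0"
  "WJ u v z + WJ v z u + WJ z u v = 0"
  "WK u v z + WK v z u + WK z u v = 0"
proof -
  have closed: "closed_form 2 M (fundamental_form g I)" "closed_form 2 M (fundamental_form g J)"
    "closed_form 2 M (fundamental_form g K)"
    using hk by (simp_all add: hyperkaehler_def)
  have d: "fundamental_form g E i m' (vec2 u v) = g i m' (E i m' u) v" for E m' u v
    by (simp add: fundamental_form_def vec2_def)
  show "WI u v z + WI v z u + WI z u v = 0"
    by (rule closed_form_2_cyclic[where \<alpha> = "fundamental_form g I" and W = "\<lambda>w u v. WI w u v",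
          OF M i m fundamental_form_alternating(1) _ closed(1)])
       (simp_all only: d W_deriv)
  show "WJ u v z + WJ v z u + WJ z u v = 0"
    by (rule closed_form_2_cyclic[where \<alpha> = "fundamental_form g J" and W = "\<lambda>w u v. WJ w u v",
          OF M i m fundamental_form_alternating(2) _ closed(2)])
       (simp_all only: d W_deriv)
  show "WK u v z + WK v z u + WK z u v = 0"
    by (rule closed_form_2_cyclic[where \<alpha> = "fundamental_form g K" and W = "\<lambda>w u v. WK w u v",
          OF M i m fundamental_form_alternating(3) _ closed(3)])
       (simp_all only: d W_deriv)
qed

lemma WQ_cyclic: "WQ u v z + WQ v z u + WQ z u v = 0"
  by (rule closed_form_2_cyclic[where \<alpha> = \<omega>Q and W = "\<lambda>w u v. WQ w u v",
        OF Q j q \<omega>Q_alternating[OF j] WQ_deriv])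
     (use kae in \<open>simp_all add: kaehler_def\<close>)

abbreviation "LL \<equiv> quat_comb (I i m) (J i m) (K i m) (cI q) (cJ q) (cK q)"
abbreviation "LL' w \<equiv> quat_comb (I i m) (J i m) (K i m) (dI w) (dJ w) (dK w)"

text \<open>The product of two combinations of \<open>I\<close>, \<open>J\<close>, \<open>K\<close> is given by the cross product of their
  coefficients, if these are orthogonal.\<close>

lemma LL'_IQ: "LL' (IQ j q w) u = LL (LL' w u)"
  by (simp add: comb_comb coeff_deriv_orthogonal coeff_deriv_conformal)

lemma coord_XX: "coord XX (i, j) (m, q) = (xM, xQ)"
  by (simp add: prod_manifold_simps(4))

lemma chart_XX: "open (UM \<times> UQ)" "(xM, xQ) \<in> UM \<times> UQ"
  "\<And>z. z \<in> UM \<times> UQ \<Longrightarrow> inv_coord XX (i, j) z = (inv_coord M i (fst z), inv_coord Q j (snd z))"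
  using UM UQ prod_inv_coord[OF M Q i j] by (auto intro: open_Times)

lemma has_derivative_fst_compose:
  "(f has_derivative f') (at xM) \<Longrightarrow> ((\<lambda>z. f (fst z)) has_derivative (\<lambda>w. f' (fst w))) (at (xM, xQ))"
  by (rule has_derivative_compose[where f = fst and f' = fst])
     (simp_all add: bounded_linear_imp_has_derivative bounded_linear_fst)

lemma has_derivative_snd_compose:
  "(f has_derivative f') (at xQ) \<Longrightarrow> ((\<lambda>z. f (snd z)) has_derivative (\<lambda>w. f' (snd w))) (at (xM, xQ))"
  by (rule has_derivative_compose[where f = snd and f' = snd])
     (simp_all add: bounded_linear_imp_has_derivative bounded_linear_snd)

lemmas coeff_z = has_derivative_snd_compose[OF coeff_deriv(1)]
  has_derivative_snd_compose[OF coeff_deriv(2)] has_derivative_snd_compose[OF coeff_deriv(3)]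

lemma structure_deriv:
  "((\<lambda>z. TT (i, j) (inv_coord XX (i, j) z) u) has_derivative
    (\<lambda>w. (cI q *\<^sub>R I' (fst w) (fst u) + cJ q *\<^sub>R J' (fst w) (fst u) + cK q *\<^sub>R K' (fst w) (fst u)
        + LL' (snd w) (fst u), IQ' (snd w) (snd u)))) (at (xM, xQ))"
proof -
  have "((\<lambda>z. (cI (inv_coord Q j (snd z)) *\<^sub>R I i (inv_coord M i (fst z)) (fst u)
      + cJ (inv_coord Q j (snd z)) *\<^sub>R J i (inv_coord M i (fst z)) (fst u)
      + cK (inv_coord Q j (snd z)) *\<^sub>R K i (inv_coord M i (fst z)) (fst u), IQ j (inv_coord Q j (snd z)) (snd u)))
    has_derivative (\<lambda>w. (cI q *\<^sub>R I' (fst w) (fst u) + cJ q *\<^sub>R J' (fst w) (fst u) + cK q *\<^sub>R K' (fst w) (fst u)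
        + LL' (snd w) (fst u), IQ' (snd w) (snd u)))) (at (xM, xQ))"
    by (rule has_derivative_eq_rhs[OF has_derivative_Pair[OF has_derivative_add[OF has_derivative_add[OF
          has_derivative_scaleR[OF coeff_z(1) has_derivative_fst_compose[OF IJK_deriv(1)]]
          has_derivative_scaleR[OF coeff_z(2) has_derivative_fst_compose[OF IJK_deriv(2)]]]
          has_derivative_scaleR[OF coeff_z(3) has_derivative_fst_compose[OF IJK_deriv(3)]]]
          has_derivative_snd_compose[OF IQ_deriv]]])
       (simp add: fun_eq_iff quat_comb_def UM(3) UQ(3))
  then show ?thesis
    by (rule has_derivative_transform_within_open[OF _ chart_XX(1,2)])
       (simp add: chart_XX(3) twistor_structure_apply quat_comb_def)
qed

text \<open>The product rule separates the derivatives of the closed forms \<open>\<omega>\<^sub>I\<close>, \<open>\<omega>\<^sub>J\<close>, \<open>\<omega>\<^sub>K\<close>, \<open>\<omega>\<^sub>Q\<close> from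
  the form of \<open>LL' w\<close>, which comes from the derivatives of the coefficients.\<close>

definition metric' :: "'m \<times> 'q \<Rightarrow> 'm \<times> 'q \<Rightarrow> 'm \<times> 'q \<Rightarrow> real" where
  "metric' w u v = cI q * WI (fst w) (fst u) (fst v) + cJ q * WJ (fst w) (fst u) (fst v)
    + cK q * WK (fst w) (fst u) (fst v) + t * WQ (snd w) (snd u) (snd v)
    + g i m (LL' (snd w) (fst u)) (fst v)"

lemma metric_deriv:
  "((\<lambda>z. \<xi> (i, j) (inv_coord XX (i, j) z) (vec2 u v)) has_derivative (\<lambda>w. metric' w u v)) (at (xM, xQ))"
proof -
  let ?mM = "\<lambda>z. inv_coord M i (fst z)" and ?mQ = "\<lambda>z. inv_coord Q j (snd z)"
  have "((\<lambda>z. cI (?mQ z) * g i (?mM z) (I i (?mM z) (fst u)) (fst v)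
      + cJ (?mQ z) * g i (?mM z) (J i (?mM z) (fst u)) (fst v)
      + cK (?mQ z) * g i (?mM z) (K i (?mM z) (fst u)) (fst v)
      + t * \<omega>Q j (?mQ z) (vec2 (snd u) (snd v)))
    has_derivative (\<lambda>w. metric' w u v)) (at (xM, xQ))"
    by (rule has_derivative_eq_rhs[OF has_derivative_add[OF has_derivative_add[OF has_derivative_add[OF
          has_derivative_mult[OF coeff_z(1) has_derivative_fst_compose[OF W_deriv(1)]]
          has_derivative_mult[OF coeff_z(2) has_derivative_fst_compose[OF W_deriv(2)]]]
          has_derivative_mult[OF coeff_z(3) has_derivative_fst_compose[OF W_deriv(3)]]]
          has_derivative_mult_right[OF has_derivative_snd_compose[OF WQ_deriv]]]])
       (simp add: fun_eq_iff metric'_def comb_def g_simps UM(3) UQ(3))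
  then show ?thesis
  proof (rule has_derivative_transform_within_open[OF _ chart_XX(1,2)])
    fix z assume z: "z \<in> UM \<times> UQ"
    then have "?mM z \<in> dom M i" using inv_coord_in[OF M i] by auto
    then interpret z: quaternionic_hermitian "I i (?mM z)" "J i (?mM z)" "K i (?mM z)" "g i (?mM z)"
      by (rule quaternionic[OF i])
    show "cI (?mQ z) * g i (?mM z) (I i (?mM z) (fst u)) (fst v)
      + cJ (?mQ z) * g i (?mM z) (J i (?mM z) (fst u)) (fst v)
      + cK (?mQ z) * g i (?mM z) (K i (?mM z) (fst u)) (fst v)
      + t * \<omega>Q j (?mQ z) (vec2 (snd u) (snd v)) = \<xi> (i, j) (inv_coord XX (i, j) z) (vec2 u v)"
      by (simp add: chart_XX(3)[OF z] twistor_metric_vec2 z.comb_def z.g_simps)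
  qed
qed

end


section \<open>The complex structure of the twistor space\<close>

context twistor_point
begin

lemma nijenhuis_LL: "nijenhuis LL (\<lambda>w u. cI q *\<^sub>R I' w u + cJ q *\<^sub>R J' w u + cK q *\<^sub>R K' w u) u v = 0"
proof -
  have Q: "quaternionic_hermitian (I i (inv_coord M i y)) (J i (inv_coord M i y)) (K i (inv_coord M i y))
      (g i (inv_coord M i y))" if "y \<in> UM" for y
    by (rule quaternionic[OF i inv_coord_in[OF M i that]])
  from nijenhuis_quat_comb[where I = "\<lambda>x. I i (inv_coord M i x)" and J = "\<lambda>x. J i (inv_coord M i x)"
      and K = "\<lambda>x. K i (inv_coord M i x)" and g = "\<lambda>x. g i (inv_coord M i x)" and u = u and v = v,
      OF UM(1,2) Q IJK_deriv W_deriv W_cyclic coeff_norm]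
  show ?thesis by (simp only: UM(3))
qed

lemma nijenhuis_IQ: "nijenhuis (IQ j q) IQ' u v = 0"
proof -
  have "integrable_structure Q IQ" using kae by (simp add: kaehler_def complex_manifold_def)
  with integrable_structure_iff[OF chart_open[OF Q] chart_inj[OF Q] endo(4) IQ_sq]
  have "nijenhuis (IQ j (inv_coord Q j xQ)) IQ' u v = 0" using j UQ(2) by blast
  then show ?thesis by (simp only: UQ(3))
qed

text \<open>The mixed terms of the Nijenhuis tensor cancel since \<open>LL' (IQ w) = LL (LL' w)\<close>, that is, because
  \<open>h\<close> is holomorphic.\<close>

lemma nijenhuis_TT:
  "nijenhuis (TT (i, j) (m, q))
    (\<lambda>w u. frechet_derivative (\<lambda>z. TT (i, j) (inv_coord XX (i, j) z) u) (at (xM, xQ)) w) u v = 0"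
proof -
  have "frechet_derivative (\<lambda>z. TT (i, j) (inv_coord XX (i, j) z) u) (at (xM, xQ)) =
    (\<lambda>w. (cI q *\<^sub>R I' (fst w) (fst u) + cJ q *\<^sub>R J' (fst w) (fst u) + cK q *\<^sub>R K' (fst w) (fst u)
        + LL' (snd w) (fst u), IQ' (snd w) (snd u)))" for u
    by (rule frechet_derivative_at[symmetric, OF structure_deriv])
  note rules = this twistor_structure_apply fst_conv snd_conv LL'_IQ linear_add[OF linear_comb]
  show ?thesis
    unfolding nijenhuis_def rules
    using nijenhuis_LL[of "fst u" "fst v"] nijenhuis_IQ[of "snd u" "snd v"]
    by (simp add: nijenhuis_def prod_eq_iff algebra_simps linear_add[OF linear_comb])
qed

end

context twistor_data
begin

lemma XX: "smooth_manifold XX"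
  by (rule smooth_manifold_prod[OF M Q])

lemma twistor_point:
  assumes "k \<in> idx XX" "p \<in> dom XX k"
  obtains i j m q where "k = (i, j)" "p = (m, q)" "twistor_point M I J K g Q IQ \<omega>Q h r n t i j m q"
proof -
  obtain i j m q where "k = (i, j)" "p = (m, q)" by (cases k, cases p)
  with assms show ?thesis
    by (intro that[of i j m q] twistor_point.intro twistor_data_axioms)
       (simp_all add: prod_manifold_simps twistor_point_axioms_def)
qed

lemma TT_smooth:
  assumes i: "i \<in> idx M" and j: "j \<in> idx Q"
  shows "smooth_on (coord M i ` dom M i \<times> coord Q j ` dom Q j) (\<lambda>z. TT (i, j) (inv_coord XX (i, j) z) u)"
proof -
  note UM = chart_open[OF M i] and UQ = chart_open[OF Q j]
  let ?S = "coord M i ` dom M i \<times> coord Q j ` dom Q j"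
  have S: "open ?S" by (rule open_Times[OF UM UQ])
  have "smooth_on ?S (\<lambda>z. (cI (inv_coord Q j (snd z)) *\<^sub>R I i (inv_coord M i (fst z)) (fst u)
      + cJ (inv_coord Q j (snd z)) *\<^sub>R J i (inv_coord M i (fst z)) (fst u)
      + cK (inv_coord Q j (snd z)) *\<^sub>R K i (inv_coord M i (fst z)) (fst u), IQ j (inv_coord Q j (snd z)) (snd u)))"
    by (intro smooth_on_Pair[OF S] smooth_on_add[OF S] smooth_on_scaleR[OF S]
        smooth_on_snd[OF UM UQ coeff_smooth(1)[OF j]] smooth_on_snd[OF UM UQ coeff_smooth(2)[OF j]]
        smooth_on_snd[OF UM UQ coeff_smooth(3)[OF j]] smooth_on_fst[OF UM UQ IJK_smooth(1)[OF i]]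
        smooth_on_fst[OF UM UQ IJK_smooth(2)[OF i]] smooth_on_fst[OF UM UQ IJK_smooth(3)[OF i]]
        smooth_on_snd[OF UM UQ IQ_smooth[OF j]])
  then show ?thesis
  proof (rule iffD1[OF smooth_on_cong[OF S], rotated])
    fix z assume "z \<in> ?S"
    then have "inv_coord XX (i, j) z = (inv_coord M i (fst z), inv_coord Q j (snd z))"
      using prod_inv_coord[OF M Q i j] by auto
    then show "(cI (inv_coord Q j (snd z)) *\<^sub>R I i (inv_coord M i (fst z)) (fst u)
      + cJ (inv_coord Q j (snd z)) *\<^sub>R J i (inv_coord M i (fst z)) (fst u)
      + cK (inv_coord Q j (snd z)) *\<^sub>R K i (inv_coord M i (fst z)) (fst u), IQ j (inv_coord Q j (snd z)) (snd u))
      = TT (i, j) (inv_coord XX (i, j) z) u"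
      by (simp add: twistor_structure_apply quat_comb_def)
  qed
qed

lemma tchange_commutes:
  assumes i: "i \<in> idx M" "i' \<in> idx M" and m: "m \<in> dom M i \<inter> dom M i'"
  shows "tchange M i i' m (quat_comb (I i m) (J i m) (K i m) a b c u)
    = quat_comb (I i' m) (J i' m) (K i' m) a b c (tchange M i i' m u)"
proof -
  note lin = tchange_linear[OF M i m]
  have "tchange M i i' m (I i m u) = I i' m (tchange M i i' m u)"
    "tchange M i i' m (J i m u) = J i' m (tchange M i i' m u)"
    "tchange M i i' m (K i m u) = K i' m (tchange M i i' m u)"
    using endo(1-3) i m unfolding endomorphism_field_def by simp_all
  then show ?thesis by (simp add: quat_comb_def linear_add[OF lin] linear_cmul[OF lin])
qed

lemma twistor_endomorphism_field: "endomorphism_field XX TT"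
  unfolding endomorphism_field_def
proof (intro conjI ballI allI)
  fix k p assume "k \<in> idx XX" "p \<in> dom XX k"
  then obtain i j m q where *: "k = (i, j)" "p = (m, q)" "twistor_point M I J K g Q IQ \<omega>Q h r n t i j m q"
    by (rule twistor_point)
  interpret twistor_point M I J K g Q IQ \<omega>Q h r n t i j m q by (rule *)
  show "linear (TT k p)"
    unfolding *(1,2)
    by (rule linearI) (simp_all add: twistor_structure_apply linear_add[OF linear_comb]
      linear_cmul[OF linear_comb] linear_add[OF IQ_linear[OF j q]] linear_cmul[OF IQ_linear[OF j q]])
next
  fix k u assume "k \<in> idx XX"
  then obtain i j where k: "k = (i, j)" "i \<in> idx M" "j \<in> idx Q" by (auto simp: prod_manifold_simps)
  show "smooth_on (coord XX k ` dom XX k) (\<lambda>z. TT k (inv_coord XX k z) u)"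
    unfolding k(1) prod_manifold_simps(3) prod_manifold_image by (rule TT_smooth[OF k(2,3)])
next
  fix k k' p u assume "k \<in> idx XX" "k' \<in> idx XX" "p \<in> dom XX k \<inter> dom XX k'"
  then obtain i j i' j' m q where k: "k = (i, j)" "k' = (i', j')" "p = (m, q)"
    and ij: "i \<in> idx M" "j \<in> idx Q" "i' \<in> idx M" "j' \<in> idx Q"
    and mq: "m \<in> dom M i \<inter> dom M i'" "q \<in> dom Q j \<inter> dom Q j'"
    by (cases k, cases k', cases p) (auto simp: prod_manifold_simps)
  have "tchange Q j j' q (IQ j q v) = IQ j' q (tchange Q j j' q v)" for v
    using endo(4) ij mq unfolding endomorphism_field_def by simp
  then show "tchange XX k k' p (TT k p u) = TT k' p (tchange XX k k' p u)"
    unfolding k prod_tchange[OF M Q ij mq] twistor_structure_apply fst_conv snd_conv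
    by (simp only: tchange_commutes[OF ij(1,3) mq(1)])
qed

lemma TT_sq:
  assumes "k \<in> idx XX" "p \<in> dom XX k"
  shows "TT k p (TT k p u) = - u"
proof -
  obtain i j m q where *: "k = (i, j)" "p = (m, q)" "twistor_point M I J K g Q IQ \<omega>Q h r n t i j m q"
    using twistor_point[OF assms] .
  interpret twistor_point M I J K g Q IQ \<omega>Q h r n t i j m q by (rule *)
  show ?thesis
    unfolding *(1,2) by (simp add: twistor_structure_apply comb_sq[OF coeff_norm] IQ_sq[OF j q] prod_eq_iff)
qed

lemma complex_manifold_XX: "complex_manifold (r + n) XX TT"
  unfolding complex_manifold_def
proof (intro conjI ballI allI)
  show "smooth_manifold XX" by (rule XX)
  show "DIM('m \<times> 'q) = 2 * (r + n)" using dim by simp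
  show "endomorphism_field XX TT" by (rule twistor_endomorphism_field)
  show "TT k p (TT k p u) = - u" if "k \<in> idx XX" "p \<in> dom XX k" for k p u
    by (rule TT_sq[OF that])
  show "integrable_structure XX TT"
  proof (rule iffD2[OF integrable_structure_iff[OF chart_open[OF XX] chart_inj[OF XX]
        twistor_endomorphism_field TT_sq]], assumption, assumption, assumption, assumption,
      intro ballI allI)
    fix k x u v assume k: "k \<in> idx XX" and "x \<in> coord XX k ` dom XX k"
    then obtain p where p: "p \<in> dom XX k" "x = coord XX k p" by blast
    obtain i j m q where *: "k = (i, j)" "p = (m, q)" "twistor_point M I J K g Q IQ \<omega>Q h r n t i j m q"
      using twistor_point[OF k p(1)] .
    interpret twistor_point M I J K g Q IQ \<omega>Q h r n t i j m q by (rule *)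
    have "inv_coord XX k x = (m, q)" using inv_coord_coord[OF XX k p(1)] p(2) *(2) by simp
    moreover have "x = (xM, xQ)" using p(2) * coord_XX by simp
    ultimately show "nijenhuis (TT k (inv_coord XX k x))
        (\<lambda>w u. frechet_derivative (\<lambda>y. TT k (inv_coord XX k y) u) (at x) w) u v = 0"
      unfolding *(1) using nijenhuis_TT by simp
  qed
qed

end


section \<open>Positivity\<close>

context twistor_point
begin

lemma metric_alternating: "alternating_form 2 (\<xi> (i, j) (m, q))"
proof -
  let ?\<beta> = "\<lambda>u v. g i m (LL (fst u)) (fst v) + t * \<omega>Q j q (vec2 (snd u) (snd v))"
  note alt = \<omega>Q_alternating[OF j q]
  note \<omega>_bil = alternating_form_2_imp_bilinear[OF alt]
  have "bilinear ?\<beta>"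
    unfolding bilinear_def
    by (intro conjI allI linearI)
       (simp_all add: g_simps linear_add[OF linear_comb] linear_cmul[OF linear_comb]
         bilinear_ladd[OF \<omega>_bil] bilinear_radd[OF \<omega>_bil] bilinear_lmul[OF \<omega>_bil] bilinear_rmul[OF \<omega>_bil]
         algebra_simps)
  moreover have "?\<beta> u u = 0" for u
    by (simp add: comb_self alternating_form_2_self[OF alt])
  ultimately have "alternating_form 2 (\<lambda>d. ?\<beta> (d 0) (d 1))" by (rule alternating_form_2_bilinear)
  moreover have "(\<lambda>d. ?\<beta> (d 0) (d 1)) = \<xi> (i, j) (m, q)"
  proof
    fix d :: "nat \<Rightarrow> 'm \<times> 'q"
    have "\<omega>Q j q (\<lambda>l. snd (d l)) = \<omega>Q j q (vec2 (snd (d 0)) (snd (d 1)))"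
      by (rule alternating_form_2_vec2[OF alt])
    then show "?\<beta> (d 0) (d 1) = \<xi> (i, j) (m, q) d" by (simp add: twistor_metric_apply)
  qed
  ultimately show ?thesis by simp
qed

lemma metric_invariant: "\<xi> (i, j) (m, q) (vec2 (TT (i, j) (m, q) u) (TT (i, j) (m, q) v)) = \<xi> (i, j) (m, q) (vec2 u v)"
proof -
  have "\<omega>Q j q (vec2 (IQ j q u) (IQ j q v)) = \<omega>Q j q (vec2 u v)" for u v
    using kae j q by (simp add: kaehler_def positive_11_form_def)
  then show ?thesis
    by (simp add: twistor_metric_vec2 twistor_structure_apply comb_isometry[OF coeff_norm])
qed

lemma metric_positive:
  assumes "u \<noteq> 0"
  shows "\<xi> (i, j) (m, q) (vec2 u (TT (i, j) (m, q) u)) > 0"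
proof -
  have \<omega>_pos: "\<omega>Q j q (vec2 v (IQ j q v)) > 0" if "v \<noteq> 0" for v
    using kae j q that by (simp add: kaehler_def positive_11_form_def)
  note \<omega>_bil = alternating_form_2_imp_bilinear[OF \<omega>Q_alternating[OF j q]]
  have \<omega>_nonneg: "\<omega>Q j q (vec2 v (IQ j q v)) \<ge> 0" for v
    using \<omega>_pos[of v] bilinear_lzero[OF \<omega>_bil] by (cases "v = 0") auto
  have g_nonneg: "g i m v v \<ge> 0" for v using g_pos[of v] by (cases "v = 0") (auto simp: g_simps)
  have eq: "\<xi> (i, j) (m, q) (vec2 u (TT (i, j) (m, q) u))
      = g i m (fst u) (fst u) + t * \<omega>Q j q (vec2 (snd u) (IQ j q (snd u)))"
    by (simp add: twistor_metric_vec2 twistor_structure_apply comb_isometry[OF coeff_norm])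
  from assms have "fst u \<noteq> 0 \<or> snd u \<noteq> 0" by (auto simp: prod_eq_iff)
  then show ?thesis
    unfolding eq using t g_pos[of "fst u"] \<omega>_pos[of "snd u"] g_nonneg[of "fst u"] \<omega>_nonneg[of "snd u"]
    by (auto intro: add_pos_nonneg add_nonneg_pos)
qed

end

context twistor_data
begin

lemma \<xi>_smooth:
  assumes i: "i \<in> idx M" and j: "j \<in> idx Q"
  shows "smooth_on (coord M i ` dom M i \<times> coord Q j ` dom Q j) (\<lambda>z. \<xi> (i, j) (inv_coord XX (i, j) z) d)"
proof -
  note UM = chart_open[OF M i] and UQ = chart_open[OF Q j]
  let ?S = "coord M i ` dom M i \<times> coord Q j ` dom Q j"
  let ?mM = "\<lambda>z. inv_coord M i (fst z)" and ?mQ = "\<lambda>z. inv_coord Q j (snd z)"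
  have S: "open ?S" by (rule open_Times[OF UM UQ])
  have "smooth_on ?S (\<lambda>z. cI (?mQ z) * g i (?mM z) (I i (?mM z) (fst (d 0))) (fst (d 1))
      + cJ (?mQ z) * g i (?mM z) (J i (?mM z) (fst (d 0))) (fst (d 1))
      + cK (?mQ z) * g i (?mM z) (K i (?mM z) (fst (d 0))) (fst (d 1))
      + t * \<omega>Q j (?mQ z) (\<lambda>l. snd (d l)))"
    by (intro smooth_on_add[OF S] smooth_on_mult[OF S] smooth_on_const[OF S]
        smooth_on_snd[OF UM UQ coeff_smooth(1)[OF j]] smooth_on_snd[OF UM UQ coeff_smooth(2)[OF j]]
        smooth_on_snd[OF UM UQ coeff_smooth(3)[OF j]] smooth_on_fst[OF UM UQ fundamental_smooth(1)[OF i]]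
        smooth_on_fst[OF UM UQ fundamental_smooth(2)[OF i]] smooth_on_fst[OF UM UQ fundamental_smooth(3)[OF i]]
        smooth_on_snd[OF UM UQ \<omega>Q_smooth[OF j]])
  then show ?thesis
  proof (rule iffD1[OF smooth_on_cong[OF S], rotated])
    fix z assume z: "z \<in> ?S"
    then have inv: "inv_coord XX (i, j) z = (?mM z, ?mQ z)"
      using prod_inv_coord[OF M Q i j] by auto
    have "?mM z \<in> dom M i" using z inv_coord_in[OF M i] by auto
    then interpret z: quaternionic_hermitian "I i (?mM z)" "J i (?mM z)" "K i (?mM z)" "g i (?mM z)"
      by (rule quaternionic[OF i])
    show "cI (?mQ z) * g i (?mM z) (I i (?mM z) (fst (d 0))) (fst (d 1))
      + cJ (?mQ z) * g i (?mM z) (J i (?mM z) (fst (d 0))) (fst (d 1))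
      + cK (?mQ z) * g i (?mM z) (K i (?mM z) (fst (d 0))) (fst (d 1))
      + t * \<omega>Q j (?mQ z) (\<lambda>l. snd (d l)) = \<xi> (i, j) (inv_coord XX (i, j) z) d"
      by (simp add: inv twistor_metric_apply z.comb_def z.g_simps)
  qed
qed

lemma \<xi>_diff_form: "diff_form 2 XX \<xi>"
  unfolding diff_form_def
proof (intro conjI ballI allI)
  fix k p assume "k \<in> idx XX" "p \<in> dom XX k"
  then obtain i j m q where *: "k = (i, j)" "p = (m, q)" "twistor_point M I J K g Q IQ \<omega>Q h r n t i j m q"
    by (rule twistor_point)
  show "alternating_form 2 (\<xi> k p)"
    unfolding *(1,2) by (rule twistor_point.metric_alternating[OF *(3)])
next
  fix k d assume "k \<in> idx XX"
  then obtain i j where k: "k = (i, j)" "i \<in> idx M" "j \<in> idx Q" by (auto simp: prod_manifold_simps)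
  show "smooth_on (coord XX k ` dom XX k) (\<lambda>z. \<xi> k (inv_coord XX k z) d)"
    unfolding k(1) prod_manifold_simps(3) prod_manifold_image by (rule \<xi>_smooth[OF k(2,3)])
next
  fix k k' p d assume "k \<in> idx XX" "k' \<in> idx XX" "p \<in> dom XX k \<inter> dom XX k'"
  then obtain i j i' j' m q where k: "k = (i, j)" "k' = (i', j')" "p = (m, q)"
    and ij: "i \<in> idx M" "j \<in> idx Q" "i' \<in> idx M" "j' \<in> idx Q"
    and mq: "m \<in> dom M i \<inter> dom M i'" "q \<in> dom Q j \<inter> dom Q j'"
    by (cases k, cases k', cases p) (auto simp: prod_manifold_simps)
  have "diff_form 2 Q \<omega>Q" using kae by (simp add: kaehler_def positive_11_form_def)
  then have \<omega>: "\<omega>Q j' q (\<lambda>l. tchange Q j j' q (v l)) = \<omega>Q j q v" for v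
    using ij mq unfolding diff_form_def by blast
  have g: "g i' m (tchange M i i' m u) (tchange M i i' m v) = g i m u v" for u v
    using metric ij mq unfolding riemannian_metric_def by blast
  show "\<xi> k' p (\<lambda>l. tchange XX k k' p (d l)) = \<xi> k p d"
    unfolding k prod_tchange[OF M Q ij mq] twistor_metric_apply fst_conv snd_conv
      tchange_commutes[OF ij(1,3) mq(1), symmetric] g \<omega> ..
qed

lemma \<xi>_positive: "positive_11_form XX TT \<xi>"
  unfolding positive_11_form_def
proof (intro conjI ballI allI impI \<xi>_diff_form)
  fix k p u v assume k: "k \<in> idx XX" "p \<in> dom XX k"
  obtain i j m q where *: "k = (i, j)" "p = (m, q)" "twistor_point M I J K g Q IQ \<omega>Q h r n t i j m q"
    by (rule twistor_point[OF k])
  show "\<xi> k p (vec2 (TT k p u) (TT k p v)) = \<xi> k p (vec2 u v)"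
    unfolding *(1,2) by (rule twistor_point.metric_invariant[OF *(3)])
  show "\<xi> k p (vec2 u (TT k p u)) > 0" if "u \<noteq> 0"
    unfolding *(1,2) by (rule twistor_point.metric_positive[OF *(3) that])
qed

end


section \<open>The power of the metric\<close>

context twistor_point
begin

definition twist :: "'m \<times> 'q \<Rightarrow> 'm \<times> 'q \<Rightarrow> 'm \<times> 'q \<Rightarrow> real" where
  "twist w u v = g i m (LL' (snd w) (fst u)) (fst v)"

text \<open>The forms \<open>\<omega>\<^sub>I\<close>, \<open>\<omega>\<^sub>J\<close>, \<open>\<omega>\<^sub>K\<close>, \<open>\<omega>\<^sub>Q\<close> are closed, so \<open>d\<xi>\<close> is the cyclic sum of \<open>twist\<close>.\<close>

lemma metric'_twist_cyclic:
  "(metric' w u v - twist w u v) + (metric' u v w - twist u v w) + (metric' v w u - twist v w u) = 0"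
proof -
  have "(metric' w u v - twist w u v) + (metric' u v w - twist u v w) + (metric' v w u - twist v w u)
    = cI q * (WI (fst w) (fst u) (fst v) + WI (fst u) (fst v) (fst w) + WI (fst v) (fst w) (fst u))
    + cJ q * (WJ (fst w) (fst u) (fst v) + WJ (fst u) (fst v) (fst w) + WJ (fst v) (fst w) (fst u))
    + cK q * (WK (fst w) (fst u) (fst v) + WK (fst u) (fst v) (fst w) + WK (fst v) (fst w) (fst u))
    + t * (WQ (snd w) (snd u) (snd v) + WQ (snd u) (snd v) (snd w) + WQ (snd v) (snd w) (snd u))"
    by (simp only: metric'_def twist_def) (simp add: algebra_simps)
  then show ?thesis by (simp only: W_cyclic WQ_cyclic mult_zero_right add_0_right)
qed

lemma LL'_linear: "LL' (a + b) u = LL' a u + LL' b u" "LL' (c *\<^sub>R a) u = c *\<^sub>R LL' a u"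
  by (simp_all add: comb_def linear_add[OF coeff_deriv_linear(1)] linear_add[OF coeff_deriv_linear(2)]
    linear_add[OF coeff_deriv_linear(3)] linear_cmul[OF coeff_deriv_linear(1)]
    linear_cmul[OF coeff_deriv_linear(2)] linear_cmul[OF coeff_deriv_linear(3)] algebra_simps)

lemma LL'_0: "LL' 0 u = 0"
  using LL'_linear(2)[of 0 0 u] by simp

lemma twist_linear: "linear (\<lambda>w. twist w u v)" "linear (\<lambda>u. twist w u v)" "linear (\<lambda>v. twist w u v)"
  by (rule linearI; simp add: twist_def LL'_linear g_simps linear_add[OF linear_comb] linear_cmul[OF linear_comb])+

text \<open>Unitary bases of the two factors form a basis of the product which is adapted to the metric. On
  it \<open>twist a b (\<tau> b)\<close> vanishes, because \<open>LL' a\<close> is orthogonal to \<open>LL\<close>.\<close>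

lemma leibniz_sum_twist:
  assumes k: "k < r + n - 1"
  shows "leibniz_sum twist (\<lambda>u v. \<xi> (i, j) (m, q) (vec2 u v)) (r + n - 1) k d = 0"
proof -
  let ?\<omega> = "\<lambda>u v. \<omega>Q j q (vec2 u v)" and ?R = "IQ j q"
  note alt = \<omega>Q_alternating[OF j q]
  note \<omega>_bil = alternating_form_2_imp_bilinear[OF alt]
  note linR = IQ_linear[OF j q] and sqR = IQ_sq[OF j q]
  have \<omega>_inv: "?\<omega> (?R u) (?R v) = ?\<omega> u v" for u v
    using kae j q by (simp add: kaehler_def positive_11_form_def)
  have \<omega>_pos: "?\<omega> u (?R u) > 0" if "u \<noteq> 0" for u
    using kae j q that by (simp add: kaehler_def positive_11_form_def)
  obtain E \<tau>M where E: "finite E" "card E = DIM('m)" "span E = UNIV"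
    and \<tau>M: "\<And>b. b \<in> E \<Longrightarrow> \<tau>M b \<in> E \<and> \<tau>M b \<noteq> b \<and> \<tau>M (\<tau>M b) = b"
      "\<And>b. b \<in> E \<Longrightarrow> \<tau>M b = LL b \<or> \<tau>M b = - LL b"
    and g_E: "\<And>b c. b \<in> E \<Longrightarrow> c \<in> E \<Longrightarrow> g i m (LL b) c \<noteq> 0 \<Longrightarrow> c = \<tau>M b"
    by (rule unitary_basis[of LL "g i m", OF linear_comb comb_sq[OF coeff_norm] g g_sym g_pos
          comb_isometry[OF coeff_norm]]) (assumption | rule that)+
  \<comment> \<open>On \<open>Q\<close> the Riemannian metric is \<open>\<omega>(u, I v)\<close>, and \<open>\<omega>\<close> is recovered from it by invariance.\<close>
  obtain F \<tau>Q where F: "finite F" "card F = DIM('q)" "span F = UNIV"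
    and \<tau>Q: "\<And>b. b \<in> F \<Longrightarrow> \<tau>Q b \<in> F \<and> \<tau>Q b \<noteq> b \<and> \<tau>Q (\<tau>Q b) = b"
      "\<And>b. b \<in> F \<Longrightarrow> \<tau>Q b = ?R b \<or> \<tau>Q b = - ?R b"
    and \<omega>_F: "\<And>b c. b \<in> F \<Longrightarrow> c \<in> F \<Longrightarrow> ?\<omega> (?R b) (?R c) \<noteq> 0 \<Longrightarrow> c = \<tau>Q b"
  proof (rule unitary_basis[OF linR sqR, of "\<lambda>u v. ?\<omega> u (?R v)"])
    show "bilinear (\<lambda>u v. ?\<omega> u (?R v))"
      unfolding bilinear_def
      by (intro conjI allI linearI)
         (simp_all add: linear_add[OF linR] linear_cmul[OF linR] bilinear_ladd[OF \<omega>_bil]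
           bilinear_radd[OF \<omega>_bil] bilinear_lmul[OF \<omega>_bil] bilinear_rmul[OF \<omega>_bil])
    show "?\<omega> u (?R v) = ?\<omega> v (?R u)" for u v
      using \<omega>_inv[of u "?R v"] alternating_form_2_skew[OF alt, of "?R u" v]
      by (simp add: sqR bilinear_rneg[OF \<omega>_bil])
  qed (use \<omega>_inv \<omega>_pos in blast)+
  have 0: "0 \<notin> E" "0 \<notin> F"
    using \<tau>M(1,2)[of 0] \<tau>Q(1,2)[of 0] linear_0[OF linear_comb] linear_0[OF linR] by auto
  define B where "B = (\<lambda>e. (e, 0)) ` E \<union> (\<lambda>f. (0, f)) ` F"
  define P where "P = (\<lambda>b::'m \<times> 'q. fst b \<noteq> 0)"
  define \<tau> where "\<tau> b = (if P b then (\<tau>M (fst b), 0) else (0, \<tau>Q (snd b)))" for b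
  have B_cases: "(\<exists>e\<in>E. b = (e, 0) \<and> P b \<and> \<tau> b = (\<tau>M e, 0)) \<or> (\<exists>f\<in>F. b = (0, f) \<and> \<not> P b \<and> \<tau> b = (0, \<tau>Q f))"
    if "b \<in> B" for b
    using that 0 by (auto simp: B_def P_def \<tau>_def)
  show ?thesis
  proof (rule leibniz_sum_eq_0[where B = B and \<tau> = \<tau> and P = P, OF twist_linear _ k])
    show "bilinear (\<lambda>u v. \<xi> (i, j) (m, q) (vec2 u v))"
      by (rule alternating_form_2_imp_bilinear[OF metric_alternating])
    show "finite B" using E F by (simp add: B_def)
    have "card B = card E + card F"
      unfolding B_def using E(1) F(1) 0
      by (subst card_Un_disjoint) (auto simp: card_image inj_on_def)
    then have "card B = 2 * (r + n)" using E F dim by simp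
    moreover have "r > 0" using dim(1) DIM_positive[where 'a = 'm] by simp
    ultimately show "card B = 2 * (r + n - 1) + 2" by simp
    show "span B = UNIV"
    proof (rule set_eqI, rule iffI, rule UNIV_I)
      fix z :: "'m \<times> 'q"
      have "(u, 0) \<in> span B" for u
      proof -
        have "linear (\<lambda>e::'m. (e, 0::'q))" by (rule linearI) auto
        from linear_span_image[OF this, of E] have "(u, 0) \<in> span ((\<lambda>e. (e, 0::'q)) ` E)"
          using E(3) rangeI[of "\<lambda>e. (e, 0::'q)" u] by simp
        then show ?thesis using span_mono[of _ B] by (auto simp: B_def)
      qed
      moreover have "(0, v) \<in> span B" for v
      proof -
        have "linear (\<lambda>f::'q. (0::'m, f))" by (rule linearI) auto
        from linear_span_image[OF this, of F] have "(0, v) \<in> span ((\<lambda>f. (0::'m, f)) ` F)"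
          using F(3) rangeI[of "\<lambda>f. (0::'m, f)" v] by simp
        then show ?thesis using span_mono[of _ B] by (auto simp: B_def)
      qed
      ultimately have "(fst z, 0) + (0, snd z) \<in> span B" by (intro span_add)
      then show "z \<in> span B" by simp
    qed
    show "\<tau> b \<in> B \<and> \<tau> b \<noteq> b \<and> \<tau> (\<tau> b) = b \<and> P (\<tau> b) = P b" if b: "b \<in> B" for b
    proof -
      have "\<tau>M e \<noteq> 0" if "e \<in> E" for e using \<tau>M(1)[OF that] 0(1) by metis
      then show ?thesis
        using B_cases[OF b] \<tau>M(1) \<tau>Q(1) 0 by (auto simp: B_def P_def \<tau>_def)
    qed
    show "c = \<tau> b" if b: "b \<in> B" and c: "c \<in> B" and nz: "\<xi> (i, j) (m, q) (vec2 b c) \<noteq> 0" for b c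
      using B_cases[OF b] B_cases[OF c] nz g_E \<omega>_F
      by (auto simp: twistor_metric_vec2 \<omega>_inv bilinear_lzero[OF \<omega>_bil] bilinear_rzero[OF \<omega>_bil]
        g_simps linear_0[OF linear_comb])
    show "\<not> P a \<and> P b \<and> P c \<and> c \<noteq> \<tau> b"
      if a: "a \<in> B" and b: "b \<in> B" and c: "c \<in> B" and nz: "twist a b c \<noteq> 0" for a b c
    proof -
      have "\<not> P a" using B_cases[OF a] nz by (auto simp: twist_def LL'_0 g_simps)
      moreover have Pb: "P b" "P c" using nz by (auto simp: P_def twist_def linear_0[OF linear_comb] g_simps)
      moreover have "c \<noteq> \<tau> b"
      proof
        assume c: "c = \<tau> b"
        obtain e where e: "e \<in> E" "b = (e, 0)" "\<tau> b = (\<tau>M e, 0)" using B_cases[OF b] Pb by auto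
        have "g i m (LL' (snd a) e) (LL e) = 0"
          by (rule comb_orthogonal[OF coeff_deriv_orthogonal])
        then have "g i m (LL' (snd a) e) (\<tau>M e) = 0"
          using \<tau>M(2)[OF e(1)] by (elim disjE) (simp_all add: g_simps)
        moreover have "fst b = e" "fst c = \<tau>M e" using c e by simp_all
        ultimately have "twist a b c = 0" by (simp add: twist_def)
        with nz show False by simp
      qed
      ultimately show ?thesis by blast
    qed
  qed
qed

lemma ext_deriv_power:
  "ext_deriv (2 * (r + n - 1)) XX (form_power 2 \<xi> (r + n - 1)) (i, j) (m, q) d = 0"
proof -
  let ?X = "\<lambda>u v. \<xi> (i, j) (m, q) (vec2 u v)"
  have "ext_deriv (2 * (r + n - 1)) XX (form_power 2 \<xi> (r + n - 1)) (i, j) (m, q) d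
    = (\<Sum>k<r + n - 1. leibniz_sum metric' ?X (r + n - 1) k d) / 2 ^ (r + n - 1)"
  proof (rule ext_deriv_form_power_2[where S = "UM \<times> UQ"])
    show "open (UM \<times> UQ)" by (rule chart_XX(1))
    show "coord XX (i, j) (m, q) \<in> UM \<times> UQ" unfolding coord_XX by (rule chart_XX(2))
    show "inv_coord XX (i, j) (coord XX (i, j) (m, q)) = (m, q)"
      unfolding coord_XX chart_XX(3)[OF chart_XX(2)] by (simp add: UM(3) UQ(3))
    show "((\<lambda>y. \<xi> (i, j) (inv_coord XX (i, j) y) (vec2 u v)) has_derivative (\<lambda>w. metric' w u v))
        (at (coord XX (i, j) (m, q)))" for u v
      unfolding coord_XX by (rule metric_deriv)
    show "\<xi> (i, j) (inv_coord XX (i, j) y) v = \<xi> (i, j) (inv_coord XX (i, j) y) (vec2 (v 0) (v 1))"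
      if y: "y \<in> UM \<times> UQ" for y v
    proof -
      have "twistor_point M I J K g Q IQ \<omega>Q h r n t i j (inv_coord M i (fst y)) (inv_coord Q j (snd y))"
        using y inv_coord_in[OF M i] inv_coord_in[OF Q j] i j
        by (intro twistor_point.intro twistor_data_axioms twistor_point_axioms.intro) auto
      from alternating_form_2_vec2[OF twistor_point.metric_alternating[OF this]]
      show ?thesis unfolding chart_XX(3)[OF y] .
    qed
  qed
  also have "leibniz_sum metric' ?X (r + n - 1) k d = 0" if k: "k < r + n - 1" for k
  proof -
    have "leibniz_sum (\<lambda>w u v. metric' w u v - twist w u v) ?X (r + n - 1) k d = 0"
      by (rule leibniz_sum_cyclic[OF k metric'_twist_cyclic])
    then show ?thesis using leibniz_sum_twist[OF k, of d] unfolding leibniz_sum_diff by linarith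
  qed
  then have "(\<Sum>k<r + n - 1. leibniz_sum metric' ?X (r + n - 1) k d) / 2 ^ (r + n - 1) = 0"
    by simp
  finally show ?thesis .
qed

end

context twistor_data
begin

lemma closed_power: "closed_form (2 * (r + n - 1)) XX (form_power 2 \<xi> (r + n - 1))"
  unfolding closed_form_def
proof (intro ballI allI)
  fix k p d assume "k \<in> idx XX" "p \<in> dom XX k"
  then obtain i j m q where *: "k = (i, j)" "p = (m, q)" "twistor_point M I J K g Q IQ \<omega>Q h r n t i j m q"
    by (rule twistor_point)
  show "ext_deriv (2 * (r + n - 1)) XX (form_power 2 \<xi> (r + n - 1)) k p d = 0"
    unfolding *(1,2) by (rule twistor_point.ext_deriv_power[OF *(3)])
qed

end


section \<open>Failure of the Kaehler condition\<close>

context twistor_point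
begin

text \<open>On one vector tangent to \<open>Q\<close> and two vectors tangent to \<open>M\<close>, only one of the three cyclic
  terms of \<open>twist\<close> is left. So \<open>LL' w = 0\<close> if the metric is closed.\<close>

lemma closed_imp_coeff_deriv_0:
  assumes "closed_form 2 XX \<xi>"
  shows "dI w = 0 \<and> dJ w = 0 \<and> dK w = 0"
proof -
  have pt: "twistor_point M I J K g Q IQ \<omega>Q h r n t i j m' q'" if "(m', q') \<in> dom XX (i, j)" for m' q'
    using that i j by (intro twistor_point.intro twistor_data_axioms twistor_point_axioms.intro)
      (auto simp: prod_manifold_simps)
  have cyc: "metric' w u v + metric' u v w + metric' v w u = 0" for w u v
  proof (rule closed_form_2_cyclic[OF XX _ _ _ _ assms, where i = "(i, j)" and p = "(m, q)"])
    show "(i, j) \<in> idx XX" "(m, q) \<in> dom XX (i, j)" using i j m q by (auto simp: prod_manifold_simps)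
    show "((\<lambda>y. \<xi> (i, j) (inv_coord XX (i, j) y) (vec2 u v)) has_derivative (\<lambda>w. metric' w u v))
        (at (coord XX (i, j) (m, q)))" for u v
      unfolding coord_XX by (rule metric_deriv)
    show "alternating_form 2 (\<xi> (i, j) p)" if "p \<in> dom XX (i, j)" for p
      using twistor_point.metric_alternating[OF pt[of "fst p" "snd p"]] that by simp
  qed
  obtain u :: 'm where u: "u \<noteq> 0" using nonempty_Basis nonzero_Basis by blast
  have "g i m (LL' w u) v = 0" for v
    using metric'_twist_cyclic[of "(0, w)" "(u, 0)" "(v, 0)"] cyc[of "(0, w)" "(u, 0)" "(v, 0)"]
    by (simp add: twist_def LL'_0 g_simps)
  then have "LL' w u = 0" using g_pos by (metis less_irrefl)
  with u show ?thesis using comb_eq_0D by blast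
qed

end

context twistor_data
begin

text \<open>On a ball in a chart the coefficients are constant, as their derivatives vanish there, and they
  determine the value of \<open>h\<close> within a chart of the projective line.\<close>

lemma closed_imp_locally_constant:
  assumes closed: "closed_form 2 XX \<xi>" and "topspace (mtop M) \<noteq> {}"
  shows "locally_constant Q h"
  unfolding locally_constant_def
proof
  fix q assume "q \<in> topspace (mtop Q)"
  then obtain j where j: "j \<in> idx Q" and q: "q \<in> dom Q j"
    using Q unfolding smooth_manifold_def by blast
  obtain i m where i: "i \<in> idx M" and m: "m \<in> dom M i"
    using assms(2) M unfolding smooth_manifold_def by blast
  obtain b S where S: "open S" "coord Q j q \<in> S" "S \<subseteq> coord Q j ` dom Q j"
    and b: "\<And>y. y \<in> S \<Longrightarrow> cp1_dom b (h (inv_coord Q j y))"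
    by (rule coeff_local[OF j q]) blast
  obtain e where e: "e > 0" "ball (coord Q j q) e \<subseteq> S" using S(1,2) by (auto simp: open_contains_ball)
  let ?B = "ball (coord Q j q) e"
  define U where "U = {p \<in> dom Q j. coord Q j p \<in> ?B}"
  have zero: "((\<lambda>y. cI (inv_coord Q j y)) has_derivative (\<lambda>w. 0)) (at y)"
    "((\<lambda>y. cJ (inv_coord Q j y)) has_derivative (\<lambda>w. 0)) (at y)"
    "((\<lambda>y. cK (inv_coord Q j y)) has_derivative (\<lambda>w. 0)) (at y)" if y: "y \<in> ?B" for y
  proof -
    obtain p where p: "p \<in> dom Q j" "y = coord Q j p" using y e(2) S(3) by blast
    interpret twistor_point M I J K g Q IQ \<omega>Q h r n t i j m p
      by (intro twistor_point.intro twistor_data_axioms twistor_point_axioms.intro i j m p(1))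
    have "dI = (\<lambda>w. 0)" "dJ = (\<lambda>w. 0)" "dK = (\<lambda>w. 0)"
      using closed_imp_coeff_deriv_0[OF closed] by auto
    with coeff_deriv show "((\<lambda>y. cI (inv_coord Q j y)) has_derivative (\<lambda>w. 0)) (at y)"
      "((\<lambda>y. cJ (inv_coord Q j y)) has_derivative (\<lambda>w. 0)) (at y)"
      "((\<lambda>y. cK (inv_coord Q j y)) has_derivative (\<lambda>w. 0)) (at y)"
      by (simp_all only: p(2))
  qed
  have const: "f y = f (coord Q j q)"
    if "\<And>y. y \<in> ?B \<Longrightarrow> (f has_derivative (\<lambda>w. 0)) (at y)" "y \<in> ?B" for f :: "'q \<Rightarrow> real" and y
  proof -
    have "\<exists>c. \<forall>y\<in>?B. f y = c"
      by (rule has_derivative_zero_constant[OF convex_ball], rule has_derivative_at_withinI, rule that(1))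
    moreover have "coord Q j q \<in> ?B" using e(1) by simp
    ultimately show ?thesis using that(2) by metis
  qed
  have "h p = h q" if "p \<in> U" for p
  proof -
    have p: "p \<in> dom Q j" "coord Q j p \<in> ?B" using that by (auto simp: U_def)
    have inv: "inv_coord Q j (coord Q j p) = p" "inv_coord Q j (coord Q j q) = q"
      by (rule inv_coord_coord[OF Q j]; fact)+
    show ?thesis
    proof (rule twistor_coeff_inj)
      show "cp1_dom b (h p)" "cp1_dom b (h q)"
        using b[of "coord Q j p"] b[OF S(2)] p(2) e(2) inv by auto
      show "cI p = cI q" "cJ p = cJ q" "cK p = cK q"
        using const[OF zero(1) p(2)] const[OF zero(2) p(2)] const[OF zero(3) p(2)]
        unfolding inv by blast+
    qed
  qed
  then have "h constant_on U" unfolding constant_on_def by blast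
  moreover have "openin (mtop Q) U" unfolding U_def by (rule chart_preimage_openin[OF Q j open_ball])
  moreover have "q \<in> U" using q e(1) by (simp add: U_def)
  ultimately show "\<exists>U. openin (mtop Q) U \<and> q \<in> U \<and> h constant_on U"
    by (intro exI[of _ U] conjI)
qed

end

theorem theorem3p3:
  fixes M :: "('i, 'a, 'm::euclidean_space) manifold"
    and I J K :: "('i, 'a, 'm) endo_field"
    and g :: "('i, 'a, 'm) metric_field"
    and Q :: "('j, 'b, 'q::euclidean_space) manifold"
    and IQ :: "('j, 'b, 'q) endo_field"
    and \<omega>Q :: "('j, 'b, 'q) form_field"
    and h :: "'b \<Rightarrow> cp1"
    and r n :: nat
    and t :: real
  assumes "hyperkaehler r M I J K g"
    and "kaehler n Q IQ \<omega>Q"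
    and "holomorphic_map Q IQ cp1_manifold cp1_structure h"
    and "t > 0"
  shows "balanced_metric (r + n) (prod_manifold M Q) (twistor_structure I J K IQ h)
           (twistor_metric I J K g h \<omega>Q t)
    \<and> (topspace (mtop M) \<noteq> {} \<and> \<not> locally_constant Q h \<longrightarrow>
         \<not> kaehler (r + n) (prod_manifold M Q) (twistor_structure I J K IQ h)
           (twistor_metric I J K g h \<omega>Q t))"
proof -
  interpret twistor_data M I J K g Q IQ \<omega>Q h r n t
    using assms by (rule twistor_data.intro)
  show ?thesis
    using complex_manifold_XX \<xi>_positive closed_power closed_imp_locally_constant
    unfolding balanced_metric_def kaehler_def by blast
qed

end
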